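(* Every maximal $\tau$-standard chain $\underline\theta:(\theta_\ell,I_\ell)>\dots>(\theta_0,I_0)$ in $\underline W(\underline\lambda,\tau)$ (maximal among $\tau$-standard chains) has exactly one defining chain $(\bar\theta_\ell,I_\ell)>\dots>(\bar\theta_0,I_0)$, and this defining chain is a maximal chain of $W(\underline\lambda,\tau)$ (it starts at $(\tau,[m])$, ends at $(\mathrm{id}W_Q,I_0)$, and has length $r(\tau)+m-1$, where $r$ is the rank function of $W/W_Q$). Moreover, for each $k$, $\bar\theta_k$ is $Q_k$-minimal and $Q^k$-maximal, where $Q_k=\bigcap_{r=0}^kP_{I_r}$ and $Q^k=Q_\tau\cap\bigcap_{r=k}^{\ell}P_{I_r}$.
   Context: Let $\mathbb K$ be algebraically closed of characteristic zero, $G$ a connected, simply-connected, simple algebraic group over $\mathbb K$, $T\subseteq B$ maximal torus and Borel, $W$ the Weyl group, $W_\nu$ the stabilizer of a weight $\nu$. Parabolic subgroups contain $B$; $W/W_{Q'}$ carries the Bruhat order (a graded poset); for $Q_1\subseteq Q_2$, $\pi_{Q_2}:W/W_{Q_1}\to W/W_{Q_2}$ is the projection and $\min_{Q_1},\max_{Q_1}$ give the minimal/maximal preimages; an element of $W/W_{Q_1}$ is $Q_2$-minimal (resp. $Q_2$-maximal) if it lies in the image of $\min_{Q_1}$ (resp. $\max_{Q_1}$). Standing data: dominant $\lambda_1,\dots,\lambda_m$, $\underline\lambda=(\lambda_1,\dots,\lambda_m)$, $\lambda=\sum\lambda_i$, $Q=BW_\lambda B$, $\tau\in W/W_Q$;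 $Q_\tau$ is the largest parabolic containing $Q$ such that $\tau$ is $Q_\tau$-maximal. $\mathcal I$ is a set of nonempty subsets of $[m]$ ordered by inclusion, graded of length $m-1$ (so $[m]\in\mathcal I$), satisfying ( * ): $\underline J\subseteq I\Rightarrow J\subseteq I$, where $\underline J=J$ if $J$ is minimal in $\mathcal I$ and otherwise $\underline J=\bigcup\{J\setminus K:K\in\mathcal I\text{ covered by }J\}$; $\lambda_I=\sum_{i\in\underline I}\lambda_i$, $P_I=BW_{\lambda_I}B$. $W(\underline\lambda,\tau)$ is the set of pairs $(\theta,I)$ with $\theta\in W/W_Q$, $\theta\le\tau$, $I\in\mathcal I$, with product order. $\underline W(\underline\lambda,\tau)=\bigsqcup_{I\in\mathcal I}\{\theta\in W/W_{P_I}:\theta\le\pi_{P_I}(\tau)\}\times\{I\}$, ordered by the transitive closure of: $(\theta,I)\ge(\phi,J)$ iff $I\supseteq J$ and $\max_Q(\theta)\ge\min_Q(\phi)$. $\pi_{P_{\mathcal I}}(\theta,I)=(\pi_{P_I}(\theta),I)$. A chain in $\underline W(\underline\lambda,\tau)$ is $\tau$-standard if it has a defining chain: a chain in $W(\underline\lambda,\tau)$ with the same index sets, mapping elementwise onto it under $\pi_{P_{\mathcal I}}$. *)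

theory Defs
  imports "HOL-Analysis.Analysis"
begin

section \<open>Root systems, Weyl groups (encoding of G, T, B)\<close>

definition sref :: "'v::euclidean_space \<Rightarrow> 'v \<Rightarrow> 'v" where
  "sref \<alpha> x = x - (2 * (x \<bullet> \<alpha>) / (\<alpha> \<bullet> \<alpha>)) *\<^sub>R \<alpha>"

definition root_system :: "'v::euclidean_space set \<Rightarrow> bool" where
  "root_system \<Phi> \<longleftrightarrow> finite \<Phi> \<and> 0 \<notin> \<Phi> \<and> span \<Phi> = UNIV
     \<and> (\<forall>\<alpha>\<in>\<Phi>. \<forall>\<beta>\<in>\<Phi>. sref \<alpha> \<beta> \<in> \<Phi>)
     \<and> (\<forall>\<alpha>\<in>\<Phi>. \<forall>\<beta>\<in>\<Phi>. 2 * (\<beta> \<bullet> \<alpha>) / (\<alpha> \<bullet> \<alpha>) \<in> \<int>)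
     \<and> (\<forall>\<alpha>\<in>\<Phi>. \<forall>c. c *\<^sub>R \<alpha> \<in> \<Phi> \<longrightarrow> c = 1 \<or> c = -1)"

definition irreducible_rs :: "'v::euclidean_space set \<Rightarrow> bool" where
  "irreducible_rs \<Phi> \<longleftrightarrow> \<Phi> \<noteq> {} \<and>
     \<not> (\<exists>A B. A \<union> B = \<Phi> \<and> A \<inter> B = {} \<and> A \<noteq> {} \<and> B \<noteq> {}
              \<and> (\<forall>a\<in>A. \<forall>b\<in>B. a \<bullet> b = 0))"

definition base :: "'v::euclidean_space set \<Rightarrow> 'v set \<Rightarrow> bool" where
  "base \<Phi> \<Delta> \<longleftrightarrow> \<Delta> \<subseteq> \<Phi> \<and> independent \<Delta> \<and>
     (\<forall>\<beta>\<in>\<Phi>. \<exists>c :: 'v \<Rightarrow> int. \<beta> = (\<Sum>\<alpha>\<in>\<Delta>. of_int (c \<alpha>) *\<^sub>R \<alpha>)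
        \<and> ((\<forall>\<alpha>\<in>\<Delta>. c \<alpha> \<ge> 0) \<or> (\<forall>\<alpha>\<in>\<Delta>. c \<alpha> \<le> 0)))"

text \<open>Group generated by the reflections in a set of roots. For the whole root system this
  is the Weyl group W; for a subset J of the base it is the standard parabolic subgroup W_J.\<close>
inductive_set weyl :: "'v::euclidean_space set \<Rightarrow> ('v \<Rightarrow> 'v) set" for R where
  weyl_id: "id \<in> weyl R"
| weyl_step: "w \<in> weyl R \<Longrightarrow> \<alpha> \<in> R \<Longrightarrow> sref \<alpha> \<circ> w \<in> weyl R"

definition weight :: "'v::euclidean_space set \<Rightarrow> 'v \<Rightarrow> bool" where
  "weight \<Phi> \<nu> \<longleftrightarrow> (\<forall>\<alpha>\<in>\<Phi>. 2 * (\<nu> \<bullet> \<alpha>) / (\<alpha> \<bullet> \<alpha>) \<in> \<int>)"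

definition dominant_weight :: "'v::euclidean_space set \<Rightarrow> 'v set \<Rightarrow> 'v \<Rightarrow> bool" where
  "dominant_weight \<Phi> \<Delta> \<nu> \<longleftrightarrow> weight \<Phi> \<nu> \<and> (\<forall>\<alpha>\<in>\<Delta>. \<nu> \<bullet> \<alpha> \<ge> 0)"

definition stab :: "'v::euclidean_space set \<Rightarrow> 'v \<Rightarrow> ('v \<Rightarrow> 'v) set" where
  "stab \<Phi> \<nu> = {w \<in> weyl \<Phi>. w \<nu> = \<nu>}"

definition word_prod :: "'v::euclidean_space list \<Rightarrow> 'v \<Rightarrow> 'v" where
  "word_prod xs = foldr (\<lambda>\<alpha> f. sref \<alpha> \<circ> f) xs id"

definition wlen :: "'v::euclidean_space set \<Rightarrow> ('v \<Rightarrow> 'v) \<Rightarrow> nat" where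
  "wlen \<Delta> w = (LEAST n. \<exists>xs. set xs \<subseteq> \<Delta> \<and> length xs = n \<and> word_prod xs = w)"

definition bruhat_le :: "'v::euclidean_space set \<Rightarrow> 'v set \<Rightarrow> ('v \<Rightarrow> 'v) \<Rightarrow> ('v \<Rightarrow> 'v) \<Rightarrow> bool" where
  "bruhat_le \<Phi> \<Delta> = (\<lambda>u w. u \<in> weyl \<Phi> \<and> (\<exists>\<alpha>\<in>\<Phi>. w = sref \<alpha> \<circ> u \<and> wlen \<Delta> u < wlen \<Delta> w))\<^sup>*\<^sup>*"

definition coset :: "('v \<Rightarrow> 'v) \<Rightarrow> ('v \<Rightarrow> 'v) set \<Rightarrow> ('v \<Rightarrow> 'v) set" where
  "coset w H = (\<lambda>h. w \<circ> h) ` H"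

definition quot :: "'v::euclidean_space set \<Rightarrow> ('v \<Rightarrow> 'v) set \<Rightarrow> ('v \<Rightarrow> 'v) set set" where
  "quot \<Phi> H = (\<lambda>w. coset w H) ` weyl \<Phi>"

definition cle :: "'v::euclidean_space set \<Rightarrow> 'v set \<Rightarrow> ('v \<Rightarrow> 'v) set \<Rightarrow> ('v \<Rightarrow> 'v) set \<Rightarrow> bool" where
  "cle \<Phi> \<Delta> A B \<longleftrightarrow> (\<exists>a\<in>A. \<exists>b\<in>B. bruhat_le \<Phi> \<Delta> a b)"

text \<open>Projection W/H1 \<rightarrow> W/H2 (H1 \<subseteq> H2).\<close>
definition proj :: "('v \<Rightarrow> 'v) set \<Rightarrow> ('v \<Rightarrow> 'v) set \<Rightarrow> ('v \<Rightarrow> 'v) set" where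
  "proj H2 A = (\<lambda>(a, h). a \<circ> h) ` (A \<times> H2)"

definition pmin :: "'v::euclidean_space set \<Rightarrow> 'v set \<Rightarrow> ('v \<Rightarrow> 'v) set \<Rightarrow> ('v \<Rightarrow> 'v) set
    \<Rightarrow> ('v \<Rightarrow> 'v) set \<Rightarrow> ('v \<Rightarrow> 'v) set" where
  "pmin \<Phi> \<Delta> H1 H2 C = (THE A. A \<in> quot \<Phi> H1 \<and> proj H2 A = C \<and>
      (\<forall>B\<in>quot \<Phi> H1. proj H2 B = C \<longrightarrow> cle \<Phi> \<Delta> A B))"

definition pmax :: "'v::euclidean_space set \<Rightarrow> 'v set \<Rightarrow> ('v \<Rightarrow> 'v) set \<Rightarrow> ('v \<Rightarrow> 'v) set
    \<Rightarrow> ('v \<Rightarrow> 'v) set \<Rightarrow> ('v \<Rightarrow> 'v) set" where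
  "pmax \<Phi> \<Delta> H1 H2 C = (THE A. A \<in> quot \<Phi> H1 \<and> proj H2 A = C \<and>
      (\<forall>B\<in>quot \<Phi> H1. proj H2 B = C \<longrightarrow> cle \<Phi> \<Delta> B A))"

definition is_pmin :: "'v::euclidean_space set \<Rightarrow> 'v set \<Rightarrow> ('v \<Rightarrow> 'v) set \<Rightarrow> ('v \<Rightarrow> 'v) set
    \<Rightarrow> ('v \<Rightarrow> 'v) set \<Rightarrow> bool" where
  "is_pmin \<Phi> \<Delta> H1 H2 A \<longleftrightarrow> (\<exists>C\<in>quot \<Phi> H2. A = pmin \<Phi> \<Delta> H1 H2 C)"

definition is_pmax :: "'v::euclidean_space set \<Rightarrow> 'v set \<Rightarrow> ('v \<Rightarrow> 'v) set \<Rightarrow> ('v \<Rightarrow> 'v) set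
    \<Rightarrow> ('v \<Rightarrow> 'v) set \<Rightarrow> bool" where
  "is_pmax \<Phi> \<Delta> H1 H2 A \<longleftrightarrow> (\<exists>C\<in>quot \<Phi> H2. A = pmax \<Phi> \<Delta> H1 H2 C)"

definition wrank :: "'v::euclidean_space set \<Rightarrow> ('v \<Rightarrow> 'v) set \<Rightarrow> nat" where
  "wrank \<Delta> A = Min (wlen \<Delta> ` A)"

definition is_Qtau :: "'v::euclidean_space set \<Rightarrow> 'v set \<Rightarrow> ('v \<Rightarrow> 'v) set \<Rightarrow> ('v \<Rightarrow> 'v) set
    \<Rightarrow> ('v \<Rightarrow> 'v) set \<Rightarrow> bool" where
  "is_Qtau \<Phi> \<Delta> Q \<tau> Qt \<longleftrightarrow> (\<exists>Jt. Jt \<subseteq> \<Delta> \<and> Qt = weyl Jt \<and> Q \<subseteq> Qt \<and> is_pmax \<Phi> \<Delta> Q Qt \<tau> \<and>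
     (\<forall>J. J \<subseteq> \<Delta> \<and> Q \<subseteq> weyl J \<and> is_pmax \<Phi> \<Delta> Q (weyl J) \<tau> \<longrightarrow> weyl J \<subseteq> Qt))"

definition is_chainI :: "nat set set \<Rightarrow> nat set set \<Rightarrow> bool" where
  "is_chainI Ifam C \<longleftrightarrow> C \<subseteq> Ifam \<and> (\<forall>X\<in>C. \<forall>Y\<in>C. X \<subseteq> Y \<or> Y \<subseteq> X)"

definition max_chainI :: "nat set set \<Rightarrow> nat set set \<Rightarrow> bool" where
  "max_chainI Ifam C \<longleftrightarrow> is_chainI Ifam C \<and> (\<forall>C'. is_chainI Ifam C' \<and> C \<subseteq> C' \<longrightarrow> C' = C)"

definition graded_len :: "nat set set \<Rightarrow> nat \<Rightarrow> bool" where
  "graded_len Ifam n \<longleftrightarrow> Ifam \<noteq> {} \<and>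
     (\<forall>C. max_chainI Ifam C \<longrightarrow> finite C \<and> card C = Suc n)"

definition coversI :: "nat set set \<Rightarrow> nat set \<Rightarrow> nat set \<Rightarrow> bool" where
  "coversI Ifam J K \<longleftrightarrow> K \<in> Ifam \<and> K \<subset> J \<and> \<not> (\<exists>L\<in>Ifam. K \<subset> L \<and> L \<subset> J)"

definition uline :: "nat set set \<Rightarrow> nat set \<Rightarrow> nat set" where
  "uline Ifam J = (if \<not> (\<exists>K\<in>Ifam. K \<subset> J) then J
                    else \<Union>{J - K | K. coversI Ifam J K})"

definition index_family :: "nat set set \<Rightarrow> nat \<Rightarrow> bool" where
  "index_family Ifam m \<longleftrightarrow> (\<forall>I\<in>Ifam. I \<noteq> {} \<and> I \<subseteq> {1..m}) \<and> graded_len Ifam (m - 1) \<and>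
     (\<forall>I\<in>Ifam. \<forall>J\<in>Ifam. uline Ifam J \<subseteq> I \<longrightarrow> J \<subseteq> I)"

text \<open>P_I (its Weyl group W_{lambda_I}) and Q (Weyl group W_lambda).\<close>
definition PI :: "'v::euclidean_space set \<Rightarrow> (nat \<Rightarrow> 'v) \<Rightarrow> nat set set \<Rightarrow> nat set \<Rightarrow> ('v \<Rightarrow> 'v) set" where
  "PI \<Phi> lam Ifam I = stab \<Phi> (\<Sum>i\<in>uline Ifam I. lam i)"

definition Qgrp :: "'v::euclidean_space set \<Rightarrow> (nat \<Rightarrow> 'v) \<Rightarrow> nat \<Rightarrow> ('v \<Rightarrow> 'v) set" where
  "Qgrp \<Phi> lam m = stab \<Phi> (\<Sum>i\<in>{1..m}. lam i)"

type_synonym 'v elt = "('v \<Rightarrow> 'v) set \<times> nat set"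

definition UW :: "'v::euclidean_space set \<Rightarrow> 'v set \<Rightarrow> (nat set \<Rightarrow> ('v \<Rightarrow> 'v) set)
    \<Rightarrow> nat set set \<Rightarrow> ('v \<Rightarrow> 'v) set \<Rightarrow> 'v elt set" where
  "UW \<Phi> \<Delta> P Ifam \<tau> = {(\<theta>, I). I \<in> Ifam \<and> \<theta> \<in> quot \<Phi> (P I) \<and> cle \<Phi> \<Delta> \<theta> (proj (P I) \<tau>)}"

definition uR :: "'v::euclidean_space set \<Rightarrow> 'v set \<Rightarrow> ('v \<Rightarrow> 'v) set \<Rightarrow> (nat set \<Rightarrow> ('v \<Rightarrow> 'v) set)
    \<Rightarrow> 'v elt \<Rightarrow> 'v elt \<Rightarrow> bool" where
  "uR \<Phi> \<Delta> Q P x y \<longleftrightarrow> snd y \<subseteq> snd x \<and>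
     cle \<Phi> \<Delta> (pmin \<Phi> \<Delta> Q (P (snd y)) (fst y)) (pmax \<Phi> \<Delta> Q (P (snd x)) (fst x))"

definition uge :: "'v::euclidean_space set \<Rightarrow> 'v set \<Rightarrow> ('v \<Rightarrow> 'v) set \<Rightarrow> (nat set \<Rightarrow> ('v \<Rightarrow> 'v) set)
    \<Rightarrow> nat set set \<Rightarrow> ('v \<Rightarrow> 'v) set \<Rightarrow> 'v elt \<Rightarrow> 'v elt \<Rightarrow> bool" where
  "uge \<Phi> \<Delta> Q P Ifam \<tau> = (\<lambda>x y. x \<in> UW \<Phi> \<Delta> P Ifam \<tau> \<and> y \<in> UW \<Phi> \<Delta> P Ifam \<tau> \<and> uR \<Phi> \<Delta> Q P x y)\<^sup>+\<^sup>+"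

definition BW :: "'v::euclidean_space set \<Rightarrow> 'v set \<Rightarrow> ('v \<Rightarrow> 'v) set \<Rightarrow> nat set set
    \<Rightarrow> ('v \<Rightarrow> 'v) set \<Rightarrow> 'v elt set" where
  "BW \<Phi> \<Delta> Q Ifam \<tau> = {(\<theta>, I). \<theta> \<in> quot \<Phi> Q \<and> cle \<Phi> \<Delta> \<theta> \<tau> \<and> I \<in> Ifam}"

definition bge :: "'v::euclidean_space set \<Rightarrow> 'v set \<Rightarrow> 'v elt \<Rightarrow> 'v elt \<Rightarrow> bool" where
  "bge \<Phi> \<Delta> x y \<longleftrightarrow> cle \<Phi> \<Delta> (fst y) (fst x) \<and> snd y \<subseteq> snd x"

text \<open>Chains are written as x_l > ... > x_0, encoded by index functions on {0..l}.\<close>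
definition chain_elems :: "nat \<Rightarrow> (nat \<Rightarrow> 'a) \<Rightarrow> (nat \<Rightarrow> 'b) \<Rightarrow> ('a \<times> 'b) set" where
  "chain_elems l th I = {(th k, I k) | k. k \<le> l}"

definition uchain where
  "uchain \<Phi> \<Delta> Q P Ifam \<tau> l th I \<longleftrightarrow> (\<forall>k\<le>l. (th k, I k) \<in> UW \<Phi> \<Delta> P Ifam \<tau>) \<and>
     (\<forall>k<l. uge \<Phi> \<Delta> Q P Ifam \<tau> (th (Suc k), I (Suc k)) (th k, I k) \<and>
            (th (Suc k), I (Suc k)) \<noteq> (th k, I k))"

definition bchain where
  "bchain \<Phi> \<Delta> Q Ifam \<tau> l th I \<longleftrightarrow> (\<forall>k\<le>l. (th k, I k) \<in> BW \<Phi> \<Delta> Q Ifam \<tau>) \<and>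
     (\<forall>k<l. bge \<Phi> \<Delta> (th (Suc k), I (Suc k)) (th k, I k) \<and>
            (th (Suc k), I (Suc k)) \<noteq> (th k, I k))"

definition max_bchain where
  "max_bchain \<Phi> \<Delta> Q Ifam \<tau> l th I \<longleftrightarrow> bchain \<Phi> \<Delta> Q Ifam \<tau> l th I \<and>
     (\<forall>l' th' I'. bchain \<Phi> \<Delta> Q Ifam \<tau> l' th' I' \<and> chain_elems l th I \<subseteq> chain_elems l' th' I'
        \<longrightarrow> chain_elems l' th' I' = chain_elems l th I)"

definition defining_chain where
  "defining_chain \<Phi> \<Delta> Q P Ifam \<tau> l th I thb \<longleftrightarrow> bchain \<Phi> \<Delta> Q Ifam \<tau> l thb I \<and>
     (\<forall>k\<le>l. proj (P (I k)) (thb k) = th k)"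

definition tau_standard where
  "tau_standard \<Phi> \<Delta> Q P Ifam \<tau> l th I \<longleftrightarrow> uchain \<Phi> \<Delta> Q P Ifam \<tau> l th I \<and>
     (\<exists>thb. defining_chain \<Phi> \<Delta> Q P Ifam \<tau> l th I thb)"

definition max_tau_standard where
  "max_tau_standard \<Phi> \<Delta> Q P Ifam \<tau> l th I \<longleftrightarrow> tau_standard \<Phi> \<Delta> Q P Ifam \<tau> l th I \<and>
     (\<forall>l' th' I'. tau_standard \<Phi> \<Delta> Q P Ifam \<tau> l' th' I' \<and> chain_elems l th I \<subseteq> chain_elems l' th' I'
        \<longrightarrow> chain_elems l' th' I' = chain_elems l th I)"

end

theory Submission
  imports Defs
begin

text \<open>A coset \<open>w W\<^sub>\<nu>\<close> is treated as the vector \<open>w \<nu>\<close>; then \<open>x \<le> y\<close> means that \<open>y\<close> arises from \<open>x\<close> by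
  reflections \<open>s\<^sub>\<beta>\<close> with \<open>\<beta> > 0\<close> and \<open>(x, \<beta>) > 0\<close>, and the rank of \<open>x\<close> is the number of positive
  roots that are negative on \<open>x\<close>.  The lifting property for simple reflections gives everything
  needed about Bruhat orders.

  Extend a defining chain of a maximal standard chain to a maximal chain of \<open>W(\<lambda>,\<tau>)\<close>.  Its image
  is the given standard chain, so one has to show that no edge is collapsed by the projections.
  A collapsed edge is a right multiplication by a reflection \<open>t\<close> lying in \<open>W\<^bsub>P_I\<^esub>\<close>.  If it is adjacent
  to an edge that is not collapsed, then replacing the vertex in between either enlarges the image,
  contradicting maximality, or moves the collapsed edge past its neighbour with the same \<open>t\<close>.  Moving
  a collapsed edge from the lowest to the highest index set shows that \<open>t\<close> lies in all \<open>W\<^bsub>P_I\<^esub>\<close> along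
  the chain, hence in \<open>W\<^sub>\<lambda>\<close>, so the edge is trivial.  Hence defining chains are maximal chains.
  They are unique because \<open>s\<^sub>\<beta> p = s\<^sub>\<gamma> p \<noteq> p\<close> forces \<open>\<beta> = \<gamma>\<close>, and replacing one member by its minimal or
  maximal lift yields again a defining chain, which gives the minimality and maximality claims.\<close>

section \<open>Reflections and reflection groups\<close>

text \<open>The orbit of the regular vector \<open>h\<close> is free, so it is W itself; the signs
  of \<open>w h\<close> on roots decide Bruhat relations in W, and weakly those of
  \<open>w \<nu>\<close> for dominant \<nu>. The obstacle is that an interval of length two in W/W_Q
  need not have two middle elements. It has them where the exchange needs them: if exactly one of
  two consecutive edges is collapsed, the projected vector separates the two roots, which forces
  regularity on the rank two system that they span. Maximality of the standard chain enters as a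
  statement on images: a maximal chain of the product, stripped of collapsed vertices, projects to a
  standard chain, so no maximal chain whose image contains the given chain has a larger image. A
  reflection that fixes \<lambda>_J for all J met by a maximal chain fixes \<lambda>, because each i
  in [m] lies in \<open>uline Ifam J\<close> for the first J of the chain that contains i.\<close>

lemma linear_sref: "linear (sref a)"
  unfolding sref_def
  by (rule linearI) (simp_all add: inner_add_left algebra_simps add_divide_distrib)

lemma sref_inner_self [simp]: "sref a x \<bullet> a = - (x \<bullet> a)"
  by (cases "a = 0") (simp_all add: sref_def inner_diff_left)

lemma sref_self [simp]: "sref a a = - a"
  by (cases "a = 0") (simp_all add: sref_def scaleR_2)

lemma sref_inner_swap: "sref a x \<bullet> y = x \<bullet> sref a y"
  by (simp add: sref_def inner_diff_left inner_diff_right inner_commute)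

lemma sref_sref [simp]: "sref a (sref a x) = x"
proof -
  have "sref a (sref a x) = sref a x - (2 * (sref a x \<bullet> a) / (a \<bullet> a)) *\<^sub>R a"
    by (simp only: sref_def)
  then show ?thesis by (simp only: sref_inner_self) (simp add: sref_def)
qed

lemma sref_inner [simp]: "sref a x \<bullet> sref a y = x \<bullet> y"
  by (simp add: sref_inner_swap)

lemma sref_uminus_root [simp]: "sref (- a) = sref a"
  by (rule ext) (simp add: sref_def)

lemma sref_fix: "x \<bullet> a = 0 \<Longrightarrow> sref a x = x"
  by (simp add: sref_def)

lemma sref_eq_iff: "a \<noteq> 0 \<Longrightarrow> sref a x = x \<longleftrightarrow> x \<bullet> a = 0"
  by (simp add: sref_def)

lemma sref_comp_self [simp]: "sref a \<circ> sref a = id"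
  by (rule ext) simp

lemma bij_sref: "bij (sref a)"
  by (rule o_bij[of "sref a"]) simp_all

lemma sref_in_weyl: "a \<in> R \<Longrightarrow> sref a \<in> weyl R"
  using weyl_step[OF weyl_id, of a R] by simp

lemma weyl_comp: "u \<in> weyl R \<Longrightarrow> v \<in> weyl R \<Longrightarrow> u \<circ> v \<in> weyl R"
  by (induction rule: weyl.induct) (auto simp: comp_assoc intro: weyl_step)

lemma weyl_bij: "w \<in> weyl R \<Longrightarrow> bij w"
  by (induction rule: weyl.induct) (simp_all del: id_apply o_apply add: bij_comp bij_sref)

lemma weyl_inv: "w \<in> weyl R \<Longrightarrow> inv w \<in> weyl R"
proof (induction rule: weyl.induct)
  case weyl_id
  show ?case using weyl.weyl_id[of R] by (simp del: id_apply)
next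
  case (weyl_step w a)
  have "inv (sref a) = sref a"
    by (rule inv_unique_comp) simp_all
  then have "inv (sref a \<circ> w) = inv w \<circ> sref a"
    using o_inv_distrib[OF bij_sref weyl_bij[OF weyl_step(1)], of a] by simp
  then show ?case using weyl_step by (simp del: o_apply add: weyl_comp sref_in_weyl)
qed

lemma weyl_inv_cancel [simp]:
  assumes "w \<in> weyl R"
  shows "w (inv w x) = x" "inv w (w x) = x" "w \<circ> inv w = id" "inv w \<circ> w = id"
  using weyl_bij[OF assms] bij_is_surj[THEN surj_f_inv_f] bij_is_inj[THEN inv_f_f]
  by (auto simp: fun_eq_iff)

lemma weyl_linear: "w \<in> weyl R \<Longrightarrow> linear w"
  by (induction rule: weyl.induct) (simp_all del: id_apply o_apply add: linear_id linear_compose linear_sref)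

lemma weyl_inner [simp]: "w \<in> weyl R \<Longrightarrow> w x \<bullet> w y = x \<bullet> y"
  by (induction arbitrary: x y rule: weyl.induct) auto

lemma weyl_inner_inv: "w \<in> weyl R \<Longrightarrow> w x \<bullet> y = x \<bullet> inv w y"
  using weyl_inner[of w R x "inv w y"] by simp

lemma weyl_mono: "R \<subseteq> R' \<Longrightarrow> weyl R \<subseteq> weyl R'"
proof
  fix w assume "R \<subseteq> R'" "w \<in> weyl R"
  from this(2,1) show "w \<in> weyl R'" by (induction rule: weyl.induct) (auto intro: weyl.intros)
qed

text \<open>This is w s_b = s_{wb} w, valid because \<open>w\<close> is a linear isometry.\<close>

lemma weyl_sref: "w \<in> weyl R \<Longrightarrow> w (sref b x) = sref (w b) (w x)"
  by (simp add: sref_def linear_diff[OF weyl_linear] linear_scale[OF weyl_linear])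

section \<open>Bruhat order on orbits\<close>

text \<open>Only what is needed of a positive system is recorded, so that the locale can also be
  instantiated with the opposite system; this reverses the order and turns statements about
  minimal lifts into statements about maximal lifts.\<close>

locale positive_system =
  fixes \<Phi> \<Delta> :: "'v::euclidean_space set" and h :: 'v
  assumes finite_roots: "finite \<Phi>"
    and zero_notin: "0 \<notin> \<Phi>"
    and sref_root: "a \<in> \<Phi> \<Longrightarrow> b \<in> \<Phi> \<Longrightarrow> sref a b \<in> \<Phi>"
    and reduced: "a \<in> \<Phi> \<Longrightarrow> c *\<^sub>R a \<in> \<Phi> \<Longrightarrow> c = 1 \<or> c = -1"
    and regular: "b \<in> \<Phi> \<Longrightarrow> b \<bullet> h \<noteq> 0"
    and simple_root: "a \<in> \<Delta> \<Longrightarrow> a \<in> \<Phi>"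
    and simple_pos: "a \<in> \<Delta> \<Longrightarrow> a \<bullet> h > 0"
    and simple_perm: "a \<in> \<Delta> \<Longrightarrow> b \<in> \<Phi> \<Longrightarrow> b \<bullet> h > 0 \<Longrightarrow> b \<noteq> a \<Longrightarrow> sref a b \<bullet> h > 0"
    and dominantI: "\<lbrakk>\<And>a. a \<in> \<Delta> \<Longrightarrow> x \<bullet> a \<ge> 0; b \<in> \<Phi>; b \<bullet> h > 0\<rbrakk> \<Longrightarrow> x \<bullet> b \<ge> 0"
begin

definition pos :: "'v set" where "pos = {b \<in> \<Phi>. b \<bullet> h > 0}"

definition step :: "'v \<Rightarrow> 'v \<Rightarrow> bool" where
  "step x y \<longleftrightarrow> (\<exists>b\<in>pos. x \<bullet> b > 0 \<and> y = sref b x)"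

abbreviation le :: "'v \<Rightarrow> 'v \<Rightarrow> bool" where "le \<equiv> step\<^sup>*\<^sup>*"

text \<open>On the orbit of \<open>h\<close> this is the number of inversions, hence the length; on
  the orbit of another dominant vector it is the length of the shortest representative of the
  coset.\<close>

definition rk :: "'v \<Rightarrow> nat" where "rk x = card {b \<in> pos. x \<bullet> b < 0}"

definition dom :: "'v \<Rightarrow> bool" where "dom x \<longleftrightarrow> (\<forall>b\<in>pos. x \<bullet> b \<ge> 0)"

lemma pos_root: "b \<in> pos \<Longrightarrow> b \<in> \<Phi>" by (simp add: pos_def)

lemma finite_pos: "finite pos" using finite_roots by (simp add: pos_def)

lemma simple_in_pos: "a \<in> \<Delta> \<Longrightarrow> a \<in> pos"
  by (simp add: pos_def simple_root simple_pos)

lemma uminus_root: "b \<in> \<Phi> \<Longrightarrow> - b \<in> \<Phi>"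
  using sref_root[of b b] by simp

lemma pos_or_neg: "b \<in> \<Phi> \<Longrightarrow> b \<in> pos \<or> - b \<in> pos"
  using regular[of b] uminus_root[of b] by (auto simp: pos_def)

lemma pos_nonzero: "b \<in> pos \<Longrightarrow> b \<noteq> 0"
  using zero_notin by (auto simp: pos_def)

lemma sref_simple_pos: "a \<in> \<Delta> \<Longrightarrow> b \<in> pos \<Longrightarrow> b \<noteq> a \<Longrightarrow> sref a b \<in> pos"
  using simple_perm simple_root sref_root by (auto simp: pos_def)

lemma weyl_root: "w \<in> weyl \<Phi> \<Longrightarrow> b \<in> \<Phi> \<Longrightarrow> w b \<in> \<Phi>"
  by (induction rule: weyl.induct) (auto intro: sref_root)

lemma dom_simple: "dom x \<longleftrightarrow> (\<forall>a\<in>\<Delta>. x \<bullet> a \<ge> 0)"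
  using dominantI simple_in_pos by (auto simp: dom_def pos_def)

lemma dom_h: "dom h"
  by (auto simp: dom_def pos_def inner_commute intro: less_imp_le)

lemma stepI: "b \<in> pos \<Longrightarrow> x \<bullet> b > 0 \<Longrightarrow> step x (sref b x)"
  by (auto simp: step_def)

lemma leI_pos: "b \<in> pos \<Longrightarrow> x \<bullet> b \<ge> 0 \<Longrightarrow> le x (sref b x)"
  by (cases "x \<bullet> b = 0") (use stepI[of b x] in \<open>auto simp: sref_fix\<close>)

lemma leI_neg: "b \<in> pos \<Longrightarrow> x \<bullet> b \<le> 0 \<Longrightarrow> le (sref b x) x"
  using leI_pos[of b "sref b x"] by simp

text \<open>A step subtracts a positive multiple of a positive root. This makes \<open>le\<close>
  antisymmetric before anything is known about ranks.\<close>

lemma step_height: "step x y \<Longrightarrow> y \<bullet> h < x \<bullet> h"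
proof -
  assume "step x y"
  then obtain b where b: "b \<in> pos" "x \<bullet> b > 0" "y = sref b x" by (auto simp: step_def)
  have "b \<bullet> b > 0" using pos_nonzero[OF b(1)] by simp
  with b have "(2 * (x \<bullet> b) / (b \<bullet> b)) * (b \<bullet> h) > 0" by (simp add: pos_def)
  then show ?thesis by (simp add: b(3) sref_def inner_diff_left)
qed

lemma le_height: "le x y \<Longrightarrow> x = y \<or> y \<bullet> h < x \<bullet> h"
  by (induction rule: rtranclp_induct) (auto dest: step_height)

lemma le_antisym: "le x y \<Longrightarrow> le y x \<Longrightarrow> x = y"
  using le_height[of x y] le_height[of y x] by auto

section \<open>The lifting property for simple reflections\<close>

lemma step_sref:
  assumes "a \<in> \<Delta>" "b \<in> pos" "b \<noteq> a" "x \<bullet> b > 0"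
  shows "step (sref a x) (sref a (sref b x))"
proof -
  have "sref a (sref b x) = sref (sref a b) (sref a x)"
    using weyl_sref[OF sref_in_weyl, of a "{a}" b x] by simp
  moreover have "sref a x \<bullet> sref a b > 0" using assms by simp
  ultimately show ?thesis using stepI[OF sref_simple_pos[OF assms(1,2,3)]] by simp
qed

text \<open>The names refer to the pairing with \<open>a\<close>, not to \<open>le\<close>: of
  \<open>x\<close> and \<open>sref a x\<close>, \<open>down\<close> is the \<open>le\<close>-larger
  one and \<open>up\<close> the \<open>le\<close>-smaller one. The lifting property then says that
  both maps are monotone, a form that passes to the transitive closure.\<close>

definition down :: "'v \<Rightarrow> 'v \<Rightarrow> 'v" where "down a x = (if x \<bullet> a > 0 then sref a x else x)"
definition up :: "'v \<Rightarrow> 'v \<Rightarrow> 'v" where "up a x = (if x \<bullet> a < 0 then sref a x else x)"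

text \<open>If the step is the reflection in \<open>a\<close> itself, both ends have the same
  \<open>down\<close> and the same \<open>up\<close>. Otherwise \<open>sref a\<close> permutes the
  positive roots different from \<open>a\<close>, so it carries the step to a step, and the four
  corners of the resulting square are comparable as required.\<close>

lemma lifting_step:
  assumes a: "a \<in> \<Delta>" and "step x y"
  shows "le (down a x) (down a y) \<and> le (up a x) (up a y)"
proof -
  obtain b where b: "b \<in> pos" "x \<bullet> b > 0" "y = sref b x"
    using assms(2) by (auto simp: step_def)
  show ?thesis
  proof (cases "b = a")
    case True
    then show ?thesis using b by (simp add: down_def up_def)
  next
    case False
    have s: "le (sref a x) (sref a y)" using step_sref[OF a b(1) False b(2)] b(3) by auto
    have xy: "le x y" using assms(2) by auto
    note ap = simple_in_pos[OF a]
    have x1: "x \<bullet> a \<ge> 0 \<Longrightarrow> le x (sref a x)" "x \<bullet> a \<le> 0 \<Longrightarrow> le (sref a x) x"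
     and y1: "y \<bullet> a \<ge> 0 \<Longrightarrow> le y (sref a y)" "y \<bullet> a \<le> 0 \<Longrightarrow> le (sref a y) y"
      using leI_pos[OF ap] leI_neg[OF ap] by auto
    show ?thesis unfolding down_def up_def
      using s xy x1 y1 by (auto simp: not_less intro: rtranclp_trans)
  qed
qed

lemma lifting:
  assumes "a \<in> \<Delta>" "le x y"
  shows "le (down a x) (down a y)" "le (up a x) (up a y)"
  using assms(2) by (induction rule: rtranclp_induct) (auto dest: lifting_step[OF assms(1)])

text \<open>This lemma and the next three are the forms of the lifting property used later. Weak
  inequalities suffice since \<open>sref a\<close> fixes vectors orthogonal to
  \<open>a\<close>.\<close>

lemma le_sref_right: "a \<in> \<Delta> \<Longrightarrow> le x y \<Longrightarrow> x \<bullet> a \<ge> 0 \<Longrightarrow> y \<bullet> a \<le> 0 \<Longrightarrow> le x (sref a y)"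
  using lifting(2)[of a x y] by (auto simp: up_def sref_fix split: if_splits)

lemma le_sref_left: "a \<in> \<Delta> \<Longrightarrow> le x y \<Longrightarrow> x \<bullet> a \<ge> 0 \<Longrightarrow> y \<bullet> a \<le> 0 \<Longrightarrow> le (sref a x) y"
  using lifting(1)[of a x y] by (auto simp: down_def sref_fix split: if_splits)

lemma le_sref_neg: "a \<in> \<Delta> \<Longrightarrow> le x y \<Longrightarrow> x \<bullet> a \<le> 0 \<Longrightarrow> y \<bullet> a \<le> 0 \<Longrightarrow> le (sref a x) (sref a y)"
  using lifting(2)[of a x y] by (auto simp: up_def sref_fix not_less split: if_splits)

lemma le_sref_pos: "a \<in> \<Delta> \<Longrightarrow> le x y \<Longrightarrow> x \<bullet> a \<ge> 0 \<Longrightarrow> y \<bullet> a \<ge> 0 \<Longrightarrow> le (sref a x) (sref a y)"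
  using lifting(1)[of a x y] by (auto simp: down_def sref_fix not_less split: if_splits)

text \<open>Apart from \<open>a\<close>, the roots counted for \<open>x\<close> and for
  \<open>sref a x\<close> correspond under \<open>sref a\<close>, which permutes the positive roots
  other than \<open>a\<close>.\<close>

lemma rk_sref:
  assumes a: "a \<in> \<Delta>" and neg: "x \<bullet> a < 0"
  shows "rk x = Suc (rk (sref a x))"
proof -
  let ?A = "{b \<in> pos. x \<bullet> b < 0}" and ?B = "{b \<in> pos. sref a x \<bullet> b < 0}"
  have "?A = insert a (sref a ` ?B)"
  proof (intro equalityI subsetI)
    fix b assume b: "b \<in> ?A"
    show "b \<in> insert a (sref a ` ?B)"
    proof (cases "b = a")
      case False
      have "sref a b \<in> ?B" using b sref_simple_pos[OF a _ False] by simp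
      then show ?thesis using image_eqI[of b "sref a" "sref a b"] by simp
    qed simp
  next
    fix b assume "b \<in> insert a (sref a ` ?B)"
    moreover have "sref a c \<in> ?A" if "c \<in> ?B" for c
    proof -
      have "c \<noteq> a" using that neg by auto
      then show ?thesis using that sref_simple_pos[OF a] by (simp add: sref_inner_swap)
    qed
    ultimately show "b \<in> ?A" using neg simple_in_pos[OF a] by auto
  qed
  moreover have "a \<notin> sref a ` ?B"
  proof
    assume "a \<in> sref a ` ?B"
    then obtain c where "c \<in> ?B" "a = sref a c" by auto
    then have "c = - a" by (metis sref_self sref_sref)
    then show False using \<open>c \<in> ?B\<close> simple_pos[OF a] by (simp add: pos_def)
  qed
  moreover have "inj_on (sref a) ?B" by (rule inj_onI) (metis sref_sref)
  ultimately show ?thesis using finite_pos by (simp add: rk_def card_image)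
qed

lemma rk_sref_pos: "a \<in> \<Delta> \<Longrightarrow> x \<bullet> a > 0 \<Longrightarrow> rk (sref a x) = Suc (rk x)"
  using rk_sref[of a "sref a x"] by simp

lemma rk_eq_0_iff: "rk x = 0 \<longleftrightarrow> dom x"
  using finite_pos by (auto simp: rk_def dom_def not_less)

lemma rk_pos_simple: "rk x > 0 \<Longrightarrow> \<exists>a\<in>\<Delta>. x \<bullet> a < 0"
  using rk_eq_0_iff[of x] dom_simple[of x] by (auto simp: not_le)

lemma step_not_dom: "step x y \<Longrightarrow> \<not> dom y"
  by (fastforce simp: step_def dom_def)

lemma le_dom: "le x y \<Longrightarrow> dom y \<Longrightarrow> x = y"
  by (induction rule: rtranclp_induct) (auto dest: step_not_dom)

text \<open>A step by a non-simple root gives no direct comparison of the root sets counted by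
  \<open>rk\<close>. Instead a simple root \<open>a\<close> negative on \<open>y\<close> is split
  off: by lifting, either \<open>sref a x\<close> or \<open>x\<close> itself lies below
  \<open>sref a y\<close>, whose rank is one less.\<close>

lemma rk_less: "le x y \<Longrightarrow> x \<noteq> y \<Longrightarrow> rk x < rk y"
proof (induction "rk y" arbitrary: x y rule: less_induct)
  case less
  have "rk y \<noteq> 0" using less.prems le_dom rk_eq_0_iff by blast
  then obtain a where a: "a \<in> \<Delta>" "y \<bullet> a < 0" using rk_pos_simple by auto
  note r = rk_sref[OF a]
  show ?case
  proof (cases "x \<bullet> a < 0")
    case True
    have "le (sref a x) (sref a y)" using le_sref_neg a less.prems True by simp
    moreover have "sref a x \<noteq> sref a y" using less.prems(2) by (metis sref_sref)
    ultimately have "rk (sref a x) < rk (sref a y)" using less.hyps r by simp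
    then show ?thesis using r rk_sref[OF a(1) True] by simp
  next
    case False
    then have "le x (sref a y)" using le_sref_right a less.prems by simp
    then show ?thesis using less.hyps[of "sref a y" x] r by (cases "x = sref a y") auto
  qed
qed

lemma rk_le: "le x y \<Longrightarrow> rk x \<le> rk y"
  using rk_less[of x y] by (cases "x = y") auto

lemma le_rk_eq: "le x y \<Longrightarrow> rk x = rk y \<Longrightarrow> x = y"
  using rk_less by force

text \<open>Translates the length condition in \<open>bruhat_le\<close> into the sign of a
  pairing.\<close>

lemma step_iff_rk: "b \<in> pos \<Longrightarrow> x \<bullet> b \<noteq> 0 \<Longrightarrow> rk x < rk (sref b x) \<longleftrightarrow> x \<bullet> b > 0"
proof -
  assume b: "b \<in> pos" "x \<bullet> b \<noteq> 0"
  have ne: "sref b x \<noteq> x" using sref_eq_iff[OF pos_nonzero] b by auto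
  consider "x \<bullet> b > 0" | "x \<bullet> b < 0" using b by linarith
  then show ?thesis
    using rk_less[OF leI_pos[OF b(1), of x]] rk_less[OF leI_neg[OF b(1), of x]] ne
    by cases auto
qed

lemma cover_step:
  assumes "le x y" "rk y = Suc (rk x)"
  shows "step x y"
proof -
  from assms(1) have "x = y \<or> (\<exists>z. step x z \<and> le z y)"
    by (cases rule: converse_rtranclpE) auto
  then obtain z where z: "step x z" "le z y" using assms by auto
  have "rk x < rk z" using rk_less z(1) step_height by blast
  then have "z = y" using le_rk_eq[OF z(2)] rk_le[OF z(2)] assms(2) by simp
  then show ?thesis using z by simp
qed

text \<open>With cover relations being single steps, this is gradedness. A simple root negative on
  \<open>y\<close> reduces it to an interval with a top of smaller rank, and the element found there
  is lifted back.\<close>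

lemma le_between:
  "le x y \<Longrightarrow> Suc (rk x) < rk y \<Longrightarrow> \<exists>z. le x z \<and> le z y \<and> rk x < rk z \<and> rk z < rk y"
proof (induction "rk y" arbitrary: x y rule: less_induct)
  case less
  obtain a where a: "a \<in> \<Delta>" "y \<bullet> a < 0" using rk_pos_simple[of y] less.prems by auto
  note r = rk_sref[OF a]
  have y': "le (sref a y) y" using leI_neg[OF simple_in_pos] a by simp
  have *: ?case if "le x (sref a y)"
    using that y' r less.prems by (intro exI[of _ "sref a y"]) auto
  show ?case
  proof (cases "x \<bullet> a < 0")
    case False
    then show ?thesis using * le_sref_right a less.prems by simp
  next
    case True
    note rx = rk_sref[OF a(1) True]
    have "le (sref a x) (sref a y)" using le_sref_neg a less.prems True by simp
    then obtain z where z: "le (sref a x) z" "le z (sref a y)" "rk (sref a x) < rk z" "rk z < rk (sref a y)"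
      using less.hyps[of "sref a y" "sref a x"] less.prems r rx by auto
    show ?thesis
    proof (cases "z \<bullet> a > 0")
      case True
      have "le x (sref a z)" using le_sref_pos[OF a(1) z(1)] True \<open>x \<bullet> a < 0\<close> by simp
      moreover have "le (sref a z) y" using le_sref_pos[OF a(1) z(2)] True a by simp
      ultimately show ?thesis using rk_sref_pos[OF a(1) True] z(3,4) r rx by (intro exI[of _ "sref a z"]) auto
    next
      case False
      \<comment> \<open>Now \<open>z\<close> is above \<open>x\<close> without being reflected, and
        \<open>sref a y\<close>, which lies above \<open>z\<close>, is the element wanted.\<close>
      then have "le x z" using le_sref_left[OF a(1) z(1)] \<open>x \<bullet> a < 0\<close> by simp
      then show ?thesis using * z(2) by (meson rtranclp_trans)
    qed
  qed
qed

text \<open>The two reflections subtract multiples of \<open>b\<close> and of \<open>c\<close> from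
  \<open>x\<close>, nonzero by hypothesis. So \<open>b\<close> and \<open>c\<close> are
  proportional, and reducedness and positivity leave only equality.\<close>

lemma sref_eq_imp_root_eq:
  assumes "b \<in> pos" "c \<in> pos" "sref b x = sref c x" "x \<bullet> b \<noteq> 0"
  shows "b = c"
proof -
  let ?k = "\<lambda>b. 2 * (x \<bullet> b) / (b \<bullet> b)"
  have eq: "?k b *\<^sub>R b = ?k c *\<^sub>R c" using assms(3) by (simp add: sref_def)
  have "?k b \<noteq> 0" using assms(4) pos_nonzero[OF assms(1)] by simp
  then have "b = (?k c / ?k b) *\<^sub>R c"
    using arg_cong[OF eq, of "\<lambda>v. (1 / ?k b) *\<^sub>R v"] by (simp add: mult.commute)
  then obtain d where d: "b = d *\<^sub>R c" by blast
  then have "d = 1 \<or> d = -1" using reduced[of c d] assms pos_root by auto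
  then show ?thesis using d assms by (auto simp: pos_def)
qed

text \<open>Length two intervals have a second middle element as soon as the lower end is regular for
  the rank two subsystem generated by the two edges; for singular vectors this fails.\<close>

lemma diamond:
  assumes "b \<in> pos" "x \<bullet> b > 0" "y = sref b x" "c \<in> pos" "y \<bullet> c > 0" "z = sref c y"
    and "rk y = Suc (rk x)" "rk z = Suc (rk y)"
    and "\<And>e. e \<in> \<Phi> \<Longrightarrow> e \<in> span {b, c} \<Longrightarrow> x \<bullet> e \<noteq> 0"
  shows "\<exists>y'. y' \<noteq> y \<and> le x y' \<and> le y' z \<and> rk y' = Suc (rk x)"
  using assms
proof (induction "rk z" arbitrary: b c x y z rule: less_induct)
  case less
  note b = less.prems(1-3) and c = less.prems(4-6) and rks = less.prems(7,8) and reg = less.prems(9)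
  have xy: "le x y" using leI_pos[of b x] b by simp
  have yz: "le y z" using leI_pos[of c y] c by simp
  have xz: "le x z" using xy yz by simp
  obtain a where a: "a \<in> \<Delta>" "z \<bullet> a < 0" using rk_pos_simple[of z] rks by auto
  note rz = rk_sref[OF a]
  have za: "le (sref a z) z" using leI_neg[OF simple_in_pos] a by simp
  \<comment> \<open>If \<open>sref a z\<close> is \<open>y\<close>, the candidate for a second
    middle element is lost, but the upper edge is then known to be the simple root
    \<open>a\<close>.\<close>
  have ca: "c = a" "y \<bullet> a > 0" if "sref a z = y"
  proof -
    have "z = sref a y" using that by auto
    then show "y \<bullet> a > 0" using a by simp
    show "c = a"
      using sref_eq_imp_root_eq[OF c(1) simple_in_pos[OF a(1)], of y] c \<open>z = sref a y\<close> by simp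
  qed
  show ?case
  proof (cases "x \<bullet> a < 0")
    case False
    then have xa: "le x (sref a z)" using le_sref_right a xz by simp
    show ?thesis
    proof (cases "sref a z = y")
      case False
      then show ?thesis using xa za rz rks by (intro exI[of _ "sref a z"]) auto
    next
      case True
      \<comment> \<open>Regularity applies since \<open>a = c\<close>. It makes
        \<open>sref a x\<close> a genuine element above \<open>x\<close>; it differs from
        \<open>y\<close> because the two pair with \<open>a\<close> in opposite signs.\<close>
      have "x \<bullet> a \<noteq> 0" using reg[of a] ca[OF True] simple_root[OF a(1)] by (simp add: span_base)
      then have pos: "x \<bullet> a > 0" using False by simp
      have "le (sref a x) (sref a y)" using le_sref_pos[OF a(1) xy] pos ca(2)[OF True] by simp
      moreover have "sref a y = z" using True by auto
      moreover have "sref a x \<noteq> y"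
        using pos ca(2)[OF True] by (metis sref_inner_self neg_0_less_iff_less not_less_iff_gr_or_eq)
      moreover have "le x (sref a x)" using leI_pos[OF simple_in_pos[OF a(1)]] pos by simp
      ultimately show ?thesis using rk_sref_pos[OF a(1) pos] by (intro exI[of _ "sref a x"]) auto
    qed
  next
    case xneg: True
    note rx = rk_sref[OF a(1) xneg]
    have xx: "sref a (sref a x) = x" by simp
    have xpos: "sref a x \<bullet> a > 0" using xneg by simp
    show ?thesis
    proof (cases "y \<bullet> a < 0")
      case True
      note ry = rk_sref[OF a(1) True]
      have ba: "b \<noteq> a" "c \<noteq> a" using b c xneg True by auto
      have conj: "sref a (sref d v) = sref (sref a d) (sref a v)" for d v
        using weyl_sref[OF sref_in_weyl, of a "{a}" d v] by simp
      have reg': "sref a x \<bullet> e \<noteq> 0" if "e \<in> \<Phi>" "e \<in> span {sref a b, sref a c}" for e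
      proof -
        have "sref a e \<in> sref a ` span {sref a b, sref a c}" using that by blast
        then have "sref a e \<in> span {b, c}"
          by (simp add: linear_span_image[OF linear_sref, symmetric])
        then show ?thesis using reg[of "sref a e"] sref_root[OF simple_root[OF a(1)] that(1)]
          by (simp add: sref_inner_swap)
      qed
      have "\<exists>m. m \<noteq> sref a y \<and> le (sref a x) m \<and> le m (sref a z) \<and> rk m = Suc (rk (sref a x))"
      proof (rule less.hyps[of "sref a z" "sref a b" "sref a x" "sref a y" "sref a c"])
        show "sref a y = sref (sref a b) (sref a x)" "sref a z = sref (sref a c) (sref a y)"
          using b c conj by auto
      qed (use b c ba rx ry rz rks reg' sref_simple_pos[OF a(1)] in auto)
      then obtain m where m: "m \<noteq> sref a y" "le (sref a x) m" "le m (sref a z)"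
        "rk m = Suc (rk (sref a x))" by blast
      show ?thesis
      proof (cases "m \<bullet> a > 0")
        case True
        have "le x (sref a m)" using le_sref_pos[OF a(1) m(2)] True xneg by simp
        moreover have "le (sref a m) z" using le_sref_pos[OF a(1) m(3)] True a by simp
        moreover have "sref a m \<noteq> y" using m(1) by auto
        ultimately show ?thesis using rk_sref_pos[OF a(1) True] rx m(4) by (intro exI[of _ "sref a m"]) auto
      next
        case False
        \<comment> \<open>Then \<open>m\<close> lies above \<open>x\<close> and has the same rank,
          so \<open>m = x\<close>; hence \<open>x\<close> is below \<open>sref a z\<close>, which is
          the second middle element.\<close>
        have "le x m" using le_sref_left[OF a(1) m(2)] False xneg by simp
        then have "x = m" using le_rk_eq[of x m] m(4) rx by simp
        moreover have "sref a z \<noteq> y" using a True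
          by (metis sref_inner_self neg_0_less_iff_less not_less_iff_gr_or_eq)
        ultimately show ?thesis using m(3) rz rks za by (intro exI[of _ "sref a z"]) auto
      qed
    next
      case False
      then have "le y (sref a z)" using le_sref_right[OF a(1) yz] a by simp
      then have eq: "sref a z = y" using le_rk_eq[of y "sref a z"] rz rks by simp
      have reg': "sref a x \<bullet> e \<noteq> 0" if "e \<in> \<Phi>" "e \<in> span {a, b}" for e
      proof -
        have "sref a e \<in> span {a, b}"
          unfolding sref_def using that by (intro span_diff span_scale) (auto simp: span_base)
        then show ?thesis
          using reg[of "sref a e"] sref_root[OF simple_root[OF a(1)] that(1)] ca(1)[OF eq]
          by (simp add: sref_inner_swap insert_commute)
      qed
      \<comment> \<open>Here \<open>y\<close> is \<open>sref a z\<close>, so the induction runs on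
        the interval from \<open>sref a x\<close> through \<open>x\<close> to \<open>y\<close>, with
        edges \<open>a\<close> and \<open>b\<close>; its second middle element is reflected up by
        \<open>sref a\<close>.\<close>
      have "\<exists>m. m \<noteq> x \<and> le (sref a x) m \<and> le m y \<and> rk m = Suc (rk (sref a x))"
        by (rule less.hyps[of y a "sref a x" x b])
          (use b rx rks reg' xneg simple_in_pos[OF a(1)] in auto)
      then obtain m where m: "m \<noteq> x" "le (sref a x) m" "le m y" "rk m = Suc (rk (sref a x))" by blast
      have mpos: "m \<bullet> a > 0"
      proof (rule ccontr)
        assume "\<not> m \<bullet> a > 0"
        then have "le x m" using le_sref_left[OF a(1) m(2)] xneg by simp
        then show False using le_rk_eq[of x m] m(1,4) rx by simp
      qed
      have "le x (sref a m)" using le_sref_pos[OF a(1) m(2)] mpos xneg by simp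
      moreover have "le (sref a m) z"
        using le_sref_pos[OF a(1) m(3)] mpos ca(2)[OF eq] eq by auto
      moreover have "sref a m \<noteq> y" using mpos ca(2)[OF eq]
        by (metis sref_inner_self neg_0_less_iff_less not_less_iff_gr_or_eq)
      ultimately show ?thesis using rk_sref_pos[OF a(1) mpos] rx m(4) by (intro exI[of _ "sref a m"]) auto
    qed
  qed
qed

section \<open>Simple reflections as generators, chambers and the longest element\<close>

lemma sref_pos_in_weyl_simple: "b \<in> pos \<Longrightarrow> sref b \<in> weyl \<Delta>"
\<comment> \<open>Heights are real numbers, so the induction counts the positive roots of smaller
  height.\<close>
proof (induction "card {c \<in> pos. c \<bullet> h < b \<bullet> h}" arbitrary: b rule: less_induct)
  case less
  show ?case
  proof (cases "b \<in> \<Delta>")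
    case True
    then show ?thesis by (rule sref_in_weyl)
  next
    case False
    \<comment> \<open>Otherwise \<open>- b\<close> would be dominant and pair non-negatively with
      the positive root \<open>b\<close>. Reflecting in such an \<open>a\<close> gives a positive
      root of smaller height.\<close>
    have "\<exists>a\<in>\<Delta>. b \<bullet> a > 0"
    proof (rule ccontr)
      assume "\<not> ?thesis"
      then have "- b \<bullet> b \<ge> 0"
        using dominantI[of "- b" b] less.prems by (auto simp: pos_def not_less)
      then have "b \<bullet> b \<le> 0" by (simp only: inner_minus_left)
      then show False using pos_nonzero[OF less.prems] inner_gt_zero_iff[of b] by linarith
    qed
    then obtain a where a: "a \<in> \<Delta>" "b \<bullet> a > 0" by blast
    have s: "sref a b \<in> pos" using sref_simple_pos a less.prems False by blast
    have "step b (sref a b)" using stepI simple_in_pos a by blast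
    then have lt: "sref a b \<bullet> h < b \<bullet> h" by (rule step_height)
    then have "{c \<in> pos. c \<bullet> h < sref a b \<bullet> h} \<subset> {c \<in> pos. c \<bullet> h < b \<bullet> h}" using s by auto
    then have "card {c \<in> pos. c \<bullet> h < sref a b \<bullet> h} < card {c \<in> pos. c \<bullet> h < b \<bullet> h}"
      using finite_pos by (intro psubset_card_mono) auto
    then have "sref (sref a b) \<in> weyl \<Delta>" using less.hyps s by blast
    then have "sref a \<circ> sref (sref a b) \<circ> sref a \<in> weyl \<Delta>"
      using weyl_comp[OF weyl_comp] sref_in_weyl[OF a(1)] by blast
    moreover have "sref a \<circ> sref (sref a b) \<circ> sref a = sref b"
      by (rule ext) (simp add: weyl_sref[OF sref_in_weyl, of a "{a}"])
    ultimately show ?thesis by simp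
  qed
qed

lemma weyl_simple: "weyl \<Phi> = weyl \<Delta>"
proof
  show "weyl \<Delta> \<subseteq> weyl \<Phi>" by (rule weyl_mono) (auto intro: simple_root)
  show "weyl \<Phi> \<subseteq> weyl \<Delta>"
  proof
    fix w assume "w \<in> weyl \<Phi>"
    then show "w \<in> weyl \<Delta>"
    proof (induction rule: weyl.induct)
      case (weyl_step w b)
      then have "sref b \<in> weyl \<Delta>"
        using pos_or_neg sref_pos_in_weyl_simple by (metis sref_uminus_root)
      then show ?case using weyl_step weyl_comp by blast
    qed (rule weyl.intros)
  qed
qed

text \<open>Induction over words in simple reflections: \<open>l\<close> pairs non-negatively with
  every simple root, so lifting keeps it below even if the new letter lowers \<open>w l\<close> in
  \<open>le\<close>.\<close>

lemma dom_le:
  assumes "w \<in> weyl \<Phi>" "dom l"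
  shows "le l (w l)"
  using assms(1)[unfolded weyl_simple]
proof (induction rule: weyl.induct)
  case (weyl_step w a)
  have "l \<bullet> a \<ge> 0" using assms(2) weyl_step by (simp add: dom_simple)
  then show ?case
    using le_sref_right[of a l "w l"] leI_pos[of a "w l"] weyl_step simple_in_pos[of a]
    by (cases "w l \<bullet> a \<ge> 0") auto
qed simp

lemma dom_unique: "w \<in> weyl \<Phi> \<Longrightarrow> dom l \<Longrightarrow> dom (w l) \<Longrightarrow> w l = l"
  using le_dom[of l "w l"] dom_le[of w l] by metis

lemma le_orbit: "le x y \<Longrightarrow> \<exists>w\<in>weyl \<Phi>. y = w x"
proof (induction rule: rtranclp_induct)
  case base
  show ?case using bexI[OF _ weyl.weyl_id, of "\<lambda>w. x = w x"] by simp
next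
  case (step y z)
  then obtain w b where "w \<in> weyl \<Phi>" "y = w x" "b \<in> \<Phi>" "z = sref b y"
    by (auto simp: step_def pos_def)
  then show ?case by (intro bexI[of _ "sref b \<circ> w"]) (simp_all del: o_apply add: weyl.weyl_step, simp)
qed

text \<open>\<open>h\<close> and \<open>l\<close> lie in one closed chamber, so their images under
  \<open>w\<close> do too. This carries signs from the free orbit of \<open>h\<close> to singular
  orbits.\<close>

lemma dom_inner_sign:
  assumes "dom l" "w \<in> weyl \<Phi>" "b \<in> \<Phi>" "w h \<bullet> b > 0"
  shows "w l \<bullet> b \<ge> 0"
proof -
  have "inv w b \<in> \<Phi>" using assms weyl_inv weyl_root by blast
  then have "inv w b \<in> pos"
    using assms(4) weyl_inner_inv[OF assms(2), of h b] by (simp add: pos_def inner_commute)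
  then show ?thesis using assms(1) weyl_inner_inv[OF assms(2), of l b] by (simp add: dom_def)
qed

lemma orbit_regular: "w \<in> weyl \<Phi> \<Longrightarrow> b \<in> \<Phi> \<Longrightarrow> w h \<bullet> b \<noteq> 0"
  using regular[of "inv w b"] weyl_root[of "inv w" b] weyl_inv[of w] weyl_inner_inv[of w \<Phi> h b]
    inner_commute[of h "inv w b"] by metis

text \<open>An element fixing \<open>h\<close> fixes every dominant vector, and
  \<open>h + e x\<close> is dominant for small \<open>e > 0\<close> whatever \<open>x\<close> is;
  linearity then gives \<open>w x = x\<close>.\<close>

lemma stab_regular:
  assumes w: "w \<in> weyl \<Phi>" and fixh: "w h = h"
  shows "w = id"
proof
  fix x
  have dfix: "w l = l" if "dom l" for l
  proof (rule dom_unique[OF w that])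
    show "dom (w l)" unfolding dom_def
      using dom_inner_sign[OF that w] fixh by (auto simp: pos_def inner_commute)
  qed
  obtain e where e: "e > 0" "dom (h + e *\<^sub>R x)"
  proof -
    have "\<forall>\<^sub>F e in at_right 0. (h + e *\<^sub>R x) \<bullet> b > 0" if "b \<in> pos" for b
    proof (rule order_tendstoD)
      have "((\<lambda>e. (h + e *\<^sub>R x) \<bullet> b) \<longlongrightarrow> (h + 0 *\<^sub>R x) \<bullet> b) (at_right 0)"
        by (intro tendsto_intros)
      then show "((\<lambda>e. (h + e *\<^sub>R x) \<bullet> b) \<longlongrightarrow> h \<bullet> b) (at_right 0)" by simp
      show "h \<bullet> b > 0" using that by (simp add: pos_def inner_commute)
    qed
    then have "\<forall>\<^sub>F e in at_right 0. \<forall>b\<in>pos. (h + e *\<^sub>R x) \<bullet> b > 0"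
      using finite_pos by (simp add: eventually_ball_finite)
    then have "\<forall>\<^sub>F e in at_right (0::real). e > 0 \<and> (\<forall>b\<in>pos. (h + e *\<^sub>R x) \<bullet> b > 0)"
      by (intro eventually_conj eventually_at_right_less)
    then obtain e :: real where "e > 0" "\<forall>b\<in>pos. (h + e *\<^sub>R x) \<bullet> b > 0"
      using eventually_happens'[OF trivial_limit_at_right_real] by blast
    then show ?thesis by (intro that[of e]) (auto simp: dom_def intro: less_imp_le)
  qed
  have "w (h + e *\<^sub>R x) = h + e *\<^sub>R w x"
    using fixh by (simp add: linear_add[OF weyl_linear[OF w]] linear_scale[OF weyl_linear[OF w]])
  then show "w x = id x" using dfix[OF e(2)] e(1) by simp
qed

text \<open>The witness is the longest element, found as a maximiser of the rank on the orbit of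
  \<open>h\<close>; a positive root positive on \<open>w h\<close> would allow a larger
  rank.\<close>

lemma ex_antidominant: "\<exists>w\<in>weyl \<Phi>. \<forall>l. dom l \<longrightarrow> (\<forall>b\<in>pos. w l \<bullet> b \<le> 0)"
proof -
  have "\<forall>w. w \<in> weyl \<Phi> \<longrightarrow> rk (w h) \<le> card pos"
    unfolding rk_def by (auto intro: card_mono finite_pos)
  then obtain w where w: "w \<in> weyl \<Phi>" "\<forall>u. u \<in> weyl \<Phi> \<longrightarrow> rk (u h) \<le> rk (w h)"
    using ex_has_greatest_nat[of "\<lambda>w. w \<in> weyl \<Phi>" id "\<lambda>w. rk (w h)" "Suc (card pos)"]
      weyl.weyl_id less_Suc_eq_le by blast
  have neg: "w h \<bullet> b < 0" if "b \<in> pos" for b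
  proof -
    have "rk (sref b (w h)) \<le> rk (w h)"
      using w(2)[rule_format, of "sref b \<circ> w"] weyl.weyl_step[OF w(1) pos_root[OF that]] by simp
    then show ?thesis
      using step_iff_rk[OF that, of "w h"] orbit_regular[OF w(1) pos_root[OF that]] by auto
  qed
  have "w l \<bullet> b \<le> 0" if "dom l" "b \<in> pos" for l b
    using dom_inner_sign[OF that(1) w(1), of "- b"] neg[OF that(2)] uminus_root[OF pos_root[OF that(2)]]
    by simp
  then show ?thesis using w(1) by blast
qed

section \<open>Length function, Bruhat order and cosets\<close>

lemma word_prod_Cons: "word_prod (a # xs) = sref a \<circ> word_prod xs"
  by (simp add: word_prod_def)

lemma rk_sref_le: "a \<in> \<Delta> \<Longrightarrow> rk (sref a x) \<le> Suc (rk x)"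
  using rk_sref[of a x] rk_sref_pos[of a x]
  by (metis Suc_n_not_le_n le_SucI linorder_neqE_linordered_idom nat_le_linear order_refl sref_fix)

lemma rk_word_le: "set xs \<subseteq> \<Delta> \<Longrightarrow> rk (word_prod xs h) \<le> length xs"
proof (induction xs)
  case Nil
  then show ?case using dom_h by (simp add: word_prod_def rk_eq_0_iff)
next
  case (Cons a xs)
  then show ?case using rk_sref_le[of a "word_prod xs h"] by (simp add: word_prod_Cons)
qed

text \<open>Simple roots negative on \<open>w h\<close> are split off one by one. At rank zero the
  vector is dominant, hence \<open>h\<close>, and freeness of the orbit gives the identity.\<close>

lemma ex_reduced_word:
  "w \<in> weyl \<Phi> \<Longrightarrow> \<exists>xs. set xs \<subseteq> \<Delta> \<and> length xs = rk (w h) \<and> word_prod xs = w"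
proof (induction "rk (w h)" arbitrary: w)
  case 0
  then have "w = id" using rk_eq_0_iff[of "w h"] dom_unique[OF _ dom_h] stab_regular by metis
  then show ?case using 0 by (intro exI[of _ "[]"]) (simp add: word_prod_def)
next
  case (Suc n)
  then obtain a where a: "a \<in> \<Delta>" "w h \<bullet> a < 0" using rk_pos_simple[of "w h"] by auto
  have "sref a \<circ> w \<in> weyl \<Phi>" "n = rk ((sref a \<circ> w) h)"
    using Suc rk_sref[OF a] weyl.weyl_step[OF _ simple_root[OF a(1)]] by simp_all
  then obtain xs where xs: "set xs \<subseteq> \<Delta>" "length xs = n" "word_prod xs = sref a \<circ> w"
    using Suc.hyps(1)[of "sref a \<circ> w"] by auto
  have "word_prod (a # xs) = w" by (rule ext) (simp add: word_prod_Cons xs(3))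
  then show ?case using xs a Suc.hyps(2) by (intro exI[of _ "a # xs"]) simp
qed

lemma wlen_eq_rk:
  assumes "w \<in> weyl \<Phi>"
  shows "wlen \<Delta> w = rk (w h)"
  unfolding wlen_def
proof (rule Least_equality)
  show "\<exists>xs. set xs \<subseteq> \<Delta> \<and> length xs = rk (w h) \<and> word_prod xs = w"
    by (rule ex_reduced_word[OF assms])
  fix k assume "\<exists>xs. set xs \<subseteq> \<Delta> \<and> length xs = k \<and> word_prod xs = w"
  then show "rk (w h) \<le> k" using rk_word_le by blast
qed

text \<open>The length condition gives a strict sign on the orbit of \<open>h\<close>; on the orbit
  of \<open>l\<close> the sign survives weakly, so each Bruhat edge becomes a step or a fixed
  point.\<close>

lemma bruhat_le_imp_le:
  assumes "bruhat_le \<Phi> \<Delta> u w" "dom l"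
  shows "le (u l) (w l)"
  using assms(1) unfolding bruhat_le_def
proof (induction rule: rtranclp_induct)
  case (step v w)
  then obtain b where b: "v \<in> weyl \<Phi>" "b \<in> \<Phi>" "w = sref b \<circ> v" "wlen \<Delta> v < wlen \<Delta> w" by auto
  obtain c where c: "c \<in> pos" "w = sref c \<circ> v"
    using pos_or_neg[OF b(2)] b(3) by (metis sref_uminus_root)
  have "w \<in> weyl \<Phi>" unfolding b(3) by (rule weyl.weyl_step[OF b(1,2)])
  then have "rk (v h) < rk (sref c (v h))" using b(1,4) c by (simp add: wlen_eq_rk)
  then have "v h \<bullet> c > 0" using step_iff_rk[OF c(1)] orbit_regular[OF b(1) pos_root[OF c(1)]] by simp
  then have "le (v l) (w l)"
    using dom_inner_sign[OF assms(2) b(1) pos_root[OF c(1)]] leI_pos[OF c(1)] c(2) by simp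
  then show ?case using step.IH by simp
qed simp

text \<open>A strict sign on the singular orbit is strict on the orbit of \<open>h\<close> as well,
  so a path of steps lifts to W from any prescribed representative \<open>u\<close> of its
  start.\<close>

lemma le_imp_bruhat_le:
  assumes "le (u l) y" "dom l" "u \<in> weyl \<Phi>"
  shows "\<exists>w\<in>weyl \<Phi>. y = w l \<and> bruhat_le \<Phi> \<Delta> u w"
  using assms(1)
proof (induction rule: rtranclp_induct)
  case base
  then show ?case using assms by (auto simp: bruhat_le_def)
next
  case (step y z)
  then obtain v where v: "v \<in> weyl \<Phi>" "y = v l" "bruhat_le \<Phi> \<Delta> u v" by blast
  obtain b where b: "b \<in> pos" "y \<bullet> b > 0" "z = sref b y" using step(2) by (auto simp: step_def)
  have "\<not> v h \<bullet> - b > 0"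
    using dom_inner_sign[OF assms(2) v(1) uminus_root[OF pos_root[OF b(1)]]] b v by auto
  then have p: "v h \<bullet> b > 0" using orbit_regular[OF v(1) pos_root[OF b(1)]] by simp
  have w: "sref b \<circ> v \<in> weyl \<Phi>" by (rule weyl.weyl_step[OF v(1) pos_root[OF b(1)]])
  have "rk (v h) < rk (sref b (v h))" using step_iff_rk[OF b(1)] p by simp
  then have "wlen \<Delta> v < wlen \<Delta> (sref b \<circ> v)" by (simp add: wlen_eq_rk v(1) w)
  then have "bruhat_le \<Phi> \<Delta> v (sref b \<circ> v)"
    unfolding bruhat_le_def using v(1) pos_root[OF b(1)] by (intro r_into_rtranclp) blast
  then have "bruhat_le \<Phi> \<Delta> u (sref b \<circ> v)"
    using v(3) unfolding bruhat_le_def by (rule rtranclp_trans[rotated])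
  moreover have "z = (sref b \<circ> v) l" using b(3) v(2) by simp
  ultimately show ?case using w by blast
qed

lemma coset_stab:
  assumes "w \<in> weyl \<Phi>"
  shows "coset w (stab \<Phi> n) = {u \<in> weyl \<Phi>. u n = w n}"
proof (intro equalityI subsetI)
  fix u assume "u \<in> {u \<in> weyl \<Phi>. u n = w n}"
  then have "inv w \<circ> u \<in> stab \<Phi> n" "u = w \<circ> (inv w \<circ> u)"
    using assms weyl_comp[OF weyl_inv[OF assms], of u] by (auto simp: stab_def)
  then show "u \<in> coset w (stab \<Phi> n)" unfolding coset_def by (metis image_eqI)
next
  fix u assume "u \<in> coset w (stab \<Phi> n)"
  then obtain k where "k \<in> weyl \<Phi>" "k n = n" "u = w \<circ> k" by (auto simp: coset_def stab_def)
  then show "u \<in> {u \<in> weyl \<Phi>. u n = w n}" using weyl_comp[OF assms] by simp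
qed

lemma coset_stab_eq_iff:
  assumes "u \<in> weyl \<Phi>" "w \<in> weyl \<Phi>"
  shows "coset u (stab \<Phi> n) = coset w (stab \<Phi> n) \<longleftrightarrow> u n = w n"
proof
  assume "coset u (stab \<Phi> n) = coset w (stab \<Phi> n)"
  moreover have "u \<in> coset u (stab \<Phi> n)" using assms by (simp add: coset_stab)
  ultimately show "u n = w n" using assms by (simp add: coset_stab)
qed (simp add: coset_stab assms)

lemma cle_coset_iff:
  assumes "dom n" "u \<in> weyl \<Phi>" "w \<in> weyl \<Phi>"
  shows "cle \<Phi> \<Delta> (coset u (stab \<Phi> n)) (coset w (stab \<Phi> n)) \<longleftrightarrow> le (u n) (w n)"
proof
  assume "cle \<Phi> \<Delta> (coset u (stab \<Phi> n)) (coset w (stab \<Phi> n))"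
  then obtain a b where "a n = u n" "b n = w n" "bruhat_le \<Phi> \<Delta> a b"
    by (auto simp: cle_def coset_stab assms)
  then show "le (u n) (w n)" using bruhat_le_imp_le[OF _ assms(1)] by metis
next
  assume "le (u n) (w n)"
  then obtain v where "v \<in> weyl \<Phi>" "w n = v n" "bruhat_le \<Phi> \<Delta> u v"
    using le_imp_bruhat_le assms by blast
  then show "cle \<Phi> \<Delta> (coset u (stab \<Phi> n)) (coset w (stab \<Phi> n))"
    using assms by (auto simp: cle_def coset_stab)
qed

lemma proj_coset:
  assumes "w \<in> weyl \<Phi>" "stab \<Phi> l \<subseteq> stab \<Phi> n"
  shows "proj (stab \<Phi> n) (coset w (stab \<Phi> l)) = coset w (stab \<Phi> n)"
proof (intro equalityI subsetI)
  fix u assume "u \<in> proj (stab \<Phi> n) (coset w (stab \<Phi> l))"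
  then obtain g k where g: "g \<in> stab \<Phi> l" "k \<in> stab \<Phi> n" "u = w \<circ> g \<circ> k"
    by (auto simp: proj_def coset_def)
  then have "g \<circ> k \<in> stab \<Phi> n" using assms(2) weyl_comp[of g \<Phi> k] by (auto simp: stab_def)
  then show "u \<in> coset w (stab \<Phi> n)" using g(3) by (auto simp: coset_def comp_assoc)
next
  fix u assume "u \<in> coset w (stab \<Phi> n)"
  then obtain k where k: "k \<in> stab \<Phi> n" "u = w \<circ> k" by (auto simp: coset_def)
  have "w \<in> coset w (stab \<Phi> l)" using assms(1) by (simp add: coset_stab)
  then show "u \<in> proj (stab \<Phi> n) (coset w (stab \<Phi> l))" using k by (force simp: proj_def)
qed

text \<open>A root negative on \<open>u l\<close> is negative on \<open>u h\<close>: the signs agree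
  weakly and \<open>u h\<close> is orthogonal to no root.\<close>

lemma rk_orbit_le: "dom l \<Longrightarrow> u \<in> weyl \<Phi> \<Longrightarrow> rk (u l) \<le> rk (u h)"
  unfolding rk_def
proof (rule card_mono)
  assume *: "dom l" "u \<in> weyl \<Phi>"
  have "u h \<bullet> b < 0" if "b \<in> pos" "u l \<bullet> b < 0" for b
    using dom_inner_sign[OF * pos_root[OF that(1)]] orbit_regular[OF *(2) pos_root[OF that(1)]] that(2)
    by linarith
  then show "{b \<in> pos. u l \<bullet> b < 0} \<subseteq> {b \<in> pos. u h \<bullet> b < 0}" by blast
qed (simp add: finite_pos)

text \<open>The descent of \<open>w l\<close> to the dominant vector is copied on the orbit of
  \<open>h\<close>, where each simple reflection changes the rank by at most one.\<close>

lemma ex_min_representative: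
  "dom l \<Longrightarrow> w \<in> weyl \<Phi> \<Longrightarrow> \<exists>u\<in>weyl \<Phi>. u l = w l \<and> rk (u h) \<le> rk (w l)"
proof (induction "rk (w l)" arbitrary: w)
  case 0
  then have "w l = l" using rk_eq_0_iff[of "w l"] dom_unique by simp
  moreover have "rk h = 0" using dom_h by (simp add: rk_eq_0_iff)
  ultimately show ?case by (intro bexI[of _ id] weyl.weyl_id) simp
next
  case (Suc n)
  then obtain a where a: "a \<in> \<Delta>" "w l \<bullet> a < 0" using rk_pos_simple[of "w l"] by auto
  have "sref a \<circ> w \<in> weyl \<Phi>" "n = rk ((sref a \<circ> w) l)"
    using Suc rk_sref[OF a] weyl.weyl_step[OF _ simple_root[OF a(1)]] by simp_all
  then obtain u where u: "u \<in> weyl \<Phi>" "u l = sref a (w l)" "rk (u h) \<le> n"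
    using Suc.hyps(1)[of "sref a \<circ> w"] Suc.prems by auto
  then show ?case
    using Suc.hyps(2) rk_sref_le[OF a(1), of "u h"] weyl.weyl_step[OF u(1) simple_root[OF a(1)]]
    by (intro bexI[of _ "sref a \<circ> u"]) simp_all
qed

lemma wrank_coset:
  assumes "dom l" "w \<in> weyl \<Phi>"
  shows "wrank \<Delta> (coset w (stab \<Phi> l)) = rk (w l)"
proof -
  let ?S = "wlen \<Delta> ` coset w (stab \<Phi> l)"
  have S: "?S = (\<lambda>u. rk (u h)) ` {u \<in> weyl \<Phi>. u l = w l}"
    using assms by (auto simp: coset_stab wlen_eq_rk)
  have "?S \<subseteq> {..card pos}"
    unfolding S by (auto simp: rk_def intro: card_mono finite_pos)
  then have fin: "finite ?S" using finite_subset by blast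
  have lb: "rk (w l) \<le> r" if "r \<in> ?S" for r
    using that rk_orbit_le[OF assms(1)] unfolding S by fastforce
  obtain u where u: "u \<in> weyl \<Phi>" "u l = w l" "rk (u h) \<le> rk (w l)"
    using ex_min_representative[OF assms] by blast
  then have "rk (u h) \<in> ?S" unfolding S by auto
  then have "rk (w l) \<in> ?S" using lb u(3) by (metis le_antisym order.antisym)
  then show ?thesis unfolding wrank_def using lb by (intro Min_eqI[OF fin]) auto
qed

end

section \<open>Fibres of projections\<close>

text \<open>The projection from W/W_l to W/W_n, seen as the map from \<open>w l\<close> to
  \<open>w n\<close>; the inclusion of stabilizers makes it well defined.\<close>

locale fibration = positive_system \<Phi> \<Delta> h for \<Phi> \<Delta> :: "'v::euclidean_space set" and h +
  fixes l n :: 'v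
  assumes dom_l: "dom l" and dom_n: "dom n" and stab_le: "stab \<Phi> l \<subseteq> stab \<Phi> n"
begin

definition orb :: "'v \<Rightarrow> 'v \<Rightarrow> bool" where
  "orb x p \<longleftrightarrow> (\<exists>w\<in>weyl \<Phi>. x = w l \<and> p = w n)"

text \<open>The local form of being minimal in the fibre over \<open>p\<close>: dominance with
  respect to the roots orthogonal to \<open>p\<close>.\<close>

definition mindom :: "'v \<Rightarrow> 'v \<Rightarrow> bool" where
  "mindom x p \<longleftrightarrow> (\<forall>b\<in>pos. p \<bullet> b = 0 \<longrightarrow> x \<bullet> b \<ge> 0)"

lemma orb_weyl: "w \<in> weyl \<Phi> \<Longrightarrow> orb (w l) (w n)"
  by (auto simp: orb_def)

lemma orb_sref: "orb x p \<Longrightarrow> b \<in> \<Phi> \<Longrightarrow> orb (sref b x) (sref b p)"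
proof -
  assume "orb x p" and b: "b \<in> \<Phi>"
  then obtain w where w: "w \<in> weyl \<Phi>" "x = w l" "p = w n" by (auto simp: orb_def)
  show ?thesis using orb_weyl[OF weyl.weyl_step[OF w(1) b]] w by simp
qed

lemma orb_fun: "orb x p \<Longrightarrow> orb x q \<Longrightarrow> p = q"
proof -
  assume "orb x p" "orb x q"
  then obtain u w where u: "u \<in> weyl \<Phi>" "x = u l" "p = u n" and w: "w \<in> weyl \<Phi>" "x = w l" "q = w n"
    by (auto simp: orb_def)
  have "inv w (u l) = inv w (w l)" using u(2) w(2) by simp
  then have "inv w \<circ> u \<in> stab \<Phi> l"
    using weyl_comp[OF weyl_inv[OF w(1)] u(1)] weyl_inv_cancel(2)[OF w(1)] by (simp add: stab_def)
  then have "inv w (u n) = n" using stab_le by (auto simp: stab_def)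
  then have "w (inv w (u n)) = w n" by simp
  then show ?thesis using w u by simp
qed

text \<open>Moving \<open>w\<close> to the root reduces the claim to \<open>l\<close> and
  \<open>n\<close>. Both are dominant, and a root orthogonal to \<open>l\<close> is orthogonal to
  \<open>n\<close> because its reflection lies in the smaller stabilizer.\<close>

lemma orb_sign:
  assumes "orb x p" "b \<in> \<Phi>"
  shows "p \<bullet> b > 0 \<Longrightarrow> x \<bullet> b > 0" and "x \<bullet> b > 0 \<Longrightarrow> p \<bullet> b \<ge> 0" and "x \<bullet> b = 0 \<Longrightarrow> p \<bullet> b = 0"
proof -
  obtain w where w: "w \<in> weyl \<Phi>" "x = w l" "p = w n" using assms by (auto simp: orb_def)
  define c where "c = inv w b"
  have c: "c \<in> \<Phi>" using weyl_root[OF weyl_inv[OF w(1)] assms(2)] by (simp add: c_def)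
  have eq: "x \<bullet> b = l \<bullet> c" "p \<bullet> b = n \<bullet> c" using weyl_inner_inv[OF w(1)] w by (simp_all add: c_def)
  have zero: "n \<bullet> c = 0" if "l \<bullet> c = 0"
  proof -
    have "sref c \<in> stab \<Phi> l" using sref_fix[OF that] sref_in_weyl[OF c] by (simp add: stab_def)
    then have "sref c n = n" using stab_le by (auto simp: stab_def)
    then show ?thesis using sref_eq_iff[of c n] c zero_notin by auto
  qed
  have d: "l \<bullet> c \<ge> 0 \<and> n \<bullet> c \<ge> 0 \<or> l \<bullet> c \<le> 0 \<and> n \<bullet> c \<le> 0"
    using pos_or_neg[OF c] dom_l dom_n by (fastforce simp: dom_def)
  show "p \<bullet> b > 0 \<Longrightarrow> x \<bullet> b > 0" "x \<bullet> b > 0 \<Longrightarrow> p \<bullet> b \<ge> 0" "x \<bullet> b = 0 \<Longrightarrow> p \<bullet> b = 0"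
    unfolding eq using d zero by linarith+
qed

lemma orb_neg:
  assumes "orb x p" "b \<in> \<Phi>"
  shows "p \<bullet> b < 0 \<Longrightarrow> x \<bullet> b < 0" and "x \<bullet> b < 0 \<Longrightarrow> p \<bullet> b \<le> 0"
  using orb_sign[OF assms(1) uminus_root[OF assms(2)]] by simp_all

text \<open>Monotonicity of the projection: a step upstairs becomes a step or a fixed point
  downstairs.\<close>

lemma le_orb: "le x y \<Longrightarrow> orb x p \<Longrightarrow> \<exists>q. orb y q \<and> le p q"
proof (induction rule: rtranclp_induct)
  case (step y z)
  then obtain q b where q: "orb y q" "le p q" and b: "b \<in> pos" "y \<bullet> b > 0" "z = sref b y"
    using step.IH[OF step.prems] step.hyps(2) unfolding step_def by blast
  have "le q (sref b q)" using orb_sign(2)[OF q(1) pos_root[OF b(1)] b(2)] leI_pos[OF b(1)] by blast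
  then show ?case using orb_sref[OF q(1) pos_root[OF b(1)]] q(2) b(3) by (meson rtranclp_trans)
qed auto

text \<open>A root violating \<open>mindom\<close> is orthogonal to \<open>q\<close>, so its
  reflection stays in the fibre and lowers the rank.\<close>

lemma ex_mindom: "orb y q \<Longrightarrow> \<exists>m. orb m q \<and> mindom m q \<and> le m y"
proof (induction "rk y" arbitrary: y rule: less_induct)
  case less
  show ?case
  proof (cases "mindom y q")
    case True
    then show ?thesis using less.prems by auto
  next
    case False
    then obtain b where b: "b \<in> pos" "q \<bullet> b = 0" "y \<bullet> b < 0" by (auto simp: mindom_def not_le)
    have l: "le (sref b y) y" using leI_neg b by simp
    moreover have "sref b y \<noteq> y" using b sref_eq_iff[OF pos_nonzero[OF b(1)]] by simp
    ultimately have "rk (sref b y) < rk y" by (rule rk_less)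
    moreover have "orb (sref b y) q"
      using orb_sref[OF less.prems pos_root[OF b(1)]] sref_fix[OF b(2)] by simp
    ultimately show ?thesis using less.hyps l by (meson rtranclp_trans)
  qed
qed

lemma mindom_sref:
  assumes "a \<in> \<Delta>" "p \<bullet> a \<noteq> 0" "mindom x p"
  shows "mindom (sref a x) (sref a p)"
  unfolding mindom_def
proof (intro ballI impI)
  fix b assume b: "b \<in> pos" "sref a p \<bullet> b = 0"
  then have "b \<noteq> a" using assms(2) by auto
  then have "sref a b \<in> pos" using sref_simple_pos assms(1) b(1) by blast
  then show "sref a x \<bullet> b \<ge> 0" using assms(3) b(2) by (simp add: mindom_def sref_inner_swap)
qed

lemma mindom_base:
  assumes "orb x n" "mindom x n"
  shows "x = l"
proof -
  have "dom x" unfolding dom_def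
  proof
    fix b assume b: "b \<in> pos"
    then have "n \<bullet> b = 0 \<or> n \<bullet> b > 0" using dom_n by (force simp: dom_def)
    then show "x \<bullet> b \<ge> 0"
      using assms b orb_sign(1)[OF assms(1) pos_root[OF b]] by (auto simp: mindom_def)
  qed
  then show ?thesis using assms(1) dom_unique[OF _ dom_l] by (auto simp: orb_def)
qed

lemma rk_0_base: "orb x p \<Longrightarrow> rk p = 0 \<Longrightarrow> p = n"
  using rk_eq_0_iff[of p] dom_unique[OF _ dom_n] by (auto simp: orb_def)

text \<open>Simple reflections that lower \<open>p\<close> preserve \<open>mindom\<close>; they lead
  to \<open>p = n\<close>, where \<open>mindom\<close> together with dominance of \<open>n\<close>
  forces the dominant vector \<open>l\<close>.\<close>

lemma mindom_unique:
  "orb x p \<Longrightarrow> orb y p \<Longrightarrow> mindom x p \<Longrightarrow> mindom y p \<Longrightarrow> x = y"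
proof (induction "rk p" arbitrary: p x y)
  case 0
  then show ?case using rk_0_base[of x p] mindom_base by metis
next
  case (Suc k)
  then obtain a where a: "a \<in> \<Delta>" "p \<bullet> a < 0" using rk_pos_simple[of p] by auto
  have "sref a x = sref a y"
    using Suc rk_sref[OF a] a mindom_sref orb_sref[OF _ simple_root[OF a(1)]]
    by (intro Suc.hyps(1)[of "sref a p"]) auto
  then show ?case by (metis sref_sref)
qed

text \<open>Minimal lifts are monotone even against arbitrary lifts above them. The induction lowers
  \<open>q\<close> by a simple root \<open>a\<close> negative on it; then \<open>a\<close> is
  negative on \<open>y\<close> and \<open>m\<close> too, and lifting compares \<open>z\<close> or
  \<open>sref a z\<close> with the reflected lifts.\<close>

lemma mindom_mono:
  "\<lbrakk>orb z p; mindom z p; orb y q; orb m q; mindom m q; le z y\<rbrakk> \<Longrightarrow> le z m"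
proof (induction "rk q" arbitrary: p q z y m)
  case 0
  then have q: "q = n" using rk_0_base by simp
  have "le p q" using le_orb[OF \<open>le z y\<close> \<open>orb z p\<close>] orb_fun[OF \<open>orb y q\<close>] by auto
  then have "p = n" using q le_dom dom_n by simp
  then have "z = l" using mindom_base 0 by simp
  then show ?case using dom_le[OF _ dom_l] \<open>orb m q\<close> by (auto simp: orb_def)
next
  case (Suc k)
  then obtain a where a: "a \<in> \<Delta>" "q \<bullet> a < 0" using rk_pos_simple[of q] by auto
  note ar = simple_root[OF a(1)]
  have ya: "y \<bullet> a < 0" and ma: "m \<bullet> a < 0"
    using orb_neg(1)[OF _ ar] Suc.prems a by auto
  have k: "k = rk (sref a q)" using Suc.hyps(2) rk_sref[OF a] by simp
  have y': "orb (sref a y) (sref a q)" and m': "orb (sref a m) (sref a q)"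
    and mm: "mindom (sref a m) (sref a q)"
    using Suc.prems a orb_sref[OF _ ar] mindom_sref[OF a(1)] by auto
  show ?case
  proof (cases "z \<bullet> a \<ge> 0")
    case True
    have "le z (sref a y)" using le_sref_right[OF a(1)] Suc.prems(6) True ya by simp
    then have "le z (sref a m)" using Suc.hyps(1)[OF k] Suc.prems(1,2) y' m' mm by blast
    then show ?thesis using leI_neg[OF simple_in_pos[OF a(1)], of m] ma by simp
  next
    case False
    \<comment> \<open>The value zero is excluded: \<open>z\<close> is minimal over \<open>p\<close>
      and would then pair non-negatively with \<open>a\<close>.\<close>
    then have pa: "p \<bullet> a < 0"
      using orb_neg(2)[OF Suc.prems(1) ar] Suc.prems(2) simple_in_pos[OF a(1)] by (force simp: mindom_def)
    have "le (sref a z) (sref a y)" using le_sref_neg[OF a(1)] Suc.prems(6) False ya by simp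
    moreover have "mindom (sref a z) (sref a p)"
      using mindom_sref[OF a(1) _ Suc.prems(2)] pa by simp
    ultimately have "le (sref a z) (sref a m)"
      using Suc.hyps(1)[OF k] y' m' mm orb_sref[OF Suc.prems(1) ar] by blast
    then have "le (sref a (sref a z)) (sref a (sref a m))"
      using le_sref_pos[OF a(1), of "sref a z" "sref a m"] False ma by simp
    then show ?thesis by simp
  qed
qed

lemma mindom_least: "orb m q \<Longrightarrow> mindom m q \<Longrightarrow> orb y q \<Longrightarrow> le m y"
  using ex_mindom[of y q] mindom_unique[of m q] by blast

definition least :: "'v \<Rightarrow> 'v \<Rightarrow> bool" where
  "least x p \<longleftrightarrow> orb x p \<and> (\<forall>y. orb y p \<longrightarrow> le x y)"

lemma ex_least: "w \<in> weyl \<Phi> \<Longrightarrow> \<exists>m. least m (w n)"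
  using ex_mindom[OF orb_weyl] mindom_least unfolding least_def by blast

lemma least_mindom: "least x p \<Longrightarrow> mindom x p"
  using ex_mindom[of x p] le_antisym by (auto simp: least_def)

lemma least_mono: "least z p \<Longrightarrow> least m q \<Longrightarrow> orb y q \<Longrightarrow> le z y \<Longrightarrow> le z m"
  using mindom_mono least_mindom by (auto simp: least_def)

end

section \<open>Maximal lifts through the opposite positive system\<close>

context positive_system
begin

lemma opposite: "positive_system \<Phi> (uminus ` \<Delta>) (- h)"
proof
  fix a b assume a: "a \<in> uminus ` \<Delta>" and b: "b \<in> \<Phi>" "b \<bullet> - h > 0" "b \<noteq> a"
  then obtain c where c: "c \<in> \<Delta>" "a = - c" by blast
  have "- b \<noteq> c" using b c by auto
  then have "sref c (- b) \<bullet> h > 0"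
    using simple_perm[OF c(1) uminus_root[OF b(1)]] b by simp
  then show "sref a b \<bullet> - h > 0" using c linear_neg[OF linear_sref, of c b] by simp
next
  fix x b assume x: "\<And>a. a \<in> uminus ` \<Delta> \<Longrightarrow> x \<bullet> a \<ge> 0" and b: "b \<in> \<Phi>" "b \<bullet> - h > 0"
  have "- x \<bullet> a \<ge> 0" if "a \<in> \<Delta>" for a using x[of "- a"] that by simp
  then show "x \<bullet> b \<ge> 0" using dominantI[of "- x" "- b"] uminus_root[OF b(1)] b(2) by simp
qed (use finite_roots zero_notin sref_root reduced regular simple_root simple_pos uminus_root in auto)

lemma opposite_pos: "b \<in> positive_system.pos \<Phi> (- h) \<longleftrightarrow> - b \<in> pos"
proof -
  interpret opp: positive_system \<Phi> "uminus ` \<Delta>" "- h" by (rule opposite)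
  show ?thesis using uminus_root[of b] uminus_root[of "- b"] by (auto simp: opp.pos_def pos_def)
qed

lemma opposite_step: "positive_system.step \<Phi> (- h) x y \<longleftrightarrow> step y x"
proof -
  interpret opp: positive_system \<Phi> "uminus ` \<Delta>" "- h" by (rule opposite)
  show ?thesis
  proof
    assume "opp.step x y"
    then obtain b where "- b \<in> pos" "x \<bullet> b > 0" "y = sref b x"
      using opposite_pos unfolding opp.step_def by blast
    then show "step y x" using stepI[of "- b" y] by auto
  next
    assume "step y x"
    then obtain b where "b \<in> pos" "y \<bullet> b > 0" "x = sref b y"
      unfolding step_def by blast
    then show "opp.step x y" using opp.stepI[of "- b" x] by (simp add: opposite_pos)
  qed
qed

lemma opposite_le: "(positive_system.step \<Phi> (- h))\<^sup>*\<^sup>* x y \<longleftrightarrow> le y x"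
proof -
  have "positive_system.step \<Phi> (- h) = step\<inverse>\<inverse>" by (intro ext) (simp add: opposite_step)
  then show ?thesis by (simp add: rtranclp_conversep)
qed

end

context fibration
begin

definition greatest :: "'v \<Rightarrow> 'v \<Rightarrow> bool" where
  "greatest x p \<longleftrightarrow> orb x p \<and> (\<forall>y. orb y p \<longrightarrow> le y x)"

text \<open>The longest element sends \<open>l\<close> and \<open>n\<close> to vectors dominant for
  the opposite system. The orbits, and hence the projection, are unchanged, while least elements of
  fibres become greatest ones.\<close>

lemma opposite_fibration:
  obtains w where "w \<in> weyl \<Phi>" "fibration \<Phi> (uminus ` \<Delta>) (- h) (w l) (w n)"
    "\<And>x p. fibration.orb \<Phi> (w l) (w n) x p \<longleftrightarrow> orb x p"
    "\<And>x p. fibration.least \<Phi> (- h) (w l) (w n) x p \<longleftrightarrow> greatest x p"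
proof -
  interpret opp: positive_system \<Phi> "uminus ` \<Delta>" "- h" by (rule opposite)
  obtain w where w: "w \<in> weyl \<Phi>" "\<And>l b. dom l \<Longrightarrow> b \<in> pos \<Longrightarrow> w l \<bullet> b \<le> 0"
    using ex_antidominant by blast
  have "opp.dom (w k)" if "dom k" for k
    using w(2)[OF that] opposite_pos unfolding opp.dom_def by force
  moreover have "stab \<Phi> (w l) \<subseteq> stab \<Phi> (w n)"
  proof
    fix u assume u: "u \<in> stab \<Phi> (w l)"
    have "inv w (u (w l)) = l" using u w(1) by (simp add: stab_def)
    moreover have "inv w \<circ> (u \<circ> w) \<in> weyl \<Phi>"
      using u w(1) by (intro weyl_comp weyl_inv) (auto simp: stab_def)
    ultimately have "inv w \<circ> (u \<circ> w) \<in> stab \<Phi> l" by (simp add: stab_def)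
    then have "inv w (u (w n)) = n" using stab_le by (auto simp: stab_def)
    then have "w (inv w (u (w n))) = w n" by simp
    then show "u \<in> stab \<Phi> (w n)" using u w(1) by (simp add: stab_def)
  qed
  ultimately interpret fop: fibration \<Phi> "uminus ` \<Delta>" "- h" "w l" "w n"
    using dom_l dom_n by unfold_locales auto
  have o: "fop.orb x p \<longleftrightarrow> orb x p" for x p
  proof
    assume "fop.orb x p"
    then obtain u where u: "u \<in> weyl \<Phi>" "x = u (w l)" "p = u (w n)" by (auto simp: fop.orb_def)
    then show "orb x p" using orb_weyl[OF weyl_comp[OF u(1) w(1)]] by simp
  next
    assume "orb x p"
    then obtain u where u: "u \<in> weyl \<Phi>" "x = u l" "p = u n" by (auto simp: orb_def)
    then show "fop.orb x p"
      using fop.orb_weyl[OF weyl_comp[OF u(1) weyl_inv[OF w(1)]]] w(1) by simp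
  qed
  moreover have "fop.least x p \<longleftrightarrow> greatest x p" for x p
    unfolding fop.least_def greatest_def o opposite_le ..
  ultimately show ?thesis using that w(1) fop.fibration_axioms by blast
qed

lemma ex_greatest: "u \<in> weyl \<Phi> \<Longrightarrow> \<exists>m. greatest m (u n)"
proof -
  assume u: "u \<in> weyl \<Phi>"
  obtain w where w: "w \<in> weyl \<Phi>" "fibration \<Phi> (uminus ` \<Delta>) (- h) (w l) (w n)"
    "\<And>x p. fibration.orb \<Phi> (w l) (w n) x p \<longleftrightarrow> orb x p"
    "\<And>x p. fibration.least \<Phi> (- h) (w l) (w n) x p \<longleftrightarrow> greatest x p"
    using opposite_fibration by blast
  show ?thesis
    using fibration.ex_least[OF w(2) weyl_comp[OF u weyl_inv[OF w(1)]]] w(1) by (simp add: w(4))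
qed

lemma greatest_mono:
  assumes "greatest z p" "greatest m q" "orb y q" "le y z"
  shows "le m z"
proof -
  obtain w where w: "w \<in> weyl \<Phi>" "fibration \<Phi> (uminus ` \<Delta>) (- h) (w l) (w n)"
    "\<And>x p. fibration.orb \<Phi> (w l) (w n) x p \<longleftrightarrow> orb x p"
    "\<And>x p. fibration.least \<Phi> (- h) (w l) (w n) x p \<longleftrightarrow> greatest x p"
    using opposite_fibration by blast
  show ?thesis
    using fibration.least_mono[OF w(2), unfolded w(3,4) opposite_le] assms by blast
qed

section \<open>Minimal and maximal lifts of cosets\<close>

abbreviation (input) "QQ \<equiv> stab \<Phi> l"
abbreviation (input) "HH \<equiv> stab \<Phi> n"

lemma quot_cases:
  assumes "A \<in> quot \<Phi> QQ"
  obtains w where "w \<in> weyl \<Phi>" "A = coset w QQ" "proj HH A = coset w HH"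
  using assms proj_coset[OF _ stab_le] by (auto simp: quot_def)

lemma fibre_coset_iff:
  assumes "w \<in> weyl \<Phi>" "u \<in> weyl \<Phi>"
  shows "proj HH (coset u QQ) = coset w HH \<longleftrightarrow> orb (u l) (w n)"
  using assms coset_stab_eq_iff[OF assms(2,1)] orb_fun[OF orb_weyl[OF assms(2)], of "w n"]
    orb_weyl[OF assms(2)] by (auto simp: proj_coset stab_le)

text \<open>Being a value of \<open>pmin\<close>, expressed without the definite
  description.\<close>

definition fibre_least :: "('v \<Rightarrow> 'v) set \<Rightarrow> bool" where
  "fibre_least A \<longleftrightarrow> A \<in> quot \<Phi> QQ \<and> (\<forall>B\<in>quot \<Phi> QQ. proj HH B = proj HH A \<longrightarrow> cle \<Phi> \<Delta> A B)"

definition fibre_greatest :: "('v \<Rightarrow> 'v) set \<Rightarrow> bool" where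
  "fibre_greatest A \<longleftrightarrow> A \<in> quot \<Phi> QQ \<and> (\<forall>B\<in>quot \<Phi> QQ. proj HH B = proj HH A \<longrightarrow> cle \<Phi> \<Delta> B A)"

lemma cle_quot_antisym:
  assumes "A \<in> quot \<Phi> QQ" "B \<in> quot \<Phi> QQ" "cle \<Phi> \<Delta> A B" "cle \<Phi> \<Delta> B A"
  shows "A = B"
proof -
  obtain u w where "u \<in> weyl \<Phi>" "A = coset u QQ" "w \<in> weyl \<Phi>" "B = coset w QQ"
    using assms(1,2) by (auto simp: quot_def)
  then show ?thesis using assms(3,4) le_antisym by (simp add: cle_coset_iff dom_l coset_stab_eq_iff)
qed

lemma fibre_least_coset:
  assumes "w \<in> weyl \<Phi>"
  shows "fibre_least (coset w QQ) \<longleftrightarrow> least (w l) (w n)"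
  unfolding fibre_least_def least_def quot_def
  using assms orb_weyl[OF assms]
  by (auto simp: proj_coset[OF assms stab_le] fibre_coset_iff cle_coset_iff dom_l) (auto simp: orb_def)

lemma fibre_greatest_coset:
  assumes "w \<in> weyl \<Phi>"
  shows "fibre_greatest (coset w QQ) \<longleftrightarrow> greatest (w l) (w n)"
  unfolding fibre_greatest_def greatest_def quot_def
  using assms orb_weyl[OF assms]
  by (auto simp: proj_coset[OF assms stab_le] fibre_coset_iff cle_coset_iff dom_l) (auto simp: orb_def)

lemma ex_fibre_least:
  assumes "C \<in> quot \<Phi> HH"
  shows "\<exists>A. fibre_least A \<and> proj HH A = C"
proof -
  obtain w where w: "w \<in> weyl \<Phi>" "C = coset w HH" using assms by (auto simp: quot_def)
  obtain m where m: "least m (w n)" using ex_least w by blast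
  then obtain u where u: "u \<in> weyl \<Phi>" "m = u l" "w n = u n" by (auto simp: least_def orb_def)
  then have "fibre_least (coset u QQ)" using m by (simp add: fibre_least_coset)
  moreover have "proj HH (coset u QQ) = C" using u w by (simp add: proj_coset[OF _ stab_le] coset_stab_eq_iff)
  ultimately show ?thesis by blast
qed

lemma ex_fibre_greatest:
  assumes "C \<in> quot \<Phi> HH"
  shows "\<exists>A. fibre_greatest A \<and> proj HH A = C"
proof -
  obtain w where w: "w \<in> weyl \<Phi>" "C = coset w HH" using assms by (auto simp: quot_def)
  obtain m where m: "greatest m (w n)" using ex_greatest w by blast
  then obtain u where u: "u \<in> weyl \<Phi>" "m = u l" "w n = u n" by (auto simp: greatest_def orb_def)
  then have "fibre_greatest (coset u QQ)" using m by (simp add: fibre_greatest_coset)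
  moreover have "proj HH (coset u QQ) = C" using u w by (simp add: proj_coset[OF _ stab_le] coset_stab_eq_iff)
  ultimately show ?thesis by blast
qed

lemma pmin_eq:
  assumes "fibre_least A"
  shows "pmin \<Phi> \<Delta> QQ HH (proj HH A) = A"
  unfolding pmin_def
proof (rule the_equality)
  show "A \<in> quot \<Phi> QQ \<and> proj HH A = proj HH A \<and>
    (\<forall>B\<in>quot \<Phi> QQ. proj HH B = proj HH A \<longrightarrow> cle \<Phi> \<Delta> A B)"
    using assms by (simp add: fibre_least_def)
qed (use assms cle_quot_antisym in \<open>auto simp: fibre_least_def\<close>)

lemma pmax_eq:
  assumes "fibre_greatest A"
  shows "pmax \<Phi> \<Delta> QQ HH (proj HH A) = A"
  unfolding pmax_def
proof (rule the_equality)
  show "A \<in> quot \<Phi> QQ \<and> proj HH A = proj HH A \<and>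
    (\<forall>B\<in>quot \<Phi> QQ. proj HH B = proj HH A \<longrightarrow> cle \<Phi> \<Delta> B A)"
    using assms by (simp add: fibre_greatest_def)
qed (use assms cle_quot_antisym in \<open>auto simp: fibre_greatest_def\<close>)

lemma proj_in_quot: "A \<in> quot \<Phi> QQ \<Longrightarrow> proj HH A \<in> quot \<Phi> HH"
  by (erule quot_cases) (auto simp: quot_def)

lemma is_pmin_iff: "is_pmin \<Phi> \<Delta> QQ HH A \<longleftrightarrow> fibre_least A"
proof
  assume "is_pmin \<Phi> \<Delta> QQ HH A"
  then show "fibre_least A" using ex_fibre_least pmin_eq unfolding is_pmin_def by metis
next
  assume "fibre_least A"
  then show "is_pmin \<Phi> \<Delta> QQ HH A"
    using pmin_eq proj_in_quot unfolding is_pmin_def fibre_least_def by metis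
qed

lemma is_pmax_iff: "is_pmax \<Phi> \<Delta> QQ HH A \<longleftrightarrow> fibre_greatest A"
proof
  assume "is_pmax \<Phi> \<Delta> QQ HH A"
  then show "fibre_greatest A" using ex_fibre_greatest pmax_eq unfolding is_pmax_def by metis
next
  assume "fibre_greatest A"
  then show "is_pmax \<Phi> \<Delta> QQ HH A"
    using pmax_eq proj_in_quot unfolding is_pmax_def fibre_greatest_def by metis
qed

lemma fibre_least_mono:
  assumes "fibre_least A" "fibre_least M" "B \<in> quot \<Phi> QQ" "proj HH M = proj HH B" "cle \<Phi> \<Delta> A B"
  shows "cle \<Phi> \<Delta> A M"
proof -
  obtain a b m where w: "a \<in> weyl \<Phi>" "b \<in> weyl \<Phi>" "m \<in> weyl \<Phi>"
    and eq: "A = coset a QQ" "B = coset b QQ" "M = coset m QQ"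
    using assms(1-3) by (auto simp: quot_def fibre_least_def)
  have mb: "m n = b n"
    using assms(4) w by (simp add: eq proj_coset[OF _ stab_le] coset_stab_eq_iff)
  have "le (a l) (m l)"
    using assms w mb orb_weyl[OF w(2)] unfolding eq fibre_least_coset[OF w(1)] fibre_least_coset[OF w(3)]
      cle_coset_iff[OF dom_l w(1,2)] by (intro least_mono[of "a l" "a n" "m l" "b n" "b l"]) simp_all
  then show ?thesis using w by (simp add: eq cle_coset_iff dom_l)
qed

lemma fibre_greatest_mono:
  assumes "fibre_greatest A" "fibre_greatest M" "B \<in> quot \<Phi> QQ" "proj HH M = proj HH B" "cle \<Phi> \<Delta> B A"
  shows "cle \<Phi> \<Delta> M A"
proof -
  obtain a b m where w: "a \<in> weyl \<Phi>" "b \<in> weyl \<Phi>" "m \<in> weyl \<Phi>"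
    and eq: "A = coset a QQ" "B = coset b QQ" "M = coset m QQ"
    using assms(1-3) by (auto simp: quot_def fibre_greatest_def)
  have mb: "m n = b n"
    using assms(4) w by (simp add: eq proj_coset[OF _ stab_le] coset_stab_eq_iff)
  have "le (m l) (a l)"
    using assms w mb orb_weyl[OF w(2)] unfolding eq fibre_greatest_coset[OF w(1)] fibre_greatest_coset[OF w(3)]
      cle_coset_iff[OF dom_l w(2,1)] by (intro greatest_mono[of "a l" "a n" "m l" "b n" "b l"]) simp_all
  then show ?thesis using w by (simp add: eq cle_coset_iff dom_l)
qed

subsection \<open>Exchanging edges of the Bruhat graph\<close>

lemma cover_orb:
  assumes "orb x p" "le x y" "rk y = Suc (rk x)"
  obtains b where "b \<in> pos" "x \<bullet> b > 0" "y = sref b x" "orb y (sref b p)"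
proof -
  obtain b where "b \<in> pos" "x \<bullet> b > 0" "y = sref b x"
    using cover_step[OF assms(2,3)] by (auto simp: step_def)
  then show thesis using orb_sref[OF assms(1) pos_root] by (intro that[of b]) auto
qed

lemma cover_unique_vec:
  assumes "orb x p" "le x y" "rk y = Suc (rk x)" "le x z" "rk z = Suc (rk x)"
    "orb y q" "orb z q" "q \<noteq> p"
  shows "y = z"
proof -
  obtain b where b: "b \<in> pos" "y = sref b x" "orb y (sref b p)"
    using cover_orb[OF assms(1-3)] by blast
  obtain c where c: "c \<in> pos" "z = sref c x" "orb z (sref c p)"
    using cover_orb[OF assms(1,4,5)] by blast
  have q: "sref b p = q" "sref c p = q" using orb_fun b(3) c(3) assms(6,7) by auto
  then have "p \<bullet> b \<noteq> 0" using sref_fix[of p b] assms(8) by auto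
  then have "b = c" using sref_eq_imp_root_eq[OF b(1) c(1), of p] q by simp
  then show ?thesis using b c by simp
qed

text \<open>The edge from \<open>a\<close> to \<open>b\<close> moves the projection and the edge
  from \<open>b\<close> to \<open>c\<close> does not. This makes \<open>a\<close> regular for the
  two roots, so the interval has a second middle element. It cannot project to \<open>w n\<close>,
  since then the edge from \<open>a\<close> would be the old one.\<close>

lemma swap_down_vec:
  assumes a: "orb a p" "le a b" "rk b = Suc (rk a)" and c: "le b c" "rk c = Suc (rk b)"
    and w: "w \<in> weyl \<Phi>" "t \<in> \<Phi>" "b = w l" "c = w (sref t l)"
    and p: "w (sref t n) = w n" "p \<noteq> w n"
  shows "\<exists>b' q. le a b' \<and> le b' c \<and> rk b' = Suc (rk a) \<and> orb b' q \<and> q \<noteq> w n \<and>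
    (q = p \<longrightarrow> (\<exists>w'\<in>weyl \<Phi>. a = w' l \<and> b' = w' (sref t l)))"
proof -
  have ob: "orb b (w n)" and oc: "orb c (w n)"
    using orb_weyl[OF w(1)] orb_weyl[OF weyl_comp[OF w(1) sref_in_weyl[OF w(2)]]] w(3,4) p(1) by auto
  obtain \<beta> where \<beta>: "\<beta> \<in> pos" "a \<bullet> \<beta> > 0" "b = sref \<beta> a" "orb b (sref \<beta> p)"
    using cover_orb[OF a] by blast
  obtain \<gamma> where \<gamma>: "\<gamma> \<in> pos" "b \<bullet> \<gamma> > 0" "c = sref \<gamma> b" "orb c (sref \<gamma> (w n))"
    using cover_orb[OF ob c] by blast
  have \<beta>p: "sref \<beta> p = w n" using orb_fun[OF \<beta>(4) ob] .
  then have p\<beta>: "p \<bullet> \<beta> \<noteq> 0" using sref_fix[of p \<beta>] p(2) by auto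
  have wn\<beta>: "w n \<bullet> \<beta> \<noteq> 0" using p\<beta> unfolding \<beta>p[symmetric] by simp
  have wn\<gamma>: "w n \<bullet> \<gamma> = 0"
    using orb_fun[OF \<gamma>(4) oc] sref_eq_iff[OF pos_nonzero[OF \<gamma>(1)]] by simp
  \<comment> \<open>Transported by \<open>sref \<beta>\<close>, a root orthogonal to
    \<open>a\<close> becomes orthogonal to \<open>b\<close> and so to \<open>w n\<close>. Pairing
    with \<open>w n\<close> removes its \<beta>-coefficient, and pairing with \<open>b\<close>
    removes the \<gamma>-coefficient.\<close>
  have reg: "a \<bullet> e \<noteq> 0" if e: "e \<in> \<Phi>" "e \<in> span {\<beta>, \<gamma>}" for e
  proof
    assume z: "a \<bullet> e = 0"
    define e' where "e' = sref \<beta> e"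
    have e': "e' \<in> \<Phi>" "e' \<in> span {\<beta>, \<gamma>}"
      using sref_root[OF pos_root[OF \<beta>(1)] e(1)] e(2) unfolding e'_def sref_def
      by (auto intro!: span_diff span_scale simp: span_base)
    have z': "b \<bullet> e' = 0" using z by (simp add: e'_def \<beta>(3))
    then have q: "w n \<bullet> e' = 0" using orb_sign(3)[OF ob e'(1)] by simp
    obtain x y where xy: "e' = x *\<^sub>R \<beta> + y *\<^sub>R \<gamma>"
      using e'(2) by (auto simp: span_insert span_singleton span_breakdown_eq algebra_simps)
    then have "x = 0" using q wn\<beta> wn\<gamma> by (simp add: inner_add_right)
    then have "y = 0" using z' \<gamma>(2) xy by simp
    then show False using xy \<open>x = 0\<close> e'(1) zero_notin by simp
  qed
  obtain b' where b': "b' \<noteq> b" "le a b'" "le b' c" "rk b' = Suc (rk a)"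
    using diamond[OF \<beta>(1-3) \<gamma>(1-3) a(3) c(2) reg] by blast
  obtain \<delta> where \<delta>: "\<delta> \<in> pos" "b' = sref \<delta> a" "orb b' (sref \<delta> p)"
    using cover_orb[OF a(1) b'(2,4)] by blast
  obtain \<epsilon> where \<epsilon>: "\<epsilon> \<in> pos" "c = sref \<epsilon> b'" "orb c (sref \<epsilon> (sref \<delta> p))"
    using cover_orb[OF \<delta>(3) b'(3)] b'(4) a(3) c(2) by auto
  have "sref \<delta> p \<noteq> w n"
  proof
    assume "sref \<delta> p = w n"
    then have "\<beta> = \<delta>" using sref_eq_imp_root_eq[OF \<beta>(1) \<delta>(1) _ p\<beta>] \<beta>p by simp
    then show False using b'(1) \<beta>(3) \<delta>(2) by simp
  qed
  moreover have "\<exists>w'\<in>weyl \<Phi>. a = w' l \<and> b' = w' (sref t l)" if "sref \<delta> p = p"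
  proof -
    \<comment> \<open>If \<open>b'\<close> still projects to \<open>p\<close>, its edge to
      \<open>c\<close> moves \<open>p\<close> just as \<beta> does, so it is \<beta>. Thus
      \<open>sref \<beta>\<close> carries the old collapsed edge to the new one, which keeps the
      right factor \<open>t\<close>.\<close>
    have "sref \<beta> p = sref \<epsilon> p" using orb_fun[OF \<epsilon>(3) oc] that \<beta>p by simp
    then have "\<beta> = \<epsilon>" using sref_eq_imp_root_eq[OF \<beta>(1) \<epsilon>(1) _ p\<beta>] by simp
    then have "sref \<beta> b = a" "sref \<beta> c = b'" using \<beta>(3) \<epsilon>(2) by simp_all
    then have "a = (sref \<beta> \<circ> w) l" "b' = (sref \<beta> \<circ> w) (sref t l)"
      unfolding w(3,4) by simp_all
    then show ?thesis using weyl.weyl_step[OF w(1) pos_root[OF \<beta>(1)]] by blast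
  qed
  ultimately show ?thesis using b' \<delta>(3) by blast
qed

text \<open>Here the lower edge is collapsed, so regularity can be tested at \<open>a\<close>
  directly: pairing with \<open>w n\<close> removes the \<gamma>-coefficient, pairing with
  \<open>a\<close> then the \<beta>-coefficient. If the new vertex projects to \<open>q\<close>, its
  edge from \<open>a\<close> is \<gamma>, and \<open>sref \<gamma>\<close> transports the collapsed
  edge upwards.\<close>

lemma swap_up_vec:
  assumes a: "le a b" "rk b = Suc (rk a)" and c: "le b c" "rk c = Suc (rk b)" "orb c q"
    and w: "w \<in> weyl \<Phi>" "t \<in> \<Phi>" "a = w l" "b = w (sref t l)"
    and p: "w (sref t n) = w n" "q \<noteq> w n"
  shows "\<exists>b' q'. le a b' \<and> le b' c \<and> rk b' = Suc (rk a) \<and> orb b' q' \<and> q' \<noteq> w n \<and>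
    (q' = q \<longrightarrow> (\<exists>w'\<in>weyl \<Phi>. b' = w' l \<and> c = w' (sref t l)))"
proof -
  have oa: "orb a (w n)" and ob: "orb b (w n)"
    using orb_weyl[OF w(1)] orb_weyl[OF weyl_comp[OF w(1) sref_in_weyl[OF w(2)]]] w(3,4) p(1) by auto
  obtain \<beta> where \<beta>: "\<beta> \<in> pos" "a \<bullet> \<beta> > 0" "b = sref \<beta> a" "orb b (sref \<beta> (w n))"
    using cover_orb[OF oa a] by blast
  obtain \<gamma> where \<gamma>: "\<gamma> \<in> pos" "b \<bullet> \<gamma> > 0" "c = sref \<gamma> b" "orb c (sref \<gamma> (w n))"
    using cover_orb[OF ob c(1,2)] by blast
  have \<gamma>p: "sref \<gamma> (w n) = q" using orb_fun[OF \<gamma>(4) c(3)] .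
  then have p\<gamma>: "w n \<bullet> \<gamma> \<noteq> 0" using sref_fix[of "w n" \<gamma>] p(2) by auto
  have p\<beta>: "w n \<bullet> \<beta> = 0"
    using orb_fun[OF \<beta>(4) ob] sref_eq_iff[OF pos_nonzero[OF \<beta>(1)]] by simp
  have reg: "a \<bullet> e \<noteq> 0" if e: "e \<in> \<Phi>" "e \<in> span {\<beta>, \<gamma>}" for e
  proof
    assume z: "a \<bullet> e = 0"
    then have q: "w n \<bullet> e = 0" using orb_sign(3)[OF oa e(1)] by simp
    obtain x y where xy: "e = x *\<^sub>R \<beta> + y *\<^sub>R \<gamma>"
      using e(2) by (auto simp: span_insert span_singleton span_breakdown_eq algebra_simps)
    then have "y = 0" using q p\<beta> p\<gamma> by (simp add: inner_add_right)
    then have "x = 0" using z \<beta>(2) xy by simp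
    then show False using xy \<open>y = 0\<close> e(1) zero_notin by simp
  qed
  obtain b' where b': "b' \<noteq> b" "le a b'" "le b' c" "rk b' = Suc (rk a)"
    using diamond[OF \<beta>(1-3) \<gamma>(1-3) a(2) c(2) reg] by blast
  obtain \<delta> where \<delta>: "\<delta> \<in> pos" "b' = sref \<delta> a" "orb b' (sref \<delta> (w n))"
    using cover_orb[OF oa b'(2,4)] by blast
  obtain \<epsilon> where \<epsilon>: "\<epsilon> \<in> pos" "c = sref \<epsilon> b'" "orb c (sref \<epsilon> (sref \<delta> (w n)))"
    using cover_orb[OF \<delta>(3) b'(3)] b'(4) a(2) c(2) by auto
  have "sref \<delta> (w n) \<noteq> w n"
  proof
    assume "sref \<delta> (w n) = w n"
    then have "sref \<gamma> (w n) = sref \<epsilon> (w n)" using orb_fun[OF \<epsilon>(3) c(3)] \<gamma>p by simp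
    then have "\<gamma> = \<epsilon>" using sref_eq_imp_root_eq[OF \<gamma>(1) \<epsilon>(1) _ p\<gamma>] by simp
    then have "sref \<gamma> b' = sref \<gamma> b" using \<epsilon>(2) \<gamma>(3) by simp
    then show False using b'(1) by (metis sref_sref)
  qed
  moreover have "\<exists>w'\<in>weyl \<Phi>. b' = w' l \<and> c = w' (sref t l)" if "sref \<delta> (w n) = q"
  proof -
    have "\<gamma> = \<delta>" using sref_eq_imp_root_eq[OF \<gamma>(1) \<delta>(1) _ p\<gamma>] \<gamma>p that by simp
    then have "b' = sref \<gamma> a" using \<delta>(2) by simp
    then have "b' = (sref \<gamma> \<circ> w) l" "c = (sref \<gamma> \<circ> w) (sref t l)"
      using \<gamma>(3) unfolding w(3,4) by simp_all
    then show ?thesis using weyl.weyl_step[OF w(1) pos_root[OF \<gamma>(1)]] by blast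
  qed
  ultimately show ?thesis using b' \<delta>(3) by blast
qed

end

section \<open>Root systems with a base\<close>

text \<open>Supplies vectors with prescribed pairings on the base: the regular vector
  \<open>h\<close>, coordinate functionals, and vectors whose stabilizer is a given standard
  parabolic subgroup.\<close>

lemma independent_inner_extend:
  fixes \<Delta> :: "'v::euclidean_space set"
  assumes "independent \<Delta>"
  shows "\<exists>h. \<forall>a\<in>\<Delta>. a \<bullet> h = g a"
proof -
  obtain f :: "'v \<Rightarrow> real" where f: "linear f" "\<forall>a\<in>\<Delta>. f a = g a"
    using linear_independent_extend[OF assms] by blast
  have "x \<bullet> adjoint f 1 = f x" for x using adjoint_works[OF f(1), of x 1] by simp
  then show ?thesis using f(2) by (intro exI[of _ "adjoint f 1"]) simp
qed

lemma sum_same_sign_eq_0: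
  fixes f :: "'a \<Rightarrow> real"
  assumes "finite A" "(\<forall>i\<in>A. f i \<ge> 0) \<or> (\<forall>i\<in>A. f i \<le> 0)" "sum f A = 0" "i \<in> A"
  shows "f i = 0"
  using assms(2)
proof
  assume "\<forall>i\<in>A. f i \<ge> 0"
  then show ?thesis using sum_nonneg_eq_0_iff[OF assms(1), of f] assms(3,4) by auto
next
  assume "\<forall>i\<in>A. f i \<le> 0"
  then show ?thesis
    using sum_nonneg_eq_0_iff[OF assms(1), of "\<lambda>i. - f i"] assms(3,4) by (auto simp: sum_negf)
qed

lemma base_positive_system:
  fixes \<Phi> \<Delta> :: "'v::euclidean_space set"
  assumes rs: "root_system \<Phi>" and bs: "base \<Phi> \<Delta>"
  shows "\<exists>h. positive_system \<Phi> \<Delta> h"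
proof -
  have fin: "finite \<Phi>" and nz: "0 \<notin> \<Phi>"
    and refl: "\<And>a b. a \<in> \<Phi> \<Longrightarrow> b \<in> \<Phi> \<Longrightarrow> sref a b \<in> \<Phi>"
    and red: "\<And>a c. a \<in> \<Phi> \<Longrightarrow> c *\<^sub>R a \<in> \<Phi> \<Longrightarrow> c = 1 \<or> c = -1"
    using rs by (auto simp: root_system_def)
  have sub: "\<Delta> \<subseteq> \<Phi>" and ind: "independent \<Delta>" using bs by (auto simp: base_def)
  have finD: "finite \<Delta>" using sub fin finite_subset by blast
  \<comment> \<open>With all pairings equal to one, \<open>b \<bullet> h\<close> is the height of
    the root \<open>b\<close>, the sum of its coefficients.\<close>
  obtain h where h: "\<And>a. a \<in> \<Delta> \<Longrightarrow> a \<bullet> h = 1"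
    using independent_inner_extend[OF ind, of "\<lambda>_. 1"] by blast
  have ex: "\<exists>c :: 'v \<Rightarrow> real. b = (\<Sum>a\<in>\<Delta>. c a *\<^sub>R a) \<and>
    ((\<forall>a\<in>\<Delta>. c a \<ge> 0) \<or> (\<forall>a\<in>\<Delta>. c a \<le> 0)) \<and> b \<bullet> h = (\<Sum>a\<in>\<Delta>. c a)" if "b \<in> \<Phi>" for b
  proof -
    have "\<exists>c :: 'v \<Rightarrow> int. b = (\<Sum>a\<in>\<Delta>. of_int (c a) *\<^sub>R a) \<and>
      ((\<forall>a\<in>\<Delta>. c a \<ge> 0) \<or> (\<forall>a\<in>\<Delta>. c a \<le> 0))"
      using bs that by (simp add: base_def)
    then obtain c :: "'v \<Rightarrow> int" where c: "b = (\<Sum>a\<in>\<Delta>. of_int (c a) *\<^sub>R a)"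
      "(\<forall>a\<in>\<Delta>. c a \<ge> 0) \<or> (\<forall>a\<in>\<Delta>. c a \<le> 0)"
      by (elim exE conjE) (rule that)
    have "b \<bullet> h = (\<Sum>a\<in>\<Delta>. of_int (c a))" by (subst c(1)) (simp add: inner_sum_left h)
    then show ?thesis using c by (intro exI[of _ "\<lambda>a. of_int (c a)"]) auto
  qed
  have posc: "\<exists>c :: 'v \<Rightarrow> real. b = (\<Sum>a\<in>\<Delta>. c a *\<^sub>R a) \<and> (\<forall>a\<in>\<Delta>. c a \<ge> 0) \<and> b \<bullet> h = (\<Sum>a\<in>\<Delta>. c a)"
    if b: "b \<in> \<Phi>" "b \<bullet> h > 0" for b
  proof -
    obtain c :: "'v \<Rightarrow> real" where c: "b = (\<Sum>a\<in>\<Delta>. c a *\<^sub>R a)"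
      "(\<forall>a\<in>\<Delta>. c a \<ge> 0) \<or> (\<forall>a\<in>\<Delta>. c a \<le> 0)" "b \<bullet> h = (\<Sum>a\<in>\<Delta>. c a)"
      using ex[OF b(1)] by (elim exE conjE) (rule that)
    have "\<not> (\<forall>a\<in>\<Delta>. c a \<le> 0)" using sum_nonpos[of \<Delta> c] c(3) b(2) by auto
    then have "\<forall>a\<in>\<Delta>. c a \<ge> 0" using c(2) by blast
    with c(1,3) show ?thesis by (intro exI[of _ c] conjI)
  qed
  have "positive_system \<Phi> \<Delta> h"
  proof
    fix b assume b: "b \<in> \<Phi>"
    then obtain c :: "'v \<Rightarrow> real" where c: "b = (\<Sum>a\<in>\<Delta>. c a *\<^sub>R a)"
      "(\<forall>a\<in>\<Delta>. c a \<ge> 0) \<or> (\<forall>a\<in>\<Delta>. c a \<le> 0)" "b \<bullet> h = (\<Sum>a\<in>\<Delta>. c a)"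
      using ex[OF b] by (elim exE conjE) (rule that)
    show "b \<bullet> h \<noteq> 0"
    proof
      assume "b \<bullet> h = 0"
      then have "\<forall>a\<in>\<Delta>. c a = 0"
        using sum_same_sign_eq_0[OF finD c(2)] c(3) by simp
      then have "b = 0" unfolding c(1) by (intro sum.neutral) simp
      then show False using b nz by simp
    qed
  next
    fix a b assume a: "a \<in> \<Delta>" and b: "b \<in> \<Phi>" "b \<bullet> h > 0" "b \<noteq> a"
    obtain c :: "'v \<Rightarrow> real" where c: "b = (\<Sum>d\<in>\<Delta>. c d *\<^sub>R d)" "\<forall>d\<in>\<Delta>. c d \<ge> 0"
      using posc[OF b(1,2)] by (elim exE conjE) (rule that)
    \<comment> \<open>Otherwise \<open>b\<close> would be a non-negative multiple of
      \<open>a\<close>, hence \<open>a\<close> itself by reducedness. The reflection in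
      \<open>a\<close> leaves the coefficient of \<open>g\<close> unchanged, and one positive
      coefficient makes the reflected root positive.\<close>
    have "\<exists>g\<in>\<Delta>. g \<noteq> a \<and> c g > 0"
    proof (rule ccontr)
      assume "\<not> ?thesis"
      then have "\<forall>d\<in>\<Delta> - {a}. c d = 0" using c(2) by force
      then have ba: "b = c a *\<^sub>R a" using c(1) sum.remove[OF finD a, of "\<lambda>d. c d *\<^sub>R d"] by simp
      moreover have "c a \<ge> 0" using c(2) a by blast
      ultimately have "c a = 1" using red[of a "c a"] subsetD[OF sub a] b(1) by auto
      then show False using ba b(3) by simp
    qed
    then obtain g where g: "g \<in> \<Delta>" "g \<noteq> a" "c g > 0" by blast
    \<comment> \<open>Pairing with \<open>k\<close> reads off the coefficient of
      \<open>g\<close>.\<close>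
    obtain k where k: "\<And>d. d \<in> \<Delta> \<Longrightarrow> d \<bullet> k = (if d = g then 1 else 0)"
      using independent_inner_extend[OF ind, of "\<lambda>d. if d = g then 1 else 0"] by blast
    have coef: "(\<Sum>d\<in>\<Delta>. e d *\<^sub>R d) \<bullet> k = e g" for e :: "'v \<Rightarrow> real"
      using g(1) finD by (simp add: inner_sum_left k if_distrib cong: if_cong)
    have "sref a b \<bullet> k > 0"
      using coef[of c] c(1) g k[OF a] by (simp add: sref_def inner_diff_left)
    moreover obtain e :: "'v \<Rightarrow> real" where e: "sref a b = (\<Sum>d\<in>\<Delta>. e d *\<^sub>R d)"
      "(\<forall>d\<in>\<Delta>. e d \<ge> 0) \<or> (\<forall>d\<in>\<Delta>. e d \<le> 0)" "sref a b \<bullet> h = (\<Sum>d\<in>\<Delta>. e d)"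
      using ex[OF refl[OF subsetD[OF sub a] b(1)]] by (elim exE conjE) (rule that)
    ultimately have "e g > 0" using coef[of e] by simp
    then have "\<forall>d\<in>\<Delta>. e d \<ge> 0" using e(2) g(1) by force
    then show "sref a b \<bullet> h > 0" using e(3) sum_pos2[OF finD g(1), of e] \<open>e g > 0\<close> by simp
  next
    fix x b assume x: "\<And>a. a \<in> \<Delta> \<Longrightarrow> x \<bullet> a \<ge> 0" and b: "b \<in> \<Phi>" "b \<bullet> h > 0"
    obtain c :: "'v \<Rightarrow> real" where c: "b = (\<Sum>d\<in>\<Delta>. c d *\<^sub>R d)" "\<forall>d\<in>\<Delta>. c d \<ge> 0"
      using posc[OF b] by (elim exE conjE) (rule that)
    show "x \<bullet> b \<ge> 0"
      by (subst c(1)) (use x c(2) in \<open>auto simp: inner_sum_right intro!: sum_nonneg\<close>)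
  qed (use fin nz refl red sub h in auto)
  then show ?thesis ..
qed

context positive_system
begin

text \<open>If \<open>w\<close> fixes \<open>n\<close> and \<open>w h\<close> is negative on a
  simple root \<open>a\<close>, then \<open>n = w n\<close> is not positive on \<open>a\<close>, so
  \<open>a\<close> lies in \<open>J\<close>. Hence every letter of the descent of \<open>w h\<close>
  comes from \<open>J\<close>.\<close>

lemma parabolic_eq_stab:
  assumes J: "J \<subseteq> \<Delta>" and n: "\<And>a. a \<in> \<Delta> \<Longrightarrow> a \<bullet> n = (if a \<in> J then 0 else 1)"
  shows "weyl J = stab \<Phi> n"
proof (intro equalityI subsetI)
  have d: "dom n" by (auto simp: dom_simple inner_commute[of n] n)
  fix w assume "w \<in> stab \<Phi> n"
  then have "w \<in> weyl \<Phi>" "w n = n" by (auto simp: stab_def)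
  then show "w \<in> weyl J"
  proof (induction "rk (w h)" arbitrary: w)
    case 0
    then have "w = id" using rk_eq_0_iff[of "w h"] dom_unique[OF _ dom_h] stab_regular by metis
    then show ?case using weyl.weyl_id[of J] by (simp only:)
  next
    case (Suc k)
    then obtain a where a: "a \<in> \<Delta>" "w h \<bullet> a < 0" using rk_pos_simple[of "w h"] by auto
    have "w n \<bullet> - a \<ge> 0"
      using dom_inner_sign[OF d Suc.prems(1) uminus_root[OF simple_root[OF a(1)]]] a(2) by simp
    then have aJ: "a \<in> J" using n[OF a(1)] Suc.prems(2) by (auto simp: inner_commute split: if_splits)
    then have na: "sref a n = n" using n[OF a(1)] sref_fix[of n a] by (simp add: inner_commute)
    have "sref a \<circ> w \<in> weyl J"
      using Suc.hyps(1)[of "sref a \<circ> w"] Suc.hyps(2) Suc.prems rk_sref[OF a]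
        weyl.weyl_step[OF Suc.prems(1) simple_root[OF a(1)]] na by simp
    then have "sref a \<circ> (sref a \<circ> w) \<in> weyl J" using aJ by (rule weyl.weyl_step)
    moreover have "sref a \<circ> (sref a \<circ> w) = w" by (rule ext) simp
    ultimately show ?case by simp
  qed
next
  fix w assume "w \<in> weyl J"
  then have "w \<in> weyl \<Phi> \<and> w n = n"
  proof (induction rule: weyl.induct)
    case weyl_id
    show ?case by (intro conjI weyl.weyl_id id_apply)
  next
    case (weyl_step w a)
    then have "a \<bullet> n = 0" "a \<in> \<Phi>" using J n[of a] simple_root[of a] by auto
    then have "sref a n = n" by (intro sref_fix) (simp add: inner_commute)
    then show ?case
      using weyl_step.IH weyl.weyl_step[of w \<Phi> a] \<open>a \<in> \<Phi>\<close> by (metis comp_apply)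
  qed
  then show "w \<in> stab \<Phi> n" by (simp add: stab_def)
qed

text \<open>Applying \<open>w\<close> to a dominant vector does not increase its height, and
  preserves it only if the vector is fixed; equality for the sum forces equality in every
  term.\<close>

lemma dom_sum_fix:
  assumes "finite A" "\<And>i. i \<in> A \<Longrightarrow> dom (v i)" "w \<in> weyl \<Phi>"
  shows "w (\<Sum>i\<in>A. v i) = (\<Sum>i\<in>A. v i) \<longleftrightarrow> (\<forall>i\<in>A. w (v i) = v i)"
proof
  have sum: "w (\<Sum>i\<in>A. v i) = (\<Sum>i\<in>A. w (v i))" using linear_sum[OF weyl_linear[OF assms(3)]] .
  {
    assume "w (\<Sum>i\<in>A. v i) = (\<Sum>i\<in>A. v i)"
    then have "(\<Sum>i\<in>A. v i \<bullet> h - w (v i) \<bullet> h) = 0"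
      using sum by (simp add: sum_subtractf flip: inner_sum_left)
    moreover have "v i \<bullet> h - w (v i) \<bullet> h \<ge> 0" if "i \<in> A" for i
      using le_height[OF dom_le[OF assms(3) assms(2)[OF that]]] by auto
    ultimately have z: "v i \<bullet> h - w (v i) \<bullet> h = 0" if "i \<in> A" for i
      using sum_same_sign_eq_0[OF assms(1), of "\<lambda>i. v i \<bullet> h - w (v i) \<bullet> h"] that by blast
    show "\<forall>i\<in>A. w (v i) = v i"
    proof
      fix i assume i: "i \<in> A"
      show "w (v i) = v i" using le_height[OF dom_le[OF assms(3) assms(2)[OF i]]] z[OF i] by auto
    qed
  }
  show "\<forall>i\<in>A. w (v i) = v i \<Longrightarrow> w (\<Sum>i\<in>A. v i) = (\<Sum>i\<in>A. v i)" using sum by simp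
qed

lemma dom_sum: "(\<And>i. i \<in> A \<Longrightarrow> dom (v i)) \<Longrightarrow> dom (\<Sum>i\<in>A. v i)"
proof -
  assume "\<And>i. i \<in> A \<Longrightarrow> dom (v i)"
  then have "(\<Sum>i\<in>A. v i \<bullet> b) \<ge> 0" if "b \<in> pos" for b
    using that by (intro sum_nonneg) (simp add: dom_def)
  then show ?thesis by (simp add: dom_def inner_sum_left)
qed

text \<open>A root pairs with all dominant vectors in the same weak sign, so nothing can
  cancel.\<close>

lemma dom_sum_orthogonal:
  assumes "finite A" "\<And>i. i \<in> A \<Longrightarrow> dom (v i)" "t \<in> \<Phi>" "(\<Sum>i\<in>A. v i) \<bullet> t = 0" "i \<in> A"
  shows "v i \<bullet> t = 0"
proof -
  have "(\<forall>i\<in>A. v i \<bullet> t \<ge> 0) \<or> (\<forall>i\<in>A. v i \<bullet> t \<le> 0)"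
    using pos_or_neg[OF assms(3)] assms(2) by (fastforce simp: dom_def)
  then show ?thesis
    using sum_same_sign_eq_0[OF assms(1) _ _ assms(5), of "\<lambda>i. v i \<bullet> t"] assms(4)
    unfolding inner_sum_left by blast
qed

end

section \<open>Graded index families\<close>

text \<open>A maximal chain has \<open>m\<close> members, of pairwise distinct sizes between 1 and
  \<open>m\<close>, so every size occurs. Hence the cardinality is one more than the rank in the
  family.\<close>

lemma index_family_chain_cards:
  assumes "index_family Ifam m" "m \<ge> 1" "is_chainI Ifam C"
  shows "\<exists>D. C \<subseteq> D \<and> is_chainI Ifam D \<and> (\<forall>k\<in>{1..m}. \<exists>J\<in>D. card J = k)"
proof -
  have sub: "\<And>J. J \<in> Ifam \<Longrightarrow> J \<noteq> {} \<and> J \<subseteq> {1..m}" and gr: "graded_len Ifam (m - 1)"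
    using assms(1) by (auto simp: index_family_def)
  have fin: "finite Ifam" using sub finite_subset[of Ifam "Pow {1..m}"] by auto
  have finJ: "finite J" if "J \<in> Ifam" for J using sub[OF that] finite_subset by blast
  obtain D where D: "is_chainI Ifam D" "C \<subseteq> D"
    "\<And>D'. is_chainI Ifam D' \<Longrightarrow> C \<subseteq> D' \<Longrightarrow> card D' \<le> card D"
  proof -
    have "\<forall>D. is_chainI Ifam D \<and> C \<subseteq> D \<longrightarrow> card D < Suc (card Ifam)"
      using card_mono[OF fin] by (auto simp: is_chainI_def less_Suc_eq_le)
    then show ?thesis
      using ex_has_greatest_nat[of "\<lambda>D. is_chainI Ifam D \<and> C \<subseteq> D" C card] assms(3) that by blast
  qed
  have finD: "finite D'" if "is_chainI Ifam D'" for D'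
    using that fin finite_subset by (auto simp: is_chainI_def)
  have "max_chainI Ifam D"
    unfolding max_chainI_def using D finD card_seteq by (metis order_trans)
  then have cD: "card D = m" using gr assms(2) by (simp add: graded_len_def)
  have inj: "inj_on card D"
  proof (rule inj_onI)
    fix J K assume J: "J \<in> D" "K \<in> D" "card J = card K"
    then have "J \<in> Ifam" "K \<in> Ifam" "J \<subseteq> K \<or> K \<subseteq> J" using D(1) by (auto simp: is_chainI_def)
    then show "J = K" using J(3) card_subset_eq finJ by metis
  qed
  have "card ` D \<subseteq> {1..m}"
  proof
    fix k assume "k \<in> card ` D"
    then obtain J where J: "J \<in> Ifam" "k = card J" using D(1) by (auto simp: is_chainI_def)
    then show "k \<in> {1..m}"
      using sub[OF J(1)] finJ[OF J(1)] card_mono[of "{1..m}" J] by (auto simp: Suc_le_eq card_gt_0_iff)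
  qed
  then have "card ` D = {1..m}" using card_image[OF inj] cD by (intro card_subset_eq) auto
  then have "\<forall>k\<in>{1..m}. \<exists>J\<in>D. card J = k" by (metis imageE)
  then show ?thesis using D by blast
qed

lemma index_family_top:
  assumes "index_family Ifam m" "m \<ge> 1"
  shows "{1..m} \<in> Ifam"
proof -
  obtain D where D: "is_chainI Ifam D" "\<forall>k\<in>{1..m}. \<exists>J\<in>D. card J = k"
    using index_family_chain_cards[OF assms, of "{}"] by (auto simp: is_chainI_def)
  then obtain J where J: "J \<in> D" "card J = m" using assms(2) by force
  then have "J \<in> Ifam" "J \<subseteq> {1..m}" using D(1) assms(1) by (auto simp: is_chainI_def index_family_def)
  moreover have "J = {1..m}" using calculation(2) J(2) by (intro card_subset_eq) auto
  ultimately show ?thesis by simp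
qed

lemma index_family_between:
  assumes "index_family Ifam m" "m \<ge> 1" "J \<in> Ifam" "K \<in> Ifam" "J \<subseteq> K" "Suc (card J) < card K"
  shows "\<exists>L\<in>Ifam. J \<subset> L \<and> L \<subset> K"
proof -
  have K: "K \<subseteq> {1..m}" using assms(1,4) by (auto simp: index_family_def)
  then have cK: "card K \<le> m" using card_mono[of "{1..m}" K] by simp
  obtain D where D: "{J, K} \<subseteq> D" "is_chainI Ifam D" "\<forall>k\<in>{1..m}. \<exists>J\<in>D. card J = k"
    using index_family_chain_cards[OF assms(1,2), of "{J, K}"] assms(3-5) by (auto simp: is_chainI_def)
  obtain L where L: "L \<in> D" "card L = Suc (card J)" using D(3) assms(6) cK by force
  have fin: "finite M" if "M \<in> D" for M
    using that D(2) assms(1) finite_subset[of M "{1..m}"] by (auto simp: is_chainI_def index_family_def)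
  have "\<not> L \<subseteq> J" "\<not> K \<subseteq> L" using card_mono[OF fin, of J L] card_mono[OF fin, of L K] L assms(6) D(1) by auto
  then have "J \<subset> L" "L \<subset> K" using D(1,2) L(1) unfolding is_chainI_def by blast+
  then show ?thesis using D(2) L(1) by (auto simp: is_chainI_def)
qed

lemma index_family_below:
  assumes "index_family Ifam m" "m \<ge> 1" "J \<in> Ifam" "card J > 1"
  shows "\<exists>L\<in>Ifam. L \<subset> J"
proof -
  obtain D where D: "{J} \<subseteq> D" "is_chainI Ifam D" "\<forall>k\<in>{1..m}. \<exists>J\<in>D. card J = k"
    using index_family_chain_cards[OF assms(1,2), of "{J}"] assms(3) by (auto simp: is_chainI_def)
  obtain L where L: "L \<in> D" "card L = 1" using D(3) assms(2) by force
  have fin: "finite M" if "M \<in> D" for M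
    using that D(2) assms(1) finite_subset[of M "{1..m}"] by (auto simp: is_chainI_def index_family_def)
  have "\<not> J \<subseteq> L" using card_mono[OF fin, of L J] L assms(4) by auto
  then have "L \<subset> J" using D(1,2) L(1) unfolding is_chainI_def by blast
  then show ?thesis using D(2) L(1) by (auto simp: is_chainI_def)
qed

section \<open>Chains with collapsed edges\<close>

text \<open>Abstract form of the situation: \<open>E\<close> is the lower interval below \<open>top\<close> in \<open>W/W_Q\<close>, \<open>Ifam\<close>
  is the graded family of index sets, \<open>pr J\<close> the projection to \<open>W/W_{P_J}\<close>.  The relation
  \<open>T t a b\<close> means that \<open>b\<close> arises from \<open>a\<close> by right multiplication with the reflection \<open>t\<close>, and
  \<open>fx t J\<close> that \<open>t\<close> lies in \<open>W_{P_J}\<close>.\<close>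

locale collapse =
  fixes E :: "'a set" and le :: "'a \<Rightarrow> 'a \<Rightarrow> bool" and rk :: "'a \<Rightarrow> nat" and bot top :: 'a
    and Ifam :: "nat set set" and m :: nat and pr :: "nat set \<Rightarrow> 'a \<Rightarrow> 'b"
    and T :: "'t \<Rightarrow> 'a \<Rightarrow> 'a \<Rightarrow> bool" and fx :: "'t \<Rightarrow> nat set \<Rightarrow> bool"
  assumes le_refl: "a \<in> E \<Longrightarrow> le a a"
    and le_trans: "a \<in> E \<Longrightarrow> b \<in> E \<Longrightarrow> c \<in> E \<Longrightarrow> le a b \<Longrightarrow> le b c \<Longrightarrow> le a c"
    and rk_less: "a \<in> E \<Longrightarrow> b \<in> E \<Longrightarrow> le a b \<Longrightarrow> a \<noteq> b \<Longrightarrow> rk a < rk b"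
    and between: "a \<in> E \<Longrightarrow> b \<in> E \<Longrightarrow> le a b \<Longrightarrow> Suc (rk a) < rk b \<Longrightarrow>
      \<exists>c\<in>E. le a c \<and> le c b \<and> rk a < rk c \<and> rk c < rk b"
    and bot: "bot \<in> E" "rk bot = 0" "a \<in> E \<Longrightarrow> le bot a"
    and top: "top \<in> E" "a \<in> E \<Longrightarrow> le a top"
    and finite_Ifam: "finite Ifam"
    and m_pos: "m \<ge> 1"
    and Ifam_sub: "J \<in> Ifam \<Longrightarrow> J \<noteq> {} \<and> J \<subseteq> {1..m}"
    and Ifam_top: "{1..m} \<in> Ifam"
    and Ifam_between: "J \<in> Ifam \<Longrightarrow> K \<in> Ifam \<Longrightarrow> J \<subseteq> K \<Longrightarrow> Suc (card J) < card K \<Longrightarrow>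
      \<exists>L\<in>Ifam. J \<subset> L \<and> L \<subset> K"
    and Ifam_below: "J \<in> Ifam \<Longrightarrow> card J > 1 \<Longrightarrow> \<exists>L\<in>Ifam. L \<subset> J"
    and pr_convex: "a \<in> E \<Longrightarrow> b \<in> E \<Longrightarrow> c \<in> E \<Longrightarrow> le a b \<Longrightarrow> le b c \<Longrightarrow> J \<in> Ifam \<Longrightarrow>
      pr J a = pr J c \<Longrightarrow> pr J b = pr J a"
    and T_ex: "a \<in> E \<Longrightarrow> b \<in> E \<Longrightarrow> le a b \<Longrightarrow> rk b = Suc (rk a) \<Longrightarrow> \<exists>t. T t a b"
    and T_fx: "T t a b \<Longrightarrow> J \<in> Ifam \<Longrightarrow> pr J a = pr J b \<longleftrightarrow> fx t J"
    and T_fx_all: "T t a b \<Longrightarrow> C \<subseteq> Ifam \<Longrightarrow> (\<Union>J\<in>C. uline Ifam J) = {1..m} \<Longrightarrow>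
      \<forall>J\<in>C. fx t J \<Longrightarrow> a = b"
    and swap_down: "a \<in> E \<Longrightarrow> b \<in> E \<Longrightarrow> c \<in> E \<Longrightarrow> le a b \<Longrightarrow> le b c \<Longrightarrow> rk b = Suc (rk a) \<Longrightarrow>
      rk c = Suc (rk b) \<Longrightarrow> J \<in> Ifam \<Longrightarrow> T t b c \<Longrightarrow> pr J b = pr J c \<Longrightarrow> pr J a \<noteq> pr J b \<Longrightarrow>
      \<exists>b'\<in>E. le a b' \<and> le b' c \<and> rk b' = Suc (rk a) \<and> pr J b' \<noteq> pr J c \<and>
        (pr J b' = pr J a \<longrightarrow> T t a b')"
    and swap_up: "a \<in> E \<Longrightarrow> b \<in> E \<Longrightarrow> c \<in> E \<Longrightarrow> le a b \<Longrightarrow> le b c \<Longrightarrow> rk b = Suc (rk a) \<Longrightarrow>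
      rk c = Suc (rk b) \<Longrightarrow> J \<in> Ifam \<Longrightarrow> T t a b \<Longrightarrow> pr J a = pr J b \<Longrightarrow> pr J b \<noteq> pr J c \<Longrightarrow>
      \<exists>b'\<in>E. le a b' \<and> le b' c \<and> rk b' = Suc (rk a) \<and> pr J b' \<noteq> pr J a \<and>
        (pr J b' = pr J c \<longrightarrow> T t b' c)"
    and cover_unique: "a \<in> E \<Longrightarrow> b \<in> E \<Longrightarrow> b' \<in> E \<Longrightarrow> le a b \<Longrightarrow> le a b' \<Longrightarrow> rk b = Suc (rk a) \<Longrightarrow>
      rk b' = Suc (rk a) \<Longrightarrow> J \<in> Ifam \<Longrightarrow> pr J b = pr J b' \<Longrightarrow> pr J b \<noteq> pr J a \<Longrightarrow> b = b'"
begin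

definition X :: "('a \<times> nat set) set" where "X = E \<times> Ifam"
text \<open>The rank function of the product: a nonempty index set has rank one less than its size,
  so the truncated subtraction loses nothing.\<close>

definition R :: "'a \<times> nat set \<Rightarrow> nat" where "R x = rk (fst x) + card (snd x) - 1"
definition leX :: "'a \<times> nat set \<Rightarrow> 'a \<times> nat set \<Rightarrow> bool" where
  "leX x y \<longleftrightarrow> le (fst x) (fst y) \<and> snd x \<subseteq> snd y"
definition N :: nat where "N = rk top + m - 1"
definition pi :: "'a \<times> nat set \<Rightarrow> 'b \<times> nat set" where "pi x = (pr (snd x) (fst x), snd x)"

definition ch :: "nat \<Rightarrow> (nat \<Rightarrow> 'a \<times> nat set) \<Rightarrow> bool" where
  "ch l x \<longleftrightarrow> (\<forall>k\<le>l. x k \<in> X) \<and> (\<forall>k<l. leX (x k) (x (Suc k)) \<and> x k \<noteq> x (Suc k))"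

text \<open>A maximal chain of the product, indexed by rank.\<close>

definition full :: "(nat \<Rightarrow> 'a \<times> nat set) \<Rightarrow> bool" where
  "full x \<longleftrightarrow> (\<forall>k\<le>N. x k \<in> X \<and> R (x k) = k) \<and> (\<forall>k<N. leX (x k) (x (Suc k)))"

lemma X_D: "x \<in> X \<Longrightarrow> fst x \<in> E" "x \<in> X \<Longrightarrow> snd x \<in> Ifam"
  by (auto simp: X_def)

lemma finite_idx: "J \<in> Ifam \<Longrightarrow> finite J"
  using Ifam_sub finite_subset by blast

lemma card_idx: "J \<in> Ifam \<Longrightarrow> 1 \<le> card J" "J \<in> Ifam \<Longrightarrow> card J \<le> m"
proof -
  assume J: "J \<in> Ifam"
  then show "1 \<le> card J" using Ifam_sub finite_idx by (simp add: Suc_le_eq card_gt_0_iff)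
  show "card J \<le> m" using card_mono[of "{1..m}" J] Ifam_sub[OF J] by simp
qed

lemma R_Suc: "x \<in> X \<Longrightarrow> Suc (R x) = rk (fst x) + card (snd x)"
  using card_idx(1)[OF X_D(2)] by (fastforce simp: R_def)

lemma rk_mono: "a \<in> E \<Longrightarrow> b \<in> E \<Longrightarrow> le a b \<Longrightarrow> rk a \<le> rk b"
  using rk_less[of a b] by (cases "a = b") auto

lemma leX_refl: "x \<in> X \<Longrightarrow> leX x x"
  using X_D le_refl by (simp add: leX_def)

lemma leX_trans: "x \<in> X \<Longrightarrow> y \<in> X \<Longrightarrow> z \<in> X \<Longrightarrow> leX x y \<Longrightarrow> leX y z \<Longrightarrow> leX x z"
  unfolding leX_def using le_trans[OF X_D(1) X_D(1) X_D(1)] by blast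

lemma leX_cases:
  assumes "x \<in> X" "y \<in> X" "leX x y"
  shows "rk (fst x) \<le> rk (fst y)" "card (snd x) \<le> card (snd y)"
    and "rk (fst x) = rk (fst y) \<Longrightarrow> fst x = fst y"
    and "card (snd x) = card (snd y) \<Longrightarrow> snd x = snd y"
proof -
  note f = X_D(1)[OF assms(1)] X_D(1)[OF assms(2)] and fi = finite_idx[OF X_D(2)[OF assms(2)]]
  have l: "le (fst x) (fst y)" "snd x \<subseteq> snd y" using assms(3) by (auto simp: leX_def)
  show "rk (fst x) \<le> rk (fst y)" "card (snd x) \<le> card (snd y)"
    using rk_mono[OF f l(1)] card_mono[OF fi l(2)] by auto
  show "rk (fst x) = rk (fst y) \<Longrightarrow> fst x = fst y" using rk_less[OF f l(1)] by fastforce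
  show "card (snd x) = card (snd y) \<Longrightarrow> snd x = snd y" using card_subset_eq[OF fi l(2)] by blast
qed

lemma R_mono: "x \<in> X \<Longrightarrow> y \<in> X \<Longrightarrow> leX x y \<Longrightarrow> R x \<le> R y"
  using leX_cases(1,2)[of x y] R_Suc[of x] R_Suc[of y] by linarith

lemma R_eq: "x \<in> X \<Longrightarrow> y \<in> X \<Longrightarrow> leX x y \<Longrightarrow> R x = R y \<Longrightarrow> x = y"
  using leX_cases[of x y] R_Suc[of x] R_Suc[of y] by (intro prod_eqI) linarith+

lemma R_less: "x \<in> X \<Longrightarrow> y \<in> X \<Longrightarrow> leX x y \<Longrightarrow> x \<noteq> y \<Longrightarrow> R x < R y"
  using R_mono R_eq by fastforce

lemma topX: "(top, {1..m}) \<in> X" "R (top, {1..m}) = N" "x \<in> X \<Longrightarrow> leX x (top, {1..m})"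
  using top Ifam_top Ifam_sub X_D[of x] m_pos by (auto simp: X_def R_def N_def leX_def)

lemma R_le: "x \<in> X \<Longrightarrow> R x \<le> N"
  using R_mono[OF _ topX(1) topX(3)] topX(2) by simp

lemma X_between:
  assumes "x \<in> X" "y \<in> X" "leX x y" "Suc (R x) < R y"
  shows "\<exists>z\<in>X. leX x z \<and> leX z y \<and> R x < R z \<and> R z < R y"
proof -
  note X = X_D(1)[OF assms(1)] X_D(1)[OF assms(2)] X_D(2)[OF assms(1)] X_D(2)[OF assms(2)]
  have l: "le (fst x) (fst y)" "snd x \<subseteq> snd y" using assms(3) by (auto simp: leX_def)
  have "\<exists>z\<in>X. leX x z \<and> leX z y \<and> x \<noteq> z \<and> z \<noteq> y"
  proof -
    consider "fst x = fst y" | "snd x = snd y" | "fst x \<noteq> fst y" "snd x \<noteq> snd y" by blast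
    then show ?thesis
    proof cases
      case 1
      then have "Suc (card (snd x)) < card (snd y)" using assms R_Suc[of x] R_Suc[of y] by simp
      then obtain L where "L \<in> Ifam" "snd x \<subset> L" "L \<subset> snd y"
        using Ifam_between[OF X(3,4) l(2)] by blast
      then show ?thesis using 1 X(1,2) le_refl[OF X(1)]
        by (intro bexI[of _ "(fst x, L)"]) (auto simp: X_def leX_def prod_eq_iff)
    next
      case 2
      then have "Suc (rk (fst x)) < rk (fst y)" using assms R_Suc[of x] R_Suc[of y] by simp
      then obtain c where "c \<in> E" "le (fst x) c" "le c (fst y)" "rk (fst x) < rk c" "rk c < rk (fst y)"
        using between[OF X(1,2) l(1)] by blast
      then show ?thesis using 2 X(3)
        by (intro bexI[of _ "(c, snd x)"]) (auto simp: X_def leX_def prod_eq_iff)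
    next
      case 3
      then show ?thesis using X l le_refl[OF X(1)]
        by (intro bexI[of _ "(fst x, snd y)"]) (auto simp: X_def leX_def prod_eq_iff)
    qed
  qed
  then show ?thesis using R_less[OF assms(1)] R_less[OF _ assms(2)] by blast
qed

lemma X_below:
  assumes "x \<in> X" "R x > 0"
  shows "\<exists>y\<in>X. leX y x \<and> R y < R x"
proof -
  note X = X_D(1)[OF assms(1)] X_D(2)[OF assms(1)]
  have "\<exists>y\<in>X. leX y x \<and> y \<noteq> x"
  proof (cases "rk (fst x) > 0")
    case True
    then have "bot \<noteq> fst x" using bot(2) by auto
    then show ?thesis using X(2) bot(1) bot(3)[OF X(1)]
      by (intro bexI[of _ "(bot, snd x)"]) (auto simp: X_def leX_def prod_eq_iff)
  next
    case False
    then have "card (snd x) > 1" using assms by (simp add: R_def)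
    then obtain L where "L \<in> Ifam" "L \<subset> snd x" using Ifam_below[OF X(2)] by blast
    then show ?thesis using X(1) le_refl[OF X(1)] by (intro bexI[of _ "(fst x, L)"]) (auto simp: X_def leX_def prod_eq_iff)
  qed
  then show ?thesis using R_less[OF _ assms(1)] by blast
qed

text \<open>A rank \<open>r\<close> missed by \<open>C\<close> cuts \<open>C\<close> into a lower
  and an upper part. A new element fits between the top of the one and the bottom of the other; if
  one part is empty, the top of the product or an element below the bottom of \<open>C\<close>
  serves.\<close>

lemma extend_chain_aux:
  assumes C: "C \<subseteq> X" "\<And>x y. x \<in> C \<Longrightarrow> y \<in> C \<Longrightarrow> leX x y \<or> leX y x"
    and r: "r \<le> N" "r \<notin> R ` C"
  shows "\<exists>z\<in>X. z \<notin> C \<and> (\<forall>x\<in>C. leX x z \<or> leX z x)"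
proof -
  let ?L = "{x \<in> C. R x < r}" and ?U = "{x \<in> C. r < R x}"
  have LU: "x \<in> ?L \<or> x \<in> ?U" if "x \<in> C" for x using that r(2) by (metis (mono_tags) image_eqI linorder_neqE_nat mem_Collect_eq)
  have cmp: "leX x y" if "x \<in> C" "y \<in> C" "R x \<le> R y" for x y
  proof (rule ccontr)
    assume "\<not> leX x y"
    then have "leX y x" using C that by blast
    then have "x = y" using R_eq[of y x] R_mono[of y x] C(1) that by force
    then show False using \<open>\<not> leX x y\<close> leX_refl C(1) that by blast
  qed
  show ?thesis
  proof (cases "?U = {}")
    case True
    then have "(top, {1..m}) \<notin> C" using LU[of "(top, {1..m})"] topX(2) r(1) by auto
    then show ?thesis using topX C(1) by blast
  next
    case False
    then obtain b where b: "b \<in> ?U" "\<And>y. y \<in> ?U \<Longrightarrow> R b \<le> R y"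
      using ex_has_least_nat[of "\<lambda>x. x \<in> ?U" _ R] by blast
    then have bX: "b \<in> X" and bC: "b \<in> C" using C(1) by auto
    show ?thesis
    proof (cases "?L = {}")
      case True
      obtain z where z: "z \<in> X" "leX z b" "R z < R b" using X_below[OF bX] b(1) by auto
      have "z \<notin> C" using LU[of z] True b(2)[of z] z(3) by fastforce
      moreover have "leX z x" if "x \<in> C" for x
        using leX_trans[OF z(1) bX _ z(2)] cmp[OF bC that] b(2)[of x] LU[OF that] True C(1) that by blast
      ultimately show ?thesis using z(1) by blast
    next
      case False
      then obtain a0 where "a0 \<in> ?L" by blast
      then obtain a where a: "a \<in> ?L" "\<And>y. y \<in> ?L \<Longrightarrow> R y \<le> R a"
        using ex_has_greatest_nat[of "\<lambda>x. x \<in> ?L" a0 R r] by (metis (no_types, lifting) mem_Collect_eq less_imp_le_nat)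
      then have aX: "a \<in> X" and aC: "a \<in> C" using C(1) by auto
      have "leX a b" using cmp[OF aC bC] a(1) b(1) by simp
      then obtain z where z: "z \<in> X" "leX a z" "leX z b" "R a < R z" "R z < R b"
        using X_between[OF aX bX] a(1) b(1) by auto
      have "z \<notin> C" using LU[of z] a(2)[of z] b(2)[of z] z by fastforce
      moreover have "leX x z \<or> leX z x" if "x \<in> C" for x
        using leX_trans[OF z(1) bX _ z(3)] leX_trans[OF _ aX z(1) _ z(2)] cmp[OF bC that] cmp[OF that aC]
          b(2)[of x] a(2)[of x] LU[OF that] C(1) that by blast
      ultimately show ?thesis using z(1) by blast
    qed
  qed
qed

text \<open>A chain of largest cardinality containing \<open>C\<close> must meet every rank, and
  comparable elements of equal rank coincide.\<close>

lemma extend_chain: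
  assumes C: "C \<subseteq> X" "\<And>x y. x \<in> C \<Longrightarrow> y \<in> C \<Longrightarrow> leX x y \<or> leX y x"
  shows "\<exists>x. full x \<and> C \<subseteq> x ` {..N}"
proof -
  define chain where "chain D \<longleftrightarrow> D \<subseteq> X \<and> (\<forall>x\<in>D. \<forall>y\<in>D. leX x y \<or> leX y x)" for D
  have inj: "inj_on R D" if "chain D" for D
    using that R_eq unfolding chain_def inj_on_def by (metis subsetD)
  have fin: "finite D" "card D \<le> Suc N" if "chain D" for D
  proof -
    have "R ` D \<subseteq> {..N}" using that R_le by (auto simp: chain_def)
    then show "finite D" "card D \<le> Suc N"
      using inj[OF that] finite_imageD[of R D] finite_subset[of "R ` D" "{..N}"]
        card_mono[of "{..N}" "R ` D"] by (auto simp: card_image)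
  qed
  obtain D where D: "chain D" "C \<subseteq> D" "\<And>D'. chain D' \<Longrightarrow> C \<subseteq> D' \<Longrightarrow> card D' \<le> card D"
    using ex_has_greatest_nat[of "\<lambda>D. chain D \<and> C \<subseteq> D" C card "Suc (Suc N)"] fin(2) C
    by (auto simp: chain_def less_Suc_eq_le)
  have "\<exists>y. y \<in> D \<and> R y = k" if k: "k \<le> N" for k
  proof (rule ccontr)
    assume "\<not> ?thesis"
    then obtain z where z: "z \<in> X" "z \<notin> D" "\<forall>x\<in>D. leX x z \<or> leX z x"
      using extend_chain_aux[of D k] D(1) k unfolding chain_def by (metis (no_types, lifting) image_iff)
    then have "chain (insert z D)" using D(1) leX_refl by (auto simp: chain_def)
    then show False using D(2) D(3)[of "insert z D"] z(2) fin(1)[OF D(1)] by auto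
  qed
  then obtain x where x: "\<And>k. k \<le> N \<Longrightarrow> x k \<in> D \<and> R (x k) = k" by metis
  have DX: "D \<subseteq> X" using D(1) by (simp add: chain_def)
  have "leX (x k) (x (Suc k))" if k: "k < N" for k
  proof (rule ccontr)
    assume "\<not> ?thesis"
    then have "leX (x (Suc k)) (x k)" using D(1) x[of k] x[of "Suc k"] k by (auto simp: chain_def)
    then have "Suc k \<le> k"
      using R_mono[of "x (Suc k)" "x k"] x[of k] x[of "Suc k"] k DX by auto
    then show False by simp
  qed
  then have "full x" using x DX by (auto simp: full_def)
  moreover have "y \<in> x ` {..N}" if "y \<in> C" for y
  proof -
    have "y \<in> X" "y \<in> D" using that C(1) D(2) by auto
    then have "R y \<le> N" using R_le by blast
    then have "x (R y) = y" using inj_onD[OF inj[OF D(1)], of "x (R y)" y] x \<open>y \<in> D\<close> by simp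
    then show ?thesis using \<open>R y \<le> N\<close> by (metis atMost_iff image_eqI)
  qed
  ultimately show ?thesis by blast
qed

lemma ch_mono: "ch l x \<Longrightarrow> i \<le> j \<Longrightarrow> j \<le> l \<Longrightarrow> leX (x i) (x j)"
proof (induction j)
  case 0
  then show ?case using leX_refl by (simp add: ch_def)
next
  case (Suc j)
  show ?case
  proof (cases "i = Suc j")
    case True
    then show ?thesis using Suc.prems leX_refl by (simp add: ch_def)
  next
    case False
    then have "leX (x i) (x j)" "leX (x j) (x (Suc j))" using Suc by (auto simp: ch_def)
    then show ?thesis using leX_trans[of "x i" "x j" "x (Suc j)"] Suc.prems by (auto simp: ch_def)
  qed
qed

lemma full_ch: "full x \<Longrightarrow> ch N x"
proof -
  assume x: "full x"
  have "x k \<noteq> x (Suc k)" if "k < N" for k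
    using x that unfolding full_def by (metis Suc_leI less_imp_le_nat n_not_Suc_n)
  then show ?thesis using x by (auto simp: full_def ch_def)
qed

lemma full_mono: "full x \<Longrightarrow> i \<le> j \<Longrightarrow> j \<le> N \<Longrightarrow> leX (x i) (x j)"
  using ch_mono full_ch by blast

lemma full_D: "full x \<Longrightarrow> k \<le> N \<Longrightarrow> x k \<in> X" "full x \<Longrightarrow> k \<le> N \<Longrightarrow> R (x k) = k"
  by (auto simp: full_def)

lemma pi_convex:
  assumes "x \<in> X" "y \<in> X" "z \<in> X" "leX x y" "leX y z" "pi x = pi z"
  shows "pi y = pi x"
proof -
  have s: "snd y = snd x" "snd z = snd x" using assms(4-6) by (auto simp: leX_def pi_def)
  then have "pr (snd x) (fst y) = pr (snd x) (fst x)"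
    using assms pr_convex[OF X_D(1)[OF assms(1)] X_D(1)[OF assms(2)] X_D(1)[OF assms(3)] _ _ X_D(2)[OF assms(1)]]
    by (auto simp: leX_def pi_def)
  then show ?thesis using s by (simp add: pi_def)
qed

lemma cover_cases:
  assumes "x \<in> X" "y \<in> X" "leX x y" "R y = Suc (R x)"
  shows "snd x = snd y \<and> le (fst x) (fst y) \<and> rk (fst y) = Suc (rk (fst x)) \<or>
    fst x = fst y \<and> card (snd y) = Suc (card (snd x)) \<and> snd x \<subset> snd y"
proof (cases "card (snd x) = card (snd y)")
  case True
  then show ?thesis using leX_cases(4)[OF assms(1-3)] assms(3,4) R_Suc[OF assms(1)] R_Suc[OF assms(2)]
    by (simp add: leX_def)
next
  case False
  then have "card (snd x) < card (snd y)" using leX_cases(2)[OF assms(1-3)] by simp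
  then have "rk (fst x) = rk (fst y)" "card (snd y) = Suc (card (snd x))"
    using assms(4) R_Suc[OF assms(1)] R_Suc[OF assms(2)] leX_cases(1)[OF assms(1-3)] by linarith+
  then show ?thesis using leX_cases(3)[OF assms(1-3)] assms(3) by (auto simp: leX_def)
qed

text \<open>A collapsed edge keeps the index set. If the edge below it also keeps it, the Bruhat
  exchange applies; otherwise the two edges change different components and can be made in the
  opposite order.\<close>

lemma exchange_down:
  assumes X: "u \<in> X" "v \<in> X" "z \<in> X" and l: "leX u v" "leX v z" and r: "R v = Suc (R u)" "R z = Suc (R v)"
    and p: "pi u \<noteq> pi v" "pi v = pi z" and t: "T t (fst v) (fst z)"
  shows "\<exists>v'\<in>X. leX u v' \<and> leX v' z \<and> R v' = Suc (R u) \<and> pi v' \<noteq> pi z \<and>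
    (pi v' = pi u \<longrightarrow> T t (fst u) (fst v'))"
proof -
  note E = X_D(1)[OF X(1)] X_D(1)[OF X(2)] X_D(1)[OF X(3)] and J = X_D(2)[OF X(1)] X_D(2)[OF X(2)]
  have s: "snd v = snd z" "pr (snd v) (fst v) = pr (snd v) (fst z)" using p(2) by (auto simp: pi_def)
  have vz: "le (fst v) (fst z)" "rk (fst z) = Suc (rk (fst v))"
    using cover_cases[OF X(2,3) l(2) r(2)] s by auto
  from cover_cases[OF X(1,2) l(1) r(1)] show ?thesis
  proof
    assume u: "snd u = snd v \<and> le (fst u) (fst v) \<and> rk (fst v) = Suc (rk (fst u))"
    then have "pr (snd v) (fst u) \<noteq> pr (snd v) (fst v)" using p(1) by (auto simp: pi_def)
    then obtain b where b: "b \<in> E" "le (fst u) b" "le b (fst z)" "rk b = Suc (rk (fst u))"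
      "pr (snd v) b \<noteq> pr (snd v) (fst z)" "pr (snd v) b = pr (snd v) (fst u) \<longrightarrow> T t (fst u) b"
      using swap_down[OF E _ vz(1) _ vz(2) J(2) t s(2)] u by blast
    then show ?thesis using u s J r R_Suc[OF X(1)] R_Suc[of "(b, snd v)"]
      by (intro bexI[of _ "(b, snd v)"]) (auto simp: X_def leX_def pi_def)
  next
    assume u: "fst u = fst v \<and> card (snd v) = Suc (card (snd u)) \<and> snd u \<subset> snd v"
    have "(fst z, snd u) \<in> X" using E J by (auto simp: X_def)
    then show ?thesis using u s J r R_Suc[OF X(1)] R_Suc[of "(fst z, snd u)"] t vz le_refl[OF E(3)]
      by (intro bexI[of _ "(fst z, snd u)"]) (auto simp: leX_def pi_def)
  qed
qed

lemma exchange_up: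
  assumes X: "u \<in> X" "v \<in> X" "z \<in> X" and l: "leX u v" "leX v z" and r: "R v = Suc (R u)" "R z = Suc (R v)"
    and p: "pi u = pi v" "pi v \<noteq> pi z" and t: "T t (fst u) (fst v)"
  shows "\<exists>v'\<in>X. leX u v' \<and> leX v' z \<and> R v' = Suc (R u) \<and> pi v' \<noteq> pi u \<and>
    (pi v' = pi z \<longrightarrow> T t (fst v') (fst z))"
proof -
  note E = X_D(1)[OF X(1)] X_D(1)[OF X(2)] X_D(1)[OF X(3)] and J = X_D(2)[OF X(2)] X_D(2)[OF X(3)]
  have s: "snd u = snd v" "pr (snd v) (fst u) = pr (snd v) (fst v)" using p(1) by (auto simp: pi_def)
  have uv: "le (fst u) (fst v)" "rk (fst v) = Suc (rk (fst u))"
    using cover_cases[OF X(1,2) l(1) r(1)] s by auto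
  from cover_cases[OF X(2,3) l(2) r(2)] show ?thesis
  proof
    assume z: "snd v = snd z \<and> le (fst v) (fst z) \<and> rk (fst z) = Suc (rk (fst v))"
    then have "pr (snd v) (fst v) \<noteq> pr (snd v) (fst z)" using p(2) by (auto simp: pi_def)
    then obtain b where b: "b \<in> E" "le (fst u) b" "le b (fst z)" "rk b = Suc (rk (fst u))"
      "pr (snd v) b \<noteq> pr (snd v) (fst u)" "pr (snd v) b = pr (snd v) (fst z) \<longrightarrow> T t b (fst z)"
      using swap_up[OF E uv(1) _ uv(2) _ J(1) t s(2)] z by blast
    then show ?thesis using z s J r R_Suc[OF X(1)] R_Suc[of "(b, snd v)"]
      by (intro bexI[of _ "(b, snd v)"]) (auto simp: X_def leX_def pi_def)
  next
    assume z: "fst v = fst z \<and> card (snd z) = Suc (card (snd v)) \<and> snd v \<subset> snd z"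
    have "(fst u, snd z) \<in> X" using E J by (auto simp: X_def)
    then show ?thesis using z s J r R_Suc[OF X(1)] R_Suc[of "(fst u, snd z)"] t uv le_refl[OF E(1)]
      by (intro bexI[of _ "(fst u, snd z)"]) (auto simp: leX_def pi_def)
  qed
qed

lemma uline_sub: "uline Ifam J \<subseteq> J"
  by (auto simp: uline_def)

lemma full_top: "full x \<Longrightarrow> x N = (top, {1..m})"
  using R_eq[OF _ topX(1) topX(3)] full_D[of x N] topX(2) by simp

lemma full_bot: "full x \<Longrightarrow> fst (x 0) = bot \<and> card (snd (x 0)) = 1"
proof -
  assume x: "full x"
  then have X: "x 0 \<in> X" "R (x 0) = 0" using full_D by auto
  then have "rk (fst (x 0)) = 0" "card (snd (x 0)) = 1"
    using R_Suc[OF X(1)] card_idx(1)[OF X_D(2)[OF X(1)]] by linarith+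
  then show ?thesis using rk_less[OF bot(1) X_D(1)[OF X(1)] bot(3)[OF X_D(1)[OF X(1)]]] by fastforce
qed

text \<open>Consider the first index set of the chain that contains \<open>i\<close>. Either it is
  the lowest one, which is minimal in the family and equals its \<open>uline\<close>, or it covers
  the preceding index set, which lacks \<open>i\<close>.\<close>

lemma full_uline:
  assumes x: "full x"
  shows "(\<Union>J\<in>snd ` x ` {..N}. uline Ifam J) = {1..m}"
proof (intro equalityI subsetI)
  fix i assume "i \<in> (\<Union>J\<in>snd ` x ` {..N}. uline Ifam J)"
  then obtain k where "k \<le> N" "i \<in> snd (x k)" using uline_sub by blast
  then show "i \<in> {1..m}" using Ifam_sub X_D(2) full_D(1)[OF x] by blast
next
  fix i assume i: "i \<in> {1..m}"
  define k where "k = (LEAST k. i \<in> snd (x k))"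
  have "i \<in> snd (x N)" using i full_top[OF x] by simp
  then have k: "i \<in> snd (x k)" "k \<le> N" unfolding k_def by (auto intro: LeastI Least_le)
  have less: "i \<notin> snd (x j)" if "j < k" for j using that not_less_Least unfolding k_def by blast
  have "i \<in> uline Ifam (snd (x k))"
  proof (cases k)
    case 0
    have "\<not> (\<exists>K\<in>Ifam. K \<subset> snd (x 0))"
    proof
      assume "\<exists>K\<in>Ifam. K \<subset> snd (x 0)"
      then obtain K where K: "K \<in> Ifam" "K \<subset> snd (x 0)" by blast
      have "finite (snd (x 0))" using finite_idx X_D(2) full_D(1)[OF x] by blast
      then have "card K < card (snd (x 0))" using K by (simp add: psubset_card_mono)
      then show False using full_bot[OF x] card_idx(1)[OF K(1)] by simp
    qed
    then show ?thesis using k 0 by (simp add: uline_def)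
  next
    case (Suc j)
    have X: "x j \<in> X" "x k \<in> X" "leX (x j) (x k)" "R (x k) = Suc (R (x j))"
      using full_D[OF x] full_mono[OF x] Suc k(2) by auto
    have ne: "snd (x j) \<noteq> snd (x k)" using k(1) less[of j] Suc by auto
    then have c: "card (snd (x k)) = Suc (card (snd (x j)))" "snd (x j) \<subset> snd (x k)"
      using cover_cases[OF X] by auto
    have "coversI Ifam (snd (x k)) (snd (x j))" unfolding coversI_def
    proof (intro conjI notI c(2))
      show "snd (x j) \<in> Ifam" using X_D X by blast
      assume "\<exists>L\<in>Ifam. snd (x j) \<subset> L \<and> L \<subset> snd (x k)"
      then obtain L where L: "L \<in> Ifam" "snd (x j) \<subset> L" "L \<subset> snd (x k)" by blast
      have "card (snd (x j)) < card L" "card L < card (snd (x k))"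
        using L psubset_card_mono finite_idx X_D(2) X by blast+
      then show False using c(1) by simp
    qed
    moreover have "snd (x j) \<in> Ifam" using X_D X by blast
    ultimately show ?thesis using c(2) k(1) less[of j] Suc unfolding uline_def by auto
  qed
  then show "i \<in> (\<Union>J\<in>snd ` x ` {..N}. uline Ifam J)" using k(2) by blast
qed

abbreviation col :: "(nat \<Rightarrow> 'a \<times> nat set) \<Rightarrow> nat \<Rightarrow> bool" where
  "col x k \<equiv> pi (x k) = pi (x (Suc k))"

end

text \<open>\<open>S\<close> stands for the elements of the maximal standard chain; the assumption
  is the trace of its maximality on full chains.\<close>

locale maximal_image = collapse +
  fixes S
  assumes max_image: "\<And>x. full x \<Longrightarrow> S \<subseteq> pi ` x ` {..N} \<Longrightarrow> pi ` x ` {..N} = S"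
begin

definition good where "good x \<longleftrightarrow> full x \<and> pi ` x ` {..N} = S"

text \<open>One of the two edges at the removed vertex is collapsed, so its image is also the image
  of a neighbour and none is lost. By maximality none is gained either, and convexity of the fibres
  leaves only the two neighbours for \<open>pi v\<close>.\<close>

lemma replace_vertex:
  assumes x: "good x" and k: "Suc (Suc k) \<le> N" and v: "v \<in> X" "leX (x k) v" "leX v (x (Suc (Suc k)))"
    "R v = Suc k" and c: "col x k \<or> col x (Suc k)"
  shows "good (x(Suc k := v))" "pi v = pi (x k) \<or> pi v = pi (x (Suc (Suc k)))"
proof -
  have f: "full x" using x by (simp add: good_def)
  let ?x = "x(Suc k := v)"
  have f': "full ?x" using f v unfolding full_def by auto
  have "pi (x j) \<in> pi ` ?x ` {..N}" if j: "j \<le> N" for j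
  proof (cases "j = Suc k")
    case True
    have "?x k = x k" "?x (Suc (Suc k)) = x (Suc (Suc k))" by auto
    then have "pi (x k) \<in> pi ` ?x ` {..N}" "pi (x (Suc (Suc k))) \<in> pi ` ?x ` {..N}"
      using k by (metis (no_types) Suc_leD atMost_iff image_eqI)+
    then show ?thesis using c True by auto
  next
    case False
    then have "?x j = x j" by simp
    then show ?thesis using j by (metis atMost_iff image_eqI)
  qed
  then have "S \<subseteq> pi ` ?x ` {..N}" using x by (auto simp: good_def)
  then have e: "pi ` ?x ` {..N} = S" using max_image f' by blast
  then show "good ?x" using f' by (simp add: good_def)
  have "?x (Suc k) = v" "Suc k \<le> N" using k by auto
  then have "pi v \<in> S" using e by (metis atMost_iff image_eqI)
  then obtain j where j: "j \<le> N" "pi v = pi (x j)" using x by (auto simp: good_def)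
  \<comment> \<open>\<open>pi v\<close> already occurs at position \<open>j\<close>. If
    \<open>j\<close> lies beyond a neighbour of \<open>v\<close>, that neighbour is squeezed between
    two elements of the same image.\<close>
  consider "j \<le> k" | "j = Suc k" | "Suc (Suc k) \<le> j" by linarith
  then show "pi v = pi (x k) \<or> pi v = pi (x (Suc (Suc k)))"
  proof cases
    case 1
    then have "pi (x k) = pi (x j)"
      using pi_convex[of "x j" "x k" v] full_D(1)[OF f] full_mono[OF f] v(1,2) j k by simp
    then show ?thesis using j by simp
  next
    case 2
    then show ?thesis using j c by auto
  next
    case 3
    then have "pi (x (Suc (Suc k))) = pi v"
      using pi_convex[of v "x (Suc (Suc k))" "x j"] full_D(1)[OF f] full_mono[OF f] v(1,3) j k by simp
    then show ?thesis by simp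
  qed
qed

text \<open>The exchanged vertex does not project to its upper neighbour, so it projects to the
  lower one: the collapsed edge has moved from position k+1 to k.\<close>

lemma move_down:
  assumes x: "good x" and k: "Suc k < N" and c: "\<not> col x k" "col x (Suc k)"
  shows "\<exists>v. good (x(Suc k := v)) \<and> pi v = pi (x k) \<and> pi v \<noteq> pi (x (Suc (Suc k)))"
proof -
  have f: "full x" using x by (simp add: good_def)
  note D = full_D[OF f] full_mono[OF f]
  have X: "x k \<in> X" "x (Suc k) \<in> X" "x (Suc (Suc k)) \<in> X" "leX (x k) (x (Suc k))"
    "leX (x (Suc k)) (x (Suc (Suc k)))" "R (x (Suc k)) = Suc (R (x k))"
    "R (x (Suc (Suc k))) = Suc (R (x (Suc k)))"
    using D k by auto
  have s: "snd (x (Suc k)) = snd (x (Suc (Suc k)))" using c(2) by (auto simp: pi_def)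
  obtain t where t: "T t (fst (x (Suc k))) (fst (x (Suc (Suc k))))"
    using cover_cases[OF X(2,3,5,7)] s T_ex[OF X_D(1)[OF X(2)] X_D(1)[OF X(3)]] by auto
  obtain v where v: "v \<in> X" "leX (x k) v" "leX v (x (Suc (Suc k)))" "R v = Suc (R (x k))"
    "pi v \<noteq> pi (x (Suc (Suc k)))"
    using exchange_down[OF X c t] by blast
  show ?thesis using replace_vertex[OF x _ v(1-3)] v(4,5) c(2) D k by (intro exI[of _ v]) auto
qed

lemma move_up:
  assumes x: "good x" and k: "Suc k < N" and c: "col x k" "\<not> col x (Suc k)"
    and t: "T t (fst (x k)) (fst (x (Suc k)))"
  shows "\<exists>v. good (x(Suc k := v)) \<and> pi v = pi (x (Suc (Suc k))) \<and> T t (fst v) (fst (x (Suc (Suc k))))"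
proof -
  have f: "full x" using x by (simp add: good_def)
  note D = full_D[OF f] full_mono[OF f]
  have X: "x k \<in> X" "x (Suc k) \<in> X" "x (Suc (Suc k)) \<in> X" "leX (x k) (x (Suc k))"
    "leX (x (Suc k)) (x (Suc (Suc k)))" "R (x (Suc k)) = Suc (R (x k))"
    "R (x (Suc (Suc k))) = Suc (R (x (Suc k)))"
    using D k by auto
  obtain v where v: "v \<in> X" "leX (x k) v" "leX v (x (Suc (Suc k)))" "R v = Suc (R (x k))"
    "pi v \<noteq> pi (x k)" "pi v = pi (x (Suc (Suc k))) \<longrightarrow> T t (fst v) (fst (x (Suc (Suc k))))"
    using exchange_up[OF X c t] by blast
  show ?thesis using replace_vertex[OF x _ v(1-3)] v(4-6) c(1) D k by (intro exI[of _ v]) auto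
qed

text \<open>Take a chain for which the sum of the positions of the collapsed edges is minimal.\<close>

lemma collapsed_at_bottom:
  assumes "good x"
  shows "\<exists>y. good y \<and> (\<forall>k. Suc k < N \<longrightarrow> col y (Suc k) \<longrightarrow> col y k)"
proof -
  define wt where "wt y = (\<Sum>k | k < N \<and> col y k. k)" for y
  obtain y where y: "good y" "\<And>z. good z \<Longrightarrow> wt y \<le> wt z"
    using ex_has_least_nat[of good x wt] assms by blast
  have "col y k" if k: "Suc k < N" and c: "col y (Suc k)" for k
  proof (rule ccontr)
    assume n: "\<not> col y k"
    obtain v where v: "good (y(Suc k := v))" "pi v = pi (y k)" "pi v \<noteq> pi (y (Suc (Suc k)))"
      using move_down[OF y(1) k n c] by blast
    let ?z = "y(Suc k := v)" and ?A = "{j. j < N \<and> col y j}"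
    let ?B = "?A - {Suc k}"
    have "{j. j < N \<and> col ?z j} = insert k ?B" using v n k by auto
    moreover have "k \<notin> ?B" "finite ?B" using n by auto
    ultimately have "wt ?z = k + \<Sum> ?B" by (simp add: wt_def)
    moreover have "wt y = Suc k + \<Sum> ?B"
      unfolding wt_def using k c by (intro sum.remove) auto
    ultimately show False using y(2)[OF v(1)] by simp
  qed
  then show ?thesis using y(1) by blast
qed

text \<open>Once all collapsed edges are at the bottom, hence at one minimal index set, the topmost of
  them can be moved through all levels; its reflection then stabilizes every \<open>\<lambda>\<^sub>J\<close> along the
  chain, so that it cannot move anything.\<close>

lemma lift_collapse:
  assumes "good x" "j < N" "col x j" "\<And>k. j < k \<Longrightarrow> k < N \<Longrightarrow> \<not> col x k"
    and t: "T t (fst (x j)) (fst (x (Suc j)))" "\<And>k. k \<le> Suc j \<Longrightarrow> fx t (snd (x k))"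
    and i: "j \<le> i" "i < N"
  shows "\<exists>y. good y \<and> col y i \<and> (\<forall>k. i < k \<longrightarrow> k < N \<longrightarrow> \<not> col y k) \<and>
    T t (fst (y i)) (fst (y (Suc i))) \<and> (\<forall>k\<le>Suc i. fx t (snd (y k)))"
  using i
proof (induction i rule: dec_induct)
  case base
  then show ?case using assms by (intro exI[of _ x]) auto
next
  case (step i)
  then obtain y where y: "good y" "col y i" "\<And>k. i < k \<Longrightarrow> k < N \<Longrightarrow> \<not> col y k"
    "T t (fst (y i)) (fst (y (Suc i)))" "\<And>k. k \<le> Suc i \<Longrightarrow> fx t (snd (y k))"
    by auto
  obtain v where v: "good (y(Suc i := v))" "pi v = pi (y (Suc (Suc i)))"
    "T t (fst v) (fst (y (Suc (Suc i))))"
    using move_up[OF y(1) _ y(2) _ y(4)] y(3) step.prems by blast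
  let ?z = "y(Suc i := v)"
  have f: "full ?z" "full y" using v(1) y(1) by (auto simp: good_def)
  have J: "snd v \<in> Ifam" using X_D(2)[OF full_D(1)[OF f(1), of "Suc i"]] step.prems by simp
  have "fx t (snd v)"
    using T_fx[OF v(3) J] v(2) by (auto simp: pi_def)
  moreover have "snd (y (Suc (Suc i))) = snd v" using v(2) by (simp add: pi_def)
  ultimately have "fx t (snd (?z k))" if "k \<le> Suc (Suc i)" for k
    using y(5)[of k] that by (cases "k = Suc (Suc i)"; cases "k = Suc i") auto
  moreover have "col ?z (Suc i)" using v(2) by simp
  moreover have "\<not> col ?z k" if "Suc i < k" "k < N" for k using y(3)[of k] that by simp
  moreover have "T t (fst (?z (Suc i))) (fst (?z (Suc (Suc i))))" using v(3) by simp
  ultimately show ?case using v(1) by blast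
qed

lemma no_collapse:
  assumes "good x" "k < N"
  shows "\<not> col x k"
proof
  assume c: "col x k"
  \<comment> \<open>A good chain \<open>z\<close> without collapsed edges would give the common
    image N+1 elements, and \<open>x\<close> would be injective under \<open>pi\<close>, against
    \<open>c\<close>. So every good chain has a collapsed edge.\<close>
  have eq: "col z k" if z: "good z" "\<forall>k<N. \<not> col z k" for z
  proof -
    have f: "full x" "full z" using z assms by (auto simp: good_def)
    have "inj_on (\<lambda>k. pi (z k)) {..N}"
    proof (rule linorder_inj_onI')
      fix i j assume ij: "i \<in> {..N}" "j \<in> {..N}" "i < j"
      have "pi (z i) \<noteq> pi (z (Suc i))" using z(2) ij by simp
      then show "pi (z i) \<noteq> pi (z j)"
        using pi_convex[of "z i" "z (Suc i)" "z j"] full_D(1)[OF f(2)] full_mono[OF f(2)] ij by force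
    qed
    then have "card ((\<lambda>k. pi (z k)) ` {..N}) = Suc N" by (simp add: card_image)
    moreover have "(\<lambda>k. pi (z k)) ` {..N} = (\<lambda>k. pi (x k)) ` {..N}"
      using z(1) assms(1) by (simp add: good_def image_image)
    ultimately have "inj_on (\<lambda>k. pi (x k)) {..N}" by (intro eq_card_imp_inj_on) auto
    then have "k = Suc k" using c assms(2) by (auto dest: inj_onD)
    then show ?thesis by simp
  qed
  obtain y where y: "good y" "\<And>k. Suc k < N \<Longrightarrow> col y (Suc k) \<Longrightarrow> col y k"
    using collapsed_at_bottom assms(1) by blast
  have f: "full y" using y(1) by (simp add: good_def)
  let ?A = "{k. k < N \<and> col y k}"
  have "?A \<noteq> {}" using eq[OF y(1)] assms(2) by blast
  moreover have "finite ?A" by simp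
  ultimately have "Max ?A \<in> ?A" and Max: "\<And>k. k \<in> ?A \<Longrightarrow> k \<le> Max ?A"
    using Max_in Max_ge by blast+
  define j where "j = Max ?A"
  have j: "j < N" "col y j" "\<And>k. j < k \<Longrightarrow> k < N \<Longrightarrow> \<not> col y k"
    using \<open>Max ?A \<in> ?A\<close> Max unfolding j_def by (auto simp: not_le[symmetric])
  \<comment> \<open>The collapsed edges now fill an initial segment, and a collapsed edge keeps the
    index set, so all these vertices share one index set.\<close>
  have low: "col y k" if "k \<le> j" for k
    using that by (induction k rule: inc_induct) (use y(2) j(1,2) in auto)
  have s: "snd (y k) = snd (y j)" if "k \<le> Suc j" for k
  proof -
    have s0: "snd (y k) = snd (y 0)" if "k \<le> Suc j" for k
      using that
    proof (induction k)
      case (Suc k)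
      then show ?case using low[of k] by (simp add: pi_def)
    qed simp
    show ?thesis using s0[OF that] s0[of j] by simp
  qed
  have X: "y j \<in> X" "y (Suc j) \<in> X" "leX (y j) (y (Suc j))" "R (y (Suc j)) = Suc (R (y j))"
    using full_D[OF f] full_mono[OF f] j(1) by auto
  obtain t where t: "T t (fst (y j)) (fst (y (Suc j)))"
    using cover_cases[OF X] s[of "Suc j"] T_ex[OF X_D(1)[OF X(1)] X_D(1)[OF X(2)]] by auto
  have "fx t (snd (y j))"
    using T_fx[OF t X_D(2)[OF X(1)]] j(2) s[of "Suc j"] by (simp add: pi_def)
  \<comment> \<open>The collapsed edge has become the top one, from position \<open>N - 1\<close> to
    \<open>N\<close>, and \<open>t\<close> is fixed at every index set of the chain.\<close>
  then obtain z where z: "good z" "col z (N - 1)" "T t (fst (z (N - 1))) (fst (z (Suc (N - 1))))"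
    "\<forall>k\<le>Suc (N - 1). fx t (snd (z k))"
    using lift_collapse[OF y(1) j t, of "N - 1"] s j(1) by (metis Suc_pred' diff_less less_Suc_eq_le not_gr_zero zero_less_one gr_implies_not0)
  have N: "Suc (N - 1) = N" using j(1) by simp
  have fz: "full z" using z(1) by (simp add: good_def)
  have "snd ` z ` {..N} \<subseteq> Ifam" using X_D(2)[OF full_D(1)[OF fz]] by blast
  then have "fst (z (N - 1)) = fst (z N)"
    using T_fx_all[OF z(3), of "snd ` z ` {..N}"] full_uline[OF fz] z(4) unfolding N by auto
  moreover have "snd (z (N - 1)) = snd (z N)" using z(2) unfolding N by (simp add: pi_def)
  ultimately have "z (N - 1) = z N" by (rule prod_eqI)
  then show False using full_D(2)[OF fz, of "N - 1"] full_D(2)[OF fz, of N] N by simp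
qed

end

section \<open>Fullness, uniqueness and maximality of lifted chains\<close>

context collapse
begin

lemma ch_R_inj:
  assumes "ch l x" "i \<le> j" "j \<le> l"
  shows "R (x i) + (j - i) \<le> R (x j)"
  using assms(2,3)
proof (induction j rule: dec_induct)
  case (step j)
  then have "R (x j) < R (x (Suc j))" using assms(1) by (intro R_less) (auto simp: ch_def)
  then show ?case using step by (simp add: Suc_diff_le)
qed simp

text \<open>A full chain through \<open>D\<close> has the same image as \<open>D\<close> and no
  collapsed edge. The image therefore has N+1 elements, so \<open>D\<close> has at least as many and
  must run through all ranks.\<close>

lemma maximal_image_full:
  assumes D: "ch l D" "\<And>k. k < l \<Longrightarrow> \<not> col D k"
    and max: "\<And>x. full x \<Longrightarrow> pi ` D ` {..l} \<subseteq> pi ` x ` {..N} \<Longrightarrow> pi ` x ` {..N} = pi ` D ` {..l}"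
  shows "l = N \<and> full D"
proof -
  interpret maximal_image E le rk bot top Ifam m pr T fx "pi ` D ` {..l}"
    by unfold_locales (rule max)
  have "leX (D i) (D j) \<or> leX (D j) (D i)" if "i \<le> l" "j \<le> l" for i j
    using ch_mono[OF D(1), of i j] ch_mono[OF D(1), of j i] that by linarith
  moreover have DX: "D ` {..l} \<subseteq> X" using D(1) by (auto simp: ch_def)
  ultimately obtain x where x: "full x" "D ` {..l} \<subseteq> x ` {..N}"
    using extend_chain[of "D ` {..l}"] by blast
  have img: "pi ` x ` {..N} = pi ` D ` {..l}" using max[OF x(1)] x(2) by blast
  then have g: "good x" using x(1) by (simp add: good_def)
  have "inj_on (\<lambda>k. pi (x k)) {..N}"
  proof (rule linorder_inj_onI')
    fix i j assume ij: "i \<in> {..N}" "j \<in> {..N}" "i < j"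
    have "pi (x i) \<noteq> pi (x (Suc i))" using no_collapse[OF g, of i] ij by simp
    then show "pi (x i) \<noteq> pi (x j)"
      using pi_convex[of "x i" "x (Suc i)" "x j"] full_D(1)[OF x(1)] full_mono[OF x(1)] ij by force
  qed
  then have "card (pi ` D ` {..l}) = Suc N"
    using img card_image[of "\<lambda>k. pi (x k)" "{..N}"] by (simp add: image_image)
  moreover have "card (pi ` D ` {..l}) \<le> Suc l"
    using card_image_le[of "{..l}" "\<lambda>k. pi (D k)"] by (simp add: image_image)
  ultimately have "N \<le> l" by simp
  moreover have "l \<le> N"
    using ch_R_inj[OF D(1), of 0 l] R_le[of "D l"] D(1) by (simp add: ch_def)
  ultimately have l: "l = N" by simp
  have "R (D k) = k" if "k \<le> N" for k
    using ch_R_inj[OF D(1), of 0 k] ch_R_inj[OF D(1), of k l] R_le[of "D l"] D(1) that l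
    by (simp add: ch_def)
  then show ?thesis using l D(1) by (simp add: full_def ch_def)
qed

text \<open>Both chains start at \<open>bot\<close>. An edge changing the index set keeps the first
  component; any other edge is not collapsed and is determined by its lower end and the projection
  of its upper end.\<close>

lemma full_unique:
  assumes D: "full D" "full D'" and p: "\<And>k. k \<le> N \<Longrightarrow> pi (D k) = pi (D' k)"
    and c: "\<And>k. k < N \<Longrightarrow> \<not> col D k" and k: "k \<le> N"
  shows "D k = D' k"
  using k
proof (induction k)
  case 0
  show ?case using full_bot[OF D(1)] full_bot[OF D(2)] p[of 0] by (intro prod_eqI) (auto simp: pi_def)
next
  case (Suc k)
  then have eq: "D k = D' k" and sn: "snd (D (Suc k)) = snd (D' (Suc k))"
    and pp: "pr (snd (D (Suc k))) (fst (D (Suc k))) = pr (snd (D (Suc k))) (fst (D' (Suc k)))"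
    using p[of "Suc k"] by (auto simp: pi_def)
  have X: "D k \<in> X" "D (Suc k) \<in> X" "leX (D k) (D (Suc k))" "R (D (Suc k)) = Suc (R (D k))"
    using full_D[OF D(1)] full_mono[OF D(1)] Suc.prems by auto
  have X': "D k \<in> X" "D' (Suc k) \<in> X" "leX (D k) (D' (Suc k))" "R (D' (Suc k)) = Suc (R (D k))"
    using full_D[OF D(2)] full_mono[OF D(2), of k "Suc k"] Suc.prems eq by auto
  show ?case
  proof (cases "snd (D k) = snd (D (Suc k))")
    case True
    then have "pr (snd (D (Suc k))) (fst (D (Suc k))) \<noteq> pr (snd (D (Suc k))) (fst (D k))"
      using c[of k] Suc.prems by (auto simp: pi_def)
    then have "fst (D (Suc k)) = fst (D' (Suc k))"
      using cover_unique[OF X_D(1)[OF X(1)] X_D(1)[OF X(2)] X_D(1)[OF X'(2)] _ _ _ _ X_D(2)[OF X(2)] pp]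
        cover_cases[OF X] cover_cases[OF X'] True sn by auto
    then show ?thesis using sn by (rule prod_eqI)
  next
    case False
    then have "fst (D (Suc k)) = fst (D' (Suc k))"
      using cover_cases[OF X] cover_cases[OF X'] sn by auto
    then show ?thesis using sn by (rule prod_eqI)
  qed
qed

text \<open>A full chain has an element of every rank, and comparable elements of equal rank
  coincide.\<close>

lemma full_maximal:
  assumes D: "full D" and y: "ch l y" and sub: "D ` {..N} \<subseteq> y ` {..l}"
  shows "y ` {..l} = D ` {..N}"
proof (intro equalityI sub subsetI)
  fix v assume "v \<in> y ` {..l}"
  then obtain i where i: "i \<le> l" "v = y i" by auto
  then have vX: "v \<in> X" using y by (simp add: ch_def)
  then have R: "R v \<le> N" by (rule R_le)
  then obtain j where j: "j \<le> l" "D (R v) = y j" using sub by blast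
  have "R (y j) = R (y i)" using full_D(2)[OF D R] j i by simp
  moreover have "y i \<in> X" "y j \<in> X" using y i j by (auto simp: ch_def)
  moreover have "leX (y i) (y j) \<or> leX (y j) (y i)"
    using ch_mono[OF y, of i j] ch_mono[OF y, of j i] i j by linarith
  ultimately have "y i = y j" using R_eq[of "y i" "y j"] R_eq[of "y j" "y i"] by metis
  then have "v = D (R v)" using i j by simp
  then show "v \<in> D ` {..N}" using R by blast
qed

text \<open>Turns a full chain into one whose image is strictly ordered without repetition, as
  needed to view the image as a standard chain.\<close>

lemma delete_collapsed:
  "ch l x \<Longrightarrow> \<exists>l' y. ch l' y \<and> (\<forall>k<l'. \<not> col y k) \<and> pi ` y ` {..l'} = pi ` x ` {..l}"
proof (induction l arbitrary: x)
  case 0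
  then show ?case by (intro exI[of _ 0] exI[of _ x]) simp
next
  case (Suc l)
  show ?case
  proof (cases "\<forall>k<Suc l. \<not> col x k")
    case True
    then show ?thesis using Suc.prems by blast
  next
    case False
    then obtain k where k: "k \<le> l" "col x k" by (auto simp: less_Suc_eq_le)
    \<comment> \<open>The vertex at position k+1 is left out; the one at \<open>k\<close> has the
      same image.\<close>
    define y where "y j = (if j \<le> k then x j else x (Suc j))" for j
    have X: "x j \<in> X" if "j \<le> Suc l" for j using Suc.prems that by (simp add: ch_def)
    have "ch l y" unfolding ch_def
    proof (intro conjI allI impI)
      fix j assume "j \<le> l"
      then show "y j \<in> X" using X k by (simp add: y_def)
    next
      fix j assume j: "j < l"
      have less: "leX (x i) (x i')" "x i \<noteq> x i'" if "i < i'" "i' \<le> Suc l" for i i'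
        using ch_mono[OF Suc.prems, of i i'] ch_R_inj[OF Suc.prems, of i i'] that by auto
      show "leX (y j) (y (Suc j))" "y j \<noteq> y (Suc j)"
        using less[of j "Suc j"] less[of j "Suc (Suc j)"] less[of "Suc j" "Suc (Suc j)"] j k(1)
        by (auto simp: y_def)
    qed
    moreover have "pi ` y ` {..l} = pi ` x ` {..Suc l}"
    proof (intro equalityI subsetI)
      fix v assume "v \<in> pi ` y ` {..l}"
      then obtain j where "j \<le> l" "v = pi (y j)" by auto
      then show "v \<in> pi ` x ` {..Suc l}" by (auto simp: y_def)
    next
      fix v assume "v \<in> pi ` x ` {..Suc l}"
      then obtain j where j: "j \<le> Suc l" "v = pi (x j)" by auto
      consider "j \<le> k" | "j = Suc k" | i where "j = Suc i" "k < i"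
        by (metis Suc_lessE le_eq_less_or_eq not_less_eq_eq not_le)
      then show "v \<in> pi ` y ` {..l}"
      proof cases
        case 1
        then have "v = pi (y j)" "j \<le> l" using j k(1) by (auto simp: y_def)
        then show ?thesis by blast
      next
        case 2
        then have "v = pi (y k)" using j k by (simp add: y_def)
        then show ?thesis using k(1) by blast
      next
        case 3
        then have "v = pi (y i)" "i \<le> l" using j by (auto simp: y_def)
        then show ?thesis by blast
      qed
    qed
    ultimately show ?thesis using Suc.IH[of y] by metis
  qed
qed

end

section \<open>Defining chains\<close>

locale lsm_data = positive_system \<Phi> \<Delta> h for \<Phi> \<Delta> :: "'v::euclidean_space set" and h +
  fixes lam :: "nat \<Rightarrow> 'v" and m :: nat and Ifam :: "nat set set" and \<tau> :: "('v \<Rightarrow> 'v) set"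
  assumes m_pos: "m \<ge> 1"
    and dom_lam: "i \<in> {1..m} \<Longrightarrow> dom (lam i)"
    and index_family: "index_family Ifam m"
    and independent_simple: "independent \<Delta>"
    and tau: "\<tau> \<in> quot \<Phi> (Qgrp \<Phi> lam m)"
begin

definition lsum :: "nat set \<Rightarrow> 'v" where "lsum A = (\<Sum>i\<in>A. lam i)"

definition lt :: 'v where "lt = lsum {1..m}"

abbreviation "Q \<equiv> Qgrp \<Phi> lam m"
abbreviation "P \<equiv> PI \<Phi> lam Ifam"
abbreviation "lI J \<equiv> lsum (uline Ifam J)"

lemma Q_stab: "Q = stab \<Phi> lt" by (simp add: Qgrp_def lt_def lsum_def)
lemma P_stab: "P J = stab \<Phi> (lI J)" by (simp add: PI_def lsum_def)

lemma dom_lsum: "A \<subseteq> {1..m} \<Longrightarrow> dom (lsum A)"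
  unfolding lsum_def using dom_lam by (intro dom_sum) blast

lemma dom_lt: "dom lt" by (simp add: lt_def dom_lsum)

lemma stab_lsum: "A \<subseteq> {1..m} \<Longrightarrow> w \<in> stab \<Phi> (lsum A) \<longleftrightarrow> w \<in> weyl \<Phi> \<and> (\<forall>i\<in>A. w (lam i) = lam i)"
  using dom_sum_fix[OF finite_subset[OF _ finite_atLeastAtMost], of A 1 m lam w] dom_lam
  unfolding stab_def lsum_def by blast

lemma uline_subset: "J \<in> Ifam \<Longrightarrow> uline Ifam J \<subseteq> {1..m}"
proof -
  assume "J \<in> Ifam"
  then have "J \<subseteq> {1..m}" using index_family by (auto simp: index_family_def)
  then show ?thesis by (auto simp: uline_def)
qed

lemma fibration_P: "J \<in> Ifam \<Longrightarrow> fibration \<Phi> \<Delta> h lt (lI J)"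
proof
  assume "J \<in> Ifam"
  then have s: "uline Ifam J \<subseteq> {1..m}" by (rule uline_subset)
  then show "dom (lI J)" by (rule dom_lsum)
  show "stab \<Phi> lt \<subseteq> stab \<Phi> (lI J)"
    unfolding lt_def using stab_lsum[OF s] stab_lsum[OF order_refl] s by blast
qed (rule dom_lt)

definition lower :: "('v \<Rightarrow> 'v) set set" where "lower = {A \<in> quot \<Phi> Q. cle \<Phi> \<Delta> A \<tau>}"

text \<open>As a left multiplication the reflection would be that in \<open>w t\<close>. The
  right-hand form is chosen because \<open>t\<close> alone decides in which quotients the edge
  collapses.\<close>

definition edge :: "'v \<Rightarrow> ('v \<Rightarrow> 'v) set \<Rightarrow> ('v \<Rightarrow> 'v) set \<Rightarrow> bool" where
  "edge t a b \<longleftrightarrow> t \<in> \<Phi> \<and> (\<exists>w\<in>weyl \<Phi>. a = coset w Q \<and> b = coset (w \<circ> sref t) Q)"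

lemma quot_obtain:
  assumes "A \<in> quot \<Phi> Q"
  obtains w where "w \<in> weyl \<Phi>" "A = coset w Q"
  using assms by (auto simp: quot_def)

lemma cle_Q: "u \<in> weyl \<Phi> \<Longrightarrow> w \<in> weyl \<Phi> \<Longrightarrow> cle \<Phi> \<Delta> (coset u Q) (coset w Q) \<longleftrightarrow> le (u lt) (w lt)"
  unfolding Q_stab by (intro cle_coset_iff dom_lt)

lemma wrank_Q: "w \<in> weyl \<Phi> \<Longrightarrow> wrank \<Delta> (coset w Q) = rk (w lt)"
  unfolding Q_stab by (intro wrank_coset dom_lt)

lemma coset_Q_eq: "u \<in> weyl \<Phi> \<Longrightarrow> w \<in> weyl \<Phi> \<Longrightarrow> coset u Q = coset w Q \<longleftrightarrow> u lt = w lt"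
  unfolding Q_stab by (rule coset_stab_eq_iff)

lemma proj_P: "J \<in> Ifam \<Longrightarrow> w \<in> weyl \<Phi> \<Longrightarrow> proj (P J) (coset w Q) = coset w (P J)"
  unfolding Q_stab P_stab by (intro proj_coset fibration.stab_le[OF fibration_P])

lemma proj_P_eq_iff:
  assumes "J \<in> Ifam" "u \<in> weyl \<Phi>" "w \<in> weyl \<Phi>"
  shows "proj (P J) (coset u Q) = proj (P J) (coset w Q) \<longleftrightarrow> u (lI J) = w (lI J)"
  unfolding proj_P[OF assms(1,2)] proj_P[OF assms(1,3)] unfolding P_stab
  by (rule coset_stab_eq_iff[OF assms(2,3)])

lemma coset_in_quot: "w \<in> weyl \<Phi> \<Longrightarrow> coset w Q \<in> quot \<Phi> Q"
  by (simp add: quot_def)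

lemma cle_refl: "A \<in> quot \<Phi> Q \<Longrightarrow> cle \<Phi> \<Delta> A A"
  by (erule quot_obtain) (simp add: cle_Q)

lemma cle_trans:
  assumes "A \<in> quot \<Phi> Q" "B \<in> quot \<Phi> Q" "C \<in> quot \<Phi> Q" "cle \<Phi> \<Delta> A B" "cle \<Phi> \<Delta> B C"
  shows "cle \<Phi> \<Delta> A C"
proof -
  obtain a where a: "a \<in> weyl \<Phi>" "A = coset a Q" using assms(1) by (rule quot_obtain)
  obtain b where b: "b \<in> weyl \<Phi>" "B = coset b Q" using assms(2) by (rule quot_obtain)
  obtain c where c: "c \<in> weyl \<Phi>" "C = coset c Q" using assms(3) by (rule quot_obtain)
  have "le (a lt) (b lt)" "le (b lt) (c lt)"
    using assms(4,5) cle_Q[OF a(1) b(1)] cle_Q[OF b(1) c(1)] a b c by simp_all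
  then show ?thesis using cle_Q[OF a(1) c(1)] a c by simp
qed

lemma cle_vec:
  assumes "w \<in> weyl \<Phi>" "le (w lt) y"
  obtains u where "u \<in> weyl \<Phi>" "y = u lt" "cle \<Phi> \<Delta> (coset w Q) (coset u Q)"
proof -
  obtain v where v: "v \<in> weyl \<Phi>" "y = v (w lt)" using le_orbit[OF assms(2)] by blast
  have "v \<circ> w \<in> weyl \<Phi>" using weyl_comp v(1) assms(1) by blast
  then show ?thesis using that[of "v \<circ> w"] v assms by (simp add: cle_Q)
qed

lemma edge_obtain:
  assumes "edge t a b"
  obtains w where "w \<in> weyl \<Phi>" "t \<in> \<Phi>" "w \<circ> sref t \<in> weyl \<Phi>" "a = coset w Q" "b = coset (w \<circ> sref t) Q"
proof -
  obtain w where w: "w \<in> weyl \<Phi>" "t \<in> \<Phi>" "a = coset w Q" "b = coset (w \<circ> sref t) Q"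
    using assms by (auto simp: edge_def)
  show thesis by (rule that[OF w(1,2) weyl_comp[OF w(1) sref_in_weyl[OF w(2)]] w(3,4)])
qed

lemma lower_D: "A \<in> lower \<Longrightarrow> A \<in> quot \<Phi> Q" "A \<in> lower \<Longrightarrow> cle \<Phi> \<Delta> A \<tau>"
  by (auto simp: lower_def)

lemma lower_obtain:
  assumes "A \<in> lower"
  obtains w where "w \<in> weyl \<Phi>" "A = coset w Q"
  using lower_D(1)[OF assms] by (rule quot_obtain)

lemma lower_le: "A \<in> lower \<Longrightarrow> B \<in> quot \<Phi> Q \<Longrightarrow> cle \<Phi> \<Delta> B A \<Longrightarrow> B \<in> lower"
  using cle_trans[of B A \<tau>] tau by (auto simp: lower_def)

section \<open>Transfer of exchange and convexity from vectors to cosets\<close>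

lemma swap_down_coset:
  assumes E: "a \<in> lower" "b \<in> lower" "c \<in> lower" and l: "cle \<Phi> \<Delta> a b" "cle \<Phi> \<Delta> b c"
    and r: "wrank \<Delta> b = Suc (wrank \<Delta> a)" "wrank \<Delta> c = Suc (wrank \<Delta> b)"
    and J: "J \<in> Ifam" and t: "edge t b c" and p: "proj (P J) b = proj (P J) c" "proj (P J) a \<noteq> proj (P J) b"
  shows "\<exists>b'\<in>lower. cle \<Phi> \<Delta> a b' \<and> cle \<Phi> \<Delta> b' c \<and> wrank \<Delta> b' = Suc (wrank \<Delta> a) \<and>
    proj (P J) b' \<noteq> proj (P J) c \<and> (proj (P J) b' = proj (P J) a \<longrightarrow> edge t a b')"
proof -
  interpret fibration \<Phi> \<Delta> h lt "lI J" using fibration_P[OF J] .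
  obtain u where u: "u \<in> weyl \<Phi>" "a = coset u Q" using E(1) by (rule lower_obtain)
  obtain w where w: "w \<in> weyl \<Phi>" "t \<in> \<Phi>" "w \<circ> sref t \<in> weyl \<Phi>" "b = coset w Q" "c = coset (w \<circ> sref t) Q"
    using t by (rule edge_obtain)
  have v: "le (u lt) (w lt)" "le (w lt) (w (sref t lt))" "rk (w lt) = Suc (rk (u lt))"
    "rk (w (sref t lt)) = Suc (rk (w lt))"
    using l r cle_Q[OF u(1) w(1)] cle_Q[OF w(1,3)] wrank_Q[OF u(1)] wrank_Q[OF w(1)] wrank_Q[OF w(3)]
    unfolding u(2) w(4,5) by simp_all
  have pv: "w (sref t (lI J)) = w (lI J)" "u (lI J) \<noteq> w (lI J)"
    using p proj_P_eq_iff[OF J w(1,3)] proj_P_eq_iff[OF J u(1) w(1)] unfolding u(2) w(4,5) by auto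
  obtain b' q where b': "le (u lt) b'" "le b' (w (sref t lt))" "rk b' = Suc (rk (u lt))" "orb b' q"
    "q \<noteq> w (lI J)" "q = u (lI J) \<longrightarrow> (\<exists>w'\<in>weyl \<Phi>. u lt = w' lt \<and> b' = w' (sref t lt))"
    using swap_down_vec[OF orb_weyl[OF u(1)] v(1,3,2,4) w(1,2) refl refl pv] by blast
  obtain x where x: "x \<in> weyl \<Phi>" "b' = x lt" "q = x (lI J)" using b'(4) unfolding orb_def by blast
  have l': "cle \<Phi> \<Delta> a (coset x Q)" "cle \<Phi> \<Delta> (coset x Q) c" "wrank \<Delta> (coset x Q) = Suc (wrank \<Delta> a)"
    using b'(1-3) x cle_Q[OF u(1) x(1)] cle_Q[OF x(1) w(3)] wrank_Q[OF u(1)] wrank_Q[OF x(1)]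
    unfolding u(2) w(4,5) by simp_all
  moreover have "coset x Q \<in> lower" using lower_le[OF E(3) coset_in_quot[OF x(1)] l'(2)] .
  moreover have "proj (P J) (coset x Q) \<noteq> proj (P J) c"
    using b'(5) x(3) pv(1) proj_P_eq_iff[OF J x(1) w(3)] unfolding w(5) by simp
  moreover have "edge t a (coset x Q)" if "proj (P J) (coset x Q) = proj (P J) a"
  proof -
    have q: "q = u (lI J)" using that x(3) proj_P_eq_iff[OF J x(1) u(1)] unfolding u(2) by simp
    obtain w' where w': "w' \<in> weyl \<Phi>" "u lt = w' lt" "x lt = w' (sref t lt)"
      using mp[OF b'(6) q] unfolding x(2) by blast
    have s: "w' \<circ> sref t \<in> weyl \<Phi>" using weyl_comp[OF w'(1) sref_in_weyl[OF w(2)]] .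
    have "a = coset w' Q" "coset x Q = coset (w' \<circ> sref t) Q"
      using w'(2,3) coset_Q_eq[OF u(1) w'(1)] coset_Q_eq[OF x(1) s] u(2) by simp_all
    then show ?thesis using w'(1) w(2) unfolding edge_def by blast
  qed
  ultimately show ?thesis by blast
qed

lemma swap_up_coset:
  assumes E: "a \<in> lower" "b \<in> lower" "c \<in> lower" and l: "cle \<Phi> \<Delta> a b" "cle \<Phi> \<Delta> b c"
    and r: "wrank \<Delta> b = Suc (wrank \<Delta> a)" "wrank \<Delta> c = Suc (wrank \<Delta> b)"
    and J: "J \<in> Ifam" and t: "edge t a b" and p: "proj (P J) a = proj (P J) b" "proj (P J) b \<noteq> proj (P J) c"
  shows "\<exists>b'\<in>lower. cle \<Phi> \<Delta> a b' \<and> cle \<Phi> \<Delta> b' c \<and> wrank \<Delta> b' = Suc (wrank \<Delta> a) \<and>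
    proj (P J) b' \<noteq> proj (P J) a \<and> (proj (P J) b' = proj (P J) c \<longrightarrow> edge t b' c)"
proof -
  interpret fibration \<Phi> \<Delta> h lt "lI J" using fibration_P[OF J] .
  obtain u where u: "u \<in> weyl \<Phi>" "c = coset u Q" using E(3) by (rule lower_obtain)
  obtain w where w: "w \<in> weyl \<Phi>" "t \<in> \<Phi>" "w \<circ> sref t \<in> weyl \<Phi>" "a = coset w Q" "b = coset (w \<circ> sref t) Q"
    using t by (rule edge_obtain)
  have v: "le (w lt) (w (sref t lt))" "rk (w (sref t lt)) = Suc (rk (w lt))"
    "le (w (sref t lt)) (u lt)" "rk (u lt) = Suc (rk (w (sref t lt)))"
    using l r cle_Q[OF w(3) u(1)] cle_Q[OF w(1,3)] wrank_Q[OF u(1)] wrank_Q[OF w(1)] wrank_Q[OF w(3)]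
    unfolding u(2) w(4,5) by simp_all
  have pv: "w (sref t (lI J)) = w (lI J)" "u (lI J) \<noteq> w (lI J)"
    using p proj_P_eq_iff[OF J w(1,3)] proj_P_eq_iff[OF J w(1) u(1)] unfolding u(2) w(4,5) by auto
  obtain b' q where b': "le (w lt) b'" "le b' (u lt)" "rk b' = Suc (rk (w lt))" "orb b' q"
    "q \<noteq> w (lI J)" "q = u (lI J) \<longrightarrow> (\<exists>w'\<in>weyl \<Phi>. b' = w' lt \<and> u lt = w' (sref t lt))"
    using swap_up_vec[OF v orb_weyl[OF u(1)] w(1,2) refl refl pv] by blast
  obtain x where x: "x \<in> weyl \<Phi>" "b' = x lt" "q = x (lI J)" using b'(4) unfolding orb_def by blast
  have l': "cle \<Phi> \<Delta> a (coset x Q)" "cle \<Phi> \<Delta> (coset x Q) c" "wrank \<Delta> (coset x Q) = Suc (wrank \<Delta> a)"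
    using b'(1-3) x cle_Q[OF w(1) x(1)] cle_Q[OF x(1) u(1)] wrank_Q[OF w(1)] wrank_Q[OF x(1)]
    unfolding u(2) w(4,5) by simp_all
  moreover have "coset x Q \<in> lower" using lower_le[OF E(3) coset_in_quot[OF x(1)] l'(2)] .
  moreover have "proj (P J) (coset x Q) \<noteq> proj (P J) a"
    using b'(5) x(3) proj_P_eq_iff[OF J x(1) w(1)] unfolding w(4) by simp
  moreover have "edge t (coset x Q) c" if "proj (P J) (coset x Q) = proj (P J) c"
  proof -
    have q: "q = u (lI J)" using that x(3) proj_P_eq_iff[OF J x(1) u(1)] unfolding u(2) by simp
    obtain w' where w': "w' \<in> weyl \<Phi>" "x lt = w' lt" "u lt = w' (sref t lt)"
      using mp[OF b'(6) q] unfolding x(2) by blast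
    have s: "w' \<circ> sref t \<in> weyl \<Phi>" using weyl_comp[OF w'(1) sref_in_weyl[OF w(2)]] .
    have "coset x Q = coset w' Q" "c = coset (w' \<circ> sref t) Q"
      using w'(2,3) coset_Q_eq[OF x(1) w'(1)] coset_Q_eq[OF u(1) s] u(2) by simp_all
    then show ?thesis using w'(1) w(2) unfolding edge_def by blast
  qed
  ultimately show ?thesis by blast
qed

lemma cover_unique_coset:
  assumes E: "a \<in> lower" "b \<in> lower" "b' \<in> lower" and l: "cle \<Phi> \<Delta> a b" "cle \<Phi> \<Delta> a b'"
    and r: "wrank \<Delta> b = Suc (wrank \<Delta> a)" "wrank \<Delta> b' = Suc (wrank \<Delta> a)"
    and J: "J \<in> Ifam" and p: "proj (P J) b = proj (P J) b'" "proj (P J) b \<noteq> proj (P J) a"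
  shows "b = b'"
proof -
  interpret fibration \<Phi> \<Delta> h lt "lI J" using fibration_P[OF J] .
  obtain u v w where w: "u \<in> weyl \<Phi>" "v \<in> weyl \<Phi>" "w \<in> weyl \<Phi>"
    "a = coset u Q" "b = coset v Q" "b' = coset w Q"
    using lower_obtain[OF E(1)] lower_obtain[OF E(2)] lower_obtain[OF E(3)] by metis
  have "le (u lt) (v lt)" "le (u lt) (w lt)" "rk (v lt) = Suc (rk (u lt))" "rk (w lt) = Suc (rk (u lt))"
    using l r cle_Q[OF w(1,2)] cle_Q[OF w(1,3)] wrank_Q[OF w(1)] wrank_Q[OF w(2)] wrank_Q[OF w(3)]
    unfolding w(4-6) by simp_all
  moreover have "v (lI J) = w (lI J)" "v (lI J) \<noteq> u (lI J)"
    using p proj_P_eq_iff[OF J w(2,3)] proj_P_eq_iff[OF J w(2,1)] unfolding w(4-6) by auto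
  ultimately have "v lt = w lt"
    using cover_unique_vec[OF orb_weyl[OF w(1)], of "v lt" "w lt" "v (lI J)"]
      orb_weyl[OF w(2)] orb_weyl[OF w(3)] by simp
  then show ?thesis using coset_Q_eq[OF w(2,3)] w(5,6) by simp
qed

text \<open>The projection is monotone and the order on the target orbit is antisymmetric.\<close>

lemma proj_convex_coset:
  assumes E: "a \<in> lower" "b \<in> lower" "c \<in> lower" and l: "cle \<Phi> \<Delta> a b" "cle \<Phi> \<Delta> b c"
    and J: "J \<in> Ifam" and p: "proj (P J) a = proj (P J) c"
  shows "proj (P J) b = proj (P J) a"
proof -
  interpret fibration \<Phi> \<Delta> h lt "lI J" using fibration_P[OF J] .
  obtain u v w where w: "u \<in> weyl \<Phi>" "v \<in> weyl \<Phi>" "w \<in> weyl \<Phi>"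
    "a = coset u Q" "b = coset v Q" "c = coset w Q"
    using lower_obtain[OF E(1)] lower_obtain[OF E(2)] lower_obtain[OF E(3)] by metis
  have "le (u lt) (v lt)" "le (v lt) (w lt)"
    using l cle_Q[OF w(1,2)] cle_Q[OF w(2,3)] unfolding w(4-6) by simp_all
  then have "le (u (lI J)) (v (lI J))" "le (v (lI J)) (w (lI J))"
    using le_orb[of "u lt" "v lt"] le_orb[of "v lt" "w lt"] orb_fun orb_weyl[OF w(1)] orb_weyl[OF w(2)]
      orb_weyl[OF w(3)] by metis+
  moreover have "u (lI J) = w (lI J)" using p proj_P_eq_iff[OF J w(1,3)] w by simp
  ultimately have "v (lI J) = u (lI J)" using le_antisym by metis
  then show ?thesis using proj_P_eq_iff[OF J w(2,1)] w by simp
qed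

lemma between_coset:
  assumes "a \<in> lower" "b \<in> lower" "cle \<Phi> \<Delta> a b" "Suc (wrank \<Delta> a) < wrank \<Delta> b"
  shows "\<exists>c\<in>lower. cle \<Phi> \<Delta> a c \<and> cle \<Phi> \<Delta> c b \<and> wrank \<Delta> a < wrank \<Delta> c \<and> wrank \<Delta> c < wrank \<Delta> b"
proof -
  obtain u v where w: "u \<in> weyl \<Phi>" "v \<in> weyl \<Phi>" "a = coset u Q" "b = coset v Q"
    using lower_obtain[OF assms(1)] lower_obtain[OF assms(2)] by metis
  obtain z where z: "le (u lt) z" "le z (v lt)" "rk (u lt) < rk z" "rk z < rk (v lt)"
    using le_between[of "u lt" "v lt"] assms(3,4) w by (auto simp: cle_Q wrank_Q)
  obtain x where x: "x \<in> weyl \<Phi>" "z = x lt" using cle_vec[OF w(1) z(1)] by blast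
  have "cle \<Phi> \<Delta> (coset x Q) b" using z x w by (simp add: cle_Q)
  moreover have "coset x Q \<in> lower"
    using lower_le[OF assms(2) coset_in_quot[OF x(1)] calculation] .
  ultimately show ?thesis using z x w by (intro bexI[of _ "coset x Q"]) (simp_all add: cle_Q wrank_Q)
qed

lemma edge_exists:
  assumes "a \<in> lower" "b \<in> lower" "cle \<Phi> \<Delta> a b" "wrank \<Delta> b = Suc (wrank \<Delta> a)"
  shows "\<exists>t. edge t a b"
proof -
  obtain u v where w: "u \<in> weyl \<Phi>" "v \<in> weyl \<Phi>" "a = coset u Q" "b = coset v Q"
    using lower_obtain[OF assms(1)] lower_obtain[OF assms(2)] by metis
  have "step (u lt) (v lt)" using cover_step assms(3,4) w by (simp add: cle_Q wrank_Q)
  then obtain \<beta> where \<beta>: "\<beta> \<in> pos" "v lt = sref \<beta> (u lt)" by (auto simp: step_def)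
  \<comment> \<open>Moves the left reflection in \<beta> to the right of \<open>u\<close>.\<close>
  define t where "t = inv u \<beta>"
  have t: "t \<in> \<Phi>" "u t = \<beta>"
    using weyl_root[OF weyl_inv[OF w(1)] pos_root[OF \<beta>(1)]] w(1) by (simp_all add: t_def)
  have "u \<circ> sref t \<in> weyl \<Phi>" using weyl_comp[OF w(1) sref_in_weyl[OF t(1)]] .
  moreover have "(u \<circ> sref t) lt = v lt" using \<beta>(2) t(2) weyl_sref[OF w(1)] by simp
  ultimately have "b = coset (u \<circ> sref t) Q" using coset_Q_eq w(2,4) by metis
  then show ?thesis using w t unfolding edge_def by blast
qed

lemma edge_proj:
  assumes "edge t a b" "J \<in> Ifam"
  shows "proj (P J) a = proj (P J) b \<longleftrightarrow> sref t (lI J) = lI J"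
proof -
  obtain w where w: "w \<in> weyl \<Phi>" "w \<circ> sref t \<in> weyl \<Phi>" "a = coset w Q" "b = coset (w \<circ> sref t) Q"
    using edge_obtain[OF assms(1)] by blast
  have "w (lI J) = w (sref t (lI J)) \<longleftrightarrow> lI J = sref t (lI J)"
    using weyl_inv_cancel(2)[OF w(1)] by metis
  then show ?thesis using proj_P_eq_iff[OF assms(2) w(1,2)] w(3,4) by auto
qed

text \<open>A root orthogonal to \<lambda>_J is orthogonal to each of its dominant summands; the
  sets \<open>uline Ifam J\<close> cover [m], so \<open>t\<close> is orthogonal to
  \<lambda>.\<close>

lemma edge_trivial:
  assumes "edge t a b" "C \<subseteq> Ifam" "(\<Union>J\<in>C. uline Ifam J) = {1..m}" "\<forall>J\<in>C. sref t (lI J) = lI J"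
  shows "a = b"
proof -
  obtain w where w: "w \<in> weyl \<Phi>" "t \<in> \<Phi>" "w \<circ> sref t \<in> weyl \<Phi>" "a = coset w Q" "b = coset (w \<circ> sref t) Q"
    using edge_obtain[OF assms(1)] by blast
  have tz: "t \<noteq> 0" using w(2) zero_notin by auto
  have "lam i \<bullet> t = 0" if "i \<in> {1..m}" for i
  proof -
    obtain J where J: "J \<in> C" "i \<in> uline Ifam J" using assms(3) \<open>i \<in> {1..m}\<close> by blast
    have s: "uline Ifam J \<subseteq> {1..m}" using uline_subset assms(2) J(1) by blast
    have "lI J \<bullet> t = 0" using assms(4) J(1) sref_eq_iff[OF tz] by blast
    then show ?thesis
      using dom_sum_orthogonal[of "uline Ifam J" lam t i] finite_subset[OF s] dom_lam s w(2) J(2)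
      unfolding lsum_def by blast
  qed
  then have "lt \<bullet> t = 0" by (simp add: lt_def lsum_def inner_sum_left)
  then have "w (sref t lt) = w lt" by (simp add: sref_fix)
  then show ?thesis using coset_Q_eq[OF w(1,3)] w(4,5) by simp
qed

sublocale chains: collapse lower "cle \<Phi> \<Delta>" "wrank \<Delta>" "coset id Q" \<tau> Ifam m "\<lambda>J. proj (P J)"
  edge "\<lambda>t J. sref t (lI J) = lI J"
proof
  show "finite Ifam"
    using finite_subset[of Ifam "Pow {1..m}"] index_family by (auto simp: index_family_def)
  show "J \<noteq> {} \<and> J \<subseteq> {1..m}" if "J \<in> Ifam" for J
    using that index_family by (auto simp: index_family_def)
  have bot: "cle \<Phi> \<Delta> (coset id Q) A" if A: "A \<in> quot \<Phi> Q" for A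
  proof -
    obtain w where "w \<in> weyl \<Phi>" "A = coset w Q" using A by (rule quot_obtain)
    then show ?thesis using cle_Q[OF weyl.weyl_id] dom_le[OF _ dom_lt] by simp
  qed
  show "coset id Q \<in> lower" using bot tau coset_in_quot[OF weyl.weyl_id] by (simp add: lower_def)
  show "cle \<Phi> \<Delta> (coset id Q) A" if "A \<in> lower" for A using bot lower_D(1)[OF that] .
  show "wrank \<Delta> (coset id Q) = 0"
    using wrank_Q[OF weyl.weyl_id] rk_eq_0_iff[of lt] dom_lt by simp
  show "\<tau> \<in> lower" using tau cle_refl by (simp add: lower_def)
  show "cle \<Phi> \<Delta> a c" if "a \<in> lower" "b \<in> lower" "c \<in> lower" "cle \<Phi> \<Delta> a b" "cle \<Phi> \<Delta> b c" for a b c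
    using cle_trans that lower_D(1) by blast
  show "wrank \<Delta> a < wrank \<Delta> b" if ab: "a \<in> lower" "b \<in> lower" "cle \<Phi> \<Delta> a b" "a \<noteq> b" for a b
  proof -
    obtain u v where w: "u \<in> weyl \<Phi>" "v \<in> weyl \<Phi>" "a = coset u Q" "b = coset v Q"
      using lower_obtain[OF ab(1)] lower_obtain[OF ab(2)] by metis
    then show ?thesis using rk_less[of "u lt" "v lt"] ab(3,4) by (simp add: cle_Q wrank_Q coset_Q_eq)
  qed
qed (fact m_pos cle_refl[OF lower_D(1)] lower_D(2) between_coset proj_convex_coset edge_exists edge_proj
      edge_trivial swap_down_coset swap_up_coset cover_unique_coset index_family_top[OF index_family m_pos]
      index_family_between[OF index_family m_pos] index_family_below[OF index_family m_pos])+

section \<open>Parabolic subgroups containing W_Q and their lifts\<close>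

definition parabolic :: "('v \<Rightarrow> 'v) set \<Rightarrow> bool" where
  "parabolic H \<longleftrightarrow> (\<exists>n. H = stab \<Phi> n \<and> fibration \<Phi> \<Delta> h lt n)"

text \<open>Phrased through the subgroup and not through a vector with that stabilizer, so that
  intersections of parabolic subgroups can be compared directly.\<close>

definition lift_min :: "('v \<Rightarrow> 'v) set \<Rightarrow> ('v \<Rightarrow> 'v) set \<Rightarrow> bool" where
  "lift_min H A \<longleftrightarrow> A \<in> quot \<Phi> Q \<and> (\<forall>B\<in>quot \<Phi> Q. proj H B = proj H A \<longrightarrow> cle \<Phi> \<Delta> A B)"

definition lift_max :: "('v \<Rightarrow> 'v) set \<Rightarrow> ('v \<Rightarrow> 'v) set \<Rightarrow> bool" where
  "lift_max H A \<longleftrightarrow> A \<in> quot \<Phi> Q \<and> (\<forall>B\<in>quot \<Phi> Q. proj H B = proj H A \<longrightarrow> cle \<Phi> \<Delta> B A)"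

lemma parabolic_P: "J \<in> Ifam \<Longrightarrow> parabolic (P J)"
  unfolding parabolic_def using P_stab fibration_P by blast

lemma parabolic_Int:
  assumes "parabolic H" "parabolic H'"
  shows "parabolic (H \<inter> H')"
proof -
  obtain n where n: "H = stab \<Phi> n" "fibration \<Phi> \<Delta> h lt n" using assms(1) by (auto simp: parabolic_def)
  obtain n' where n': "H' = stab \<Phi> n'" "fibration \<Phi> \<Delta> h lt n'" using assms(2) by (auto simp: parabolic_def)
  have d: "dom n" "dom n'" using fibration.dom_n n(2) n'(2) by blast+
  have s: "stab \<Phi> lt \<subseteq> stab \<Phi> n" "stab \<Phi> lt \<subseteq> stab \<Phi> n'" using fibration.stab_le n(2) n'(2) by blast+
  \<comment> \<open>Indexing by Booleans keeps two summands even if \<open>n = n'\<close>.\<close>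
  have "w (n + n') = n + n' \<longleftrightarrow> w n = n \<and> w n' = n'" if "w \<in> weyl \<Phi>" for w
    using dom_sum_fix[of "{False, True}" "\<lambda>i. if i then n else n'" w] d that by (auto simp: add.commute)
  then have st: "stab \<Phi> (n + n') = H \<inter> H'" using n(1) n'(1) by (auto simp: stab_def)
  have "dom (n + n')" using d by (auto simp: dom_def inner_add_left)
  then have "fibration \<Phi> \<Delta> h lt (n + n')"
    using st s n(1) n'(1) dom_lt by unfold_locales auto
  then show ?thesis using st unfolding parabolic_def by blast
qed

lemma parabolic_INT:
  "finite R \<Longrightarrow> R \<noteq> {} \<Longrightarrow> (\<And>r. r \<in> R \<Longrightarrow> parabolic (H r)) \<Longrightarrow> parabolic (\<Inter>r\<in>R. H r)"
proof (induction R rule: finite_ne_induct)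
  case (insert r R)
  then have "parabolic (H r \<inter> (\<Inter>r\<in>R. H r))" by (intro parabolic_Int) auto
  then show ?case by simp
qed simp

text \<open>Needed for Q_\<tau>, which is given by a set of simple roots: a vector pairing to zero
  with exactly these simple roots has it as stabilizer.\<close>

lemma parabolic_weyl:
  assumes "J \<subseteq> \<Delta>" "Q \<subseteq> weyl J"
  shows "parabolic (weyl J)"
proof -
  obtain n where n: "\<And>a. a \<in> \<Delta> \<Longrightarrow> a \<bullet> n = (if a \<in> J then 0 else 1)"
    using independent_inner_extend[OF independent_simple, of "\<lambda>a. if a \<in> J then 0 else 1"] by blast
  have eq: "weyl J = stab \<Phi> n" using parabolic_eq_stab[OF assms(1) n] .
  have "dom n" by (auto simp: dom_simple inner_commute[of n] n)
  moreover have "stab \<Phi> lt \<subseteq> stab \<Phi> n" using assms(2) eq Q_stab by simp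
  ultimately have "fibration \<Phi> \<Delta> h lt n" using dom_lt by unfold_locales auto
  then show ?thesis using eq unfolding parabolic_def by blast
qed

lemma parabolic_lift_min:
  assumes "parabolic H"
  obtains n where "H = stab \<Phi> n" "fibration \<Phi> \<Delta> h lt n"
    "\<And>A. lift_min H A \<longleftrightarrow> fibration.fibre_least \<Phi> \<Delta> lt n A"
proof -
  obtain n where n: "H = stab \<Phi> n" "fibration \<Phi> \<Delta> h lt n" using assms by (auto simp: parabolic_def)
  show thesis
    by (rule that[OF n]) (simp only: lift_min_def fibration.fibre_least_def[OF n(2)] Q_stab n(1))
qed

lemma is_pmin_iff_lift_min:
  assumes "parabolic H"
  shows "is_pmin \<Phi> \<Delta> Q H A \<longleftrightarrow> lift_min H A"
proof -
  obtain n where n: "H = stab \<Phi> n" "fibration \<Phi> \<Delta> h lt n"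
    "\<And>A. lift_min H A \<longleftrightarrow> fibration.fibre_least \<Phi> \<Delta> lt n A"
    using parabolic_lift_min[OF assms] by blast
  show ?thesis unfolding n(3) unfolding n(1) Q_stab by (rule fibration.is_pmin_iff[OF n(2)])
qed

lemma parabolic_lift_max:
  assumes "parabolic H"
  obtains n where "H = stab \<Phi> n" "fibration \<Phi> \<Delta> h lt n"
    "\<And>A. lift_max H A \<longleftrightarrow> fibration.fibre_greatest \<Phi> \<Delta> lt n A"
proof -
  obtain n where n: "H = stab \<Phi> n" "fibration \<Phi> \<Delta> h lt n" using assms by (auto simp: parabolic_def)
  show thesis
    by (rule that[OF n]) (simp only: lift_max_def fibration.fibre_greatest_def[OF n(2)] Q_stab n(1))
qed

lemma is_pmax_iff_lift_max:
  assumes "parabolic H"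
  shows "is_pmax \<Phi> \<Delta> Q H A \<longleftrightarrow> lift_max H A"
proof -
  obtain n where n: "H = stab \<Phi> n" "fibration \<Phi> \<Delta> h lt n"
    "\<And>A. lift_max H A \<longleftrightarrow> fibration.fibre_greatest \<Phi> \<Delta> lt n A"
    using parabolic_lift_max[OF assms] by blast
  show ?thesis unfolding n(3) unfolding n(1) Q_stab by (rule fibration.is_pmax_iff[OF n(2)])
qed

lemma ex_lift_min:
  assumes "parabolic H" "A \<in> quot \<Phi> Q"
  shows "\<exists>M. lift_min H M \<and> proj H M = proj H A"
proof -
  obtain n where n: "H = stab \<Phi> n" "fibration \<Phi> \<Delta> h lt n"
    "\<And>A. lift_min H A \<longleftrightarrow> fibration.fibre_least \<Phi> \<Delta> lt n A"
    using parabolic_lift_min[OF assms(1)] by blast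
  show ?thesis unfolding n(3) unfolding n(1)
    by (rule fibration.ex_fibre_least[OF n(2) fibration.proj_in_quot[OF n(2) assms(2)[unfolded Q_stab]]])
qed

lemma ex_lift_max:
  assumes "parabolic H" "A \<in> quot \<Phi> Q"
  shows "\<exists>M. lift_max H M \<and> proj H M = proj H A"
proof -
  obtain n where n: "H = stab \<Phi> n" "fibration \<Phi> \<Delta> h lt n"
    "\<And>A. lift_max H A \<longleftrightarrow> fibration.fibre_greatest \<Phi> \<Delta> lt n A"
    using parabolic_lift_max[OF assms(1)] by blast
  show ?thesis unfolding n(3) unfolding n(1)
    by (rule fibration.ex_fibre_greatest[OF n(2) fibration.proj_in_quot[OF n(2) assms(2)[unfolded Q_stab]]])
qed

lemma lift_min_mono:
  assumes "parabolic H" "lift_min H A" "lift_min H M" "B \<in> quot \<Phi> Q" "proj H M = proj H B" "cle \<Phi> \<Delta> A B"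
  shows "cle \<Phi> \<Delta> A M"
proof -
  obtain n where n: "H = stab \<Phi> n" "fibration \<Phi> \<Delta> h lt n"
    "\<And>A. lift_min H A \<longleftrightarrow> fibration.fibre_least \<Phi> \<Delta> lt n A"
    using parabolic_lift_min[OF assms(1)] by blast
  show ?thesis
    by (rule fibration.fibre_least_mono[OF n(2) assms(2)[unfolded n(3)] assms(3)[unfolded n(3)]
      assms(4)[unfolded Q_stab] assms(5)[unfolded n(1)] assms(6)])
qed

lemma lift_max_mono:
  assumes "parabolic H" "lift_max H A" "lift_max H M" "B \<in> quot \<Phi> Q" "proj H M = proj H B" "cle \<Phi> \<Delta> B A"
  shows "cle \<Phi> \<Delta> M A"
proof -
  obtain n where n: "H = stab \<Phi> n" "fibration \<Phi> \<Delta> h lt n"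
    "\<And>A. lift_max H A \<longleftrightarrow> fibration.fibre_greatest \<Phi> \<Delta> lt n A"
    using parabolic_lift_max[OF assms(1)] by blast
  show ?thesis
    by (rule fibration.fibre_greatest_mono[OF n(2) assms(2)[unfolded n(3)] assms(3)[unfolded n(3)]
      assms(4)[unfolded Q_stab] assms(5)[unfolded n(1)] assms(6)])
qed

lemma projI: "a \<in> A \<Longrightarrow> k \<in> H \<Longrightarrow> a \<circ> k \<in> proj H A"
  unfolding proj_def by (rule image_eqI[of _ _ "(a, k)"]) auto

lemma subset_proj: "id \<in> H \<Longrightarrow> A \<subseteq> proj H A"
  using projI[of _ A id H] by auto

lemma proj_proj:
  assumes "parabolic H" "parabolic H'" "H \<subseteq> H'"
  shows "proj H' (proj H A) = proj H' A"
proof (intro equalityI subsetI)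
  fix f assume "f \<in> proj H' (proj H A)"
  then obtain a k k' where f: "a \<in> A" "k \<in> H" "k' \<in> H'" "f = a \<circ> k \<circ> k'" by (auto simp: proj_def)
  have "k \<circ> k' \<in> H'"
    using f(2,3) assms weyl_comp[of k \<Phi> k'] by (auto simp: parabolic_def stab_def)
  then show "f \<in> proj H' A" using projI[OF f(1)] f(4) by (simp only: comp_assoc)
next
  fix f assume "f \<in> proj H' A"
  then obtain a k where f: "a \<in> A" "k \<in> H'" "f = a \<circ> k" by (auto simp: proj_def)
  have "id \<in> H" using assms(1) weyl.weyl_id by (auto simp: parabolic_def stab_def)
  then have "a \<in> proj H A" using subset_proj f(1) by blast
  then show "f \<in> proj H' (proj H A)" unfolding f(3) using f(2) by (rule projI)
qed

lemma proj_coarser: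
  "parabolic H \<Longrightarrow> parabolic H' \<Longrightarrow> H \<subseteq> H' \<Longrightarrow> proj H A = proj H B \<Longrightarrow> proj H' A = proj H' B"
  using proj_proj[of H H' A] proj_proj[of H H' B] by simp

text \<open>A smaller subgroup has smaller fibres, so minimality in a fibre is inherited.\<close>

lemma lift_min_finer:
  "parabolic H \<Longrightarrow> parabolic H' \<Longrightarrow> H \<subseteq> H' \<Longrightarrow> lift_min H' A \<Longrightarrow> lift_min H A"
  unfolding lift_min_def using proj_coarser by blast

lemma lift_max_finer:
  "parabolic H \<Longrightarrow> parabolic H' \<Longrightarrow> H \<subseteq> H' \<Longrightarrow> lift_max H' A \<Longrightarrow> lift_max H A"
  unfolding lift_max_def using proj_coarser by blast

lemma BW_eq: "BW \<Phi> \<Delta> Q Ifam \<tau> = chains.X"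
  unfolding BW_def chains.X_def unfolding lower_def by auto

lemma bchain_iff: "bchain \<Phi> \<Delta> Q Ifam \<tau> l th I \<longleftrightarrow> chains.ch l (\<lambda>k. (th k, I k))"
proof -
  have "(th (Suc k), I (Suc k)) \<noteq> (th k, I k) \<longleftrightarrow> (th k, I k) \<noteq> (th (Suc k), I (Suc k))" for k
    by (rule arg_cong[OF eq_commute])
  then show ?thesis
    unfolding bchain_def chains.ch_def BW_eq bge_def chains.leX_def by simp
qed

lemma chain_elems_eq: "chain_elems l th I = (\<lambda>k. (th k, I k)) ` {..l}"
  by (auto simp: chain_elems_def)

lemma pi_eq: "chains.pi x = (proj (P (snd x)) (fst x), snd x)"
  by (rule chains.pi_def)

text \<open>The minimal lift over \<open>B\<close> is below \<open>B\<close>, which is below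
  \<open>A\<close>, which is below the maximal lift over \<open>A\<close>. So comparable pairs
  project to generating relations, without the transitive closure.\<close>

lemma uR_proj:
  assumes "A \<in> quot \<Phi> Q" "B \<in> quot \<Phi> Q" "J \<in> Ifam" "K \<in> Ifam" "K \<subseteq> J" "cle \<Phi> \<Delta> B A"
  shows "uR \<Phi> \<Delta> Q P (proj (P J) A, J) (proj (P K) B, K)"
proof -
  interpret K: fibration \<Phi> \<Delta> h lt "lI K" using fibration_P[OF assms(4)] .
  interpret J: fibration \<Phi> \<Delta> h lt "lI J" using fibration_P[OF assms(3)] .
  have "K.fibre_least M" if "lift_min (P K) M" for M
    using that unfolding K.fibre_least_def lift_min_def Q_stab P_stab .
  then obtain M where M: "lift_min (P K) M" "proj (P K) M = proj (P K) B" "pmin \<Phi> \<Delta> Q (P K) (proj (P K) M) = M"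
    using ex_lift_min[OF parabolic_P[OF assms(4)] assms(2)] K.pmin_eq unfolding Q_stab P_stab by blast
  have "J.fibre_greatest M" if "lift_max (P J) M" for M
    using that unfolding J.fibre_greatest_def lift_max_def Q_stab P_stab .
  then obtain M' where M': "lift_max (P J) M'" "proj (P J) M' = proj (P J) A" "pmax \<Phi> \<Delta> Q (P J) (proj (P J) M') = M'"
    using ex_lift_max[OF parabolic_P[OF assms(3)] assms(1)] J.pmax_eq unfolding Q_stab P_stab by blast
  have "cle \<Phi> \<Delta> M B" "cle \<Phi> \<Delta> A M'" "M \<in> quot \<Phi> Q" "M' \<in> quot \<Phi> Q"
    using M(1,2) M'(1,2) assms(1,2) by (auto simp: lift_min_def lift_max_def)
  then have "cle \<Phi> \<Delta> M M'" using cle_trans assms(1,2,6) by blast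
  then show ?thesis using M M' assms(5) by (simp add: uR_def)
qed

lemma proj_in_UW: "x \<in> chains.X \<Longrightarrow> chains.pi x \<in> UW \<Phi> \<Delta> P Ifam \<tau>"
proof -
  assume "x \<in> chains.X"
  then have x: "fst x \<in> lower" "snd x \<in> Ifam" by (auto simp: chains.X_def)
  have "id \<in> P (snd x)" using weyl.weyl_id by (auto simp: P_stab stab_def)
  then have sub: "A \<subseteq> proj (P (snd x)) A" for A by (rule subset_proj)
  have "cle \<Phi> \<Delta> (proj (P (snd x)) (fst x)) (proj (P (snd x)) \<tau>)"
    using lower_D(2)[OF x(1)] sub unfolding cle_def by blast
  moreover have "proj (P (snd x)) (fst x) \<in> quot \<Phi> (P (snd x))"
    using fibration.proj_in_quot[OF fibration_P[OF x(2)]] lower_D(1)[OF x(1)] by (simp add: Q_stab P_stab)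
  ultimately show ?thesis using x(2) by (simp add: UW_def pi_eq)
qed

text \<open>The chain itself is a defining chain of its projection; absence of collapsed edges keeps
  the projected elements distinct.\<close>

lemma tau_standard_ch:
  assumes x: "chains.ch l x" and c: "\<And>k. k < l \<Longrightarrow> chains.pi (x k) \<noteq> chains.pi (x (Suc k))"
  shows "tau_standard \<Phi> \<Delta> Q P Ifam \<tau> l (\<lambda>k. fst (chains.pi (x k))) (\<lambda>k. snd (x k))"
proof -
  have X: "x k \<in> chains.X" if "k \<le> l" for k using x that by (simp add: chains.ch_def)
  have pair: "(fst (chains.pi (x k)), snd (x k)) = chains.pi (x k)" for k by (simp add: pi_eq)
  have "uge \<Phi> \<Delta> Q P Ifam \<tau> (chains.pi (x (Suc k))) (chains.pi (x k))" if k: "k < l" for k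
    unfolding uge_def
  proof (rule tranclp.r_into_trancl, intro conjI)
    show "chains.pi (x (Suc k)) \<in> UW \<Phi> \<Delta> P Ifam \<tau>" "chains.pi (x k) \<in> UW \<Phi> \<Delta> P Ifam \<tau>"
      using proj_in_UW X k by simp_all
    have "fst (x (Suc k)) \<in> quot \<Phi> Q" "fst (x k) \<in> quot \<Phi> Q" "snd (x (Suc k)) \<in> Ifam" "snd (x k) \<in> Ifam"
      using chains.X_D[OF X, of "Suc k"] chains.X_D[OF X, of k] k lower_D(1) by auto
    then show "uR \<Phi> \<Delta> Q P (chains.pi (x (Suc k))) (chains.pi (x k))"
      unfolding pi_eq using x k by (intro uR_proj) (auto simp: chains.ch_def chains.leX_def)
  qed
  then have "uchain \<Phi> \<Delta> Q P Ifam \<tau> l (\<lambda>k. fst (chains.pi (x k))) (\<lambda>k. snd (x k))"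
    unfolding uchain_def pair using proj_in_UW X c by (metis)
  moreover have "defining_chain \<Phi> \<Delta> Q P Ifam \<tau> l (\<lambda>k. fst (chains.pi (x k))) (\<lambda>k. snd (x k)) (\<lambda>k. fst (x k))"
    unfolding defining_chain_def bchain_iff using x by (simp add: pi_eq)
  ultimately show ?thesis unfolding tau_standard_def by blast
qed

lemma defining_chain_iff:
  "defining_chain \<Phi> \<Delta> Q P Ifam \<tau> l th I thb \<longleftrightarrow>
    chains.ch l (\<lambda>k. (thb k, I k)) \<and> (\<forall>k\<le>l. chains.pi (thb k, I k) = (th k, I k))"
  unfolding defining_chain_def bchain_iff by (simp add: pi_eq)

lemma max_tau_standard_full:
  assumes max: "max_tau_standard \<Phi> \<Delta> Q P Ifam \<tau> l th I" and D: "defining_chain \<Phi> \<Delta> Q P Ifam \<tau> l th I thb"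
  shows "l = chains.N" "chains.full (\<lambda>k. (thb k, I k))"
    "\<And>k. k < l \<Longrightarrow> chains.pi (thb k, I k) \<noteq> chains.pi (thb (Suc k), I (Suc k))"
proof -
  let ?D = "\<lambda>k. (thb k, I k)"
  have ch: "chains.ch l ?D" and pi: "\<And>k. k \<le> l \<Longrightarrow> chains.pi (?D k) = (th k, I k)"
    using D by (auto simp: defining_chain_iff)
  have "uchain \<Phi> \<Delta> Q P Ifam \<tau> l th I" using max by (simp add: max_tau_standard_def tau_standard_def)
  then show nc: "chains.pi (?D k) \<noteq> chains.pi (?D (Suc k))" if "k < l" for k
    using pi[of k] pi[of "Suc k"] that unfolding uchain_def by (metis Suc_leI less_imp_le_nat)
  have img: "chains.pi ` ?D ` {..l} = chain_elems l th I"
    unfolding chain_elems_eq image_image using pi by (intro image_cong) auto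
  have *: "l = chains.N \<and> chains.full ?D"
  proof (rule chains.maximal_image_full[OF ch nc])
    fix x assume x: "chains.full x" and sub: "chains.pi ` ?D ` {..l} \<subseteq> chains.pi ` x ` {..chains.N}"
    \<comment> \<open>Stripped of collapsed vertices, the full chain projects to a standard chain
      with the same image, to which the maximality assumption applies.\<close>
    obtain l' y where y: "chains.ch l' y" "\<And>k. k < l' \<Longrightarrow> chains.pi (y k) \<noteq> chains.pi (y (Suc k))"
      "chains.pi ` y ` {..l'} = chains.pi ` x ` {..chains.N}"
      using chains.delete_collapsed[OF chains.full_ch[OF x]] by metis
    let ?th = "\<lambda>k. fst (chains.pi (y k))" and ?I = "\<lambda>k. snd (y k)"
    have "chain_elems l' ?th ?I = chains.pi ` y ` {..l'}"
      unfolding chain_elems_eq image_image by (simp add: pi_eq)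
    then have e: "chain_elems l' ?th ?I = chains.pi ` x ` {..chains.N}" using y(3) by (rule trans)
    have "chain_elems l th I \<subseteq> chain_elems l' ?th ?I" using sub unfolding e img .
    moreover have "tau_standard \<Phi> \<Delta> Q P Ifam \<tau> l' ?th ?I" by (rule tau_standard_ch[OF y(1,2)])
    moreover have "\<forall>l' th' I'. tau_standard \<Phi> \<Delta> Q P Ifam \<tau> l' th' I' \<and>
      chain_elems l th I \<subseteq> chain_elems l' th' I' \<longrightarrow> chain_elems l' th' I' = chain_elems l th I"
      using max unfolding max_tau_standard_def by (rule conjunct2)
    ultimately have "chain_elems l' ?th ?I = chain_elems l th I" by blast
    then show "chains.pi ` x ` {..chains.N} = chains.pi ` ?D ` {..l}" unfolding e img .
  qed
  show "l = chains.N" using * by (rule conjunct1)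
  show "chains.full ?D" using * by (rule conjunct2)
qed

lemma defining_chain_unique:
  assumes max: "max_tau_standard \<Phi> \<Delta> Q P Ifam \<tau> l th I" and D: "defining_chain \<Phi> \<Delta> Q P Ifam \<tau> l th I thb"
    and D': "defining_chain \<Phi> \<Delta> Q P Ifam \<tau> l th I thb'" and k: "k \<le> l"
  shows "thb' k = thb k"
proof -
  note f = max_tau_standard_full[OF max D] and f' = max_tau_standard_full[OF max D']
  have "(thb k, I k) = (thb' k, I k)"
    using chains.full_unique[OF f(2) f'(2), of k] f(1,3) D D' k by (simp add: defining_chain_iff)
  then show ?thesis by simp
qed

text \<open>Any other element of the same fibre that fits between the neighbours would give a second
  defining chain; distinctness of consecutive members is guaranteed by the unchanged
  projections.\<close>

lemma defining_chain_rigid: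
  assumes max: "max_tau_standard \<Phi> \<Delta> Q P Ifam \<tau> l th I" and D: "defining_chain \<Phi> \<Delta> Q P Ifam \<tau> l th I thb"
    and k: "k \<le> l" and M: "M \<in> lower" "proj (P (I k)) M = proj (P (I k)) (thb k)"
    and lo: "\<And>j. k = Suc j \<Longrightarrow> cle \<Phi> \<Delta> (thb j) M" and hi: "k < l \<Longrightarrow> cle \<Phi> \<Delta> M (thb (Suc k))"
  shows "M = thb k"
proof -
  let ?D = "\<lambda>k. (thb k, I k)" and ?D' = "\<lambda>i. ((thb(k := M)) i, I i)"
  have ch: "chains.ch l ?D" and pi: "\<And>k. k \<le> l \<Longrightarrow> chains.pi (?D k) = (th k, I k)"
    using D by (auto simp: defining_chain_iff)
  note nc = max_tau_standard_full(3)[OF max D]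
  have pi': "chains.pi (?D' i) = chains.pi (?D i)" for i using M(2) by (simp add: pi_eq)
  have "chains.ch l ?D'" unfolding chains.ch_def
  proof (intro conjI allI impI)
    fix i assume "i \<le> l"
    then show "?D' i \<in> chains.X" using ch M(1) by (auto simp: chains.ch_def chains.X_def)
  next
    fix i assume i: "i < l"
    show "?D' i \<noteq> ?D' (Suc i)" using nc[OF i] pi' by metis
    have "chains.leX (?D i) (?D (Suc i))" using ch i by (simp add: chains.ch_def)
    then show "chains.leX (?D' i) (?D' (Suc i))"
      using lo[of i] hi i by (auto simp: chains.leX_def)
  qed
  then have "defining_chain \<Phi> \<Delta> Q P Ifam \<tau> l th I (thb(k := M))"
    using pi pi' by (simp add: defining_chain_iff)
  from defining_chain_unique[OF max D this k] show ?thesis by simp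
qed

text \<open>Let \<open>M\<close> be the Q_k-minimal lift over the image of \<open>thb k\<close>. It
  stays below the upper neighbour and has the same projection to W/W_{P_{I_k}}. The lower neighbour
  is minimal for the larger group Q_{k-1}, hence for Q_k, so monotonicity of minimal lifts puts it
  below \<open>M\<close>; rigidity then gives \<open>M = thb k\<close>.\<close>

lemma defining_chain_lift_min:
  assumes max: "max_tau_standard \<Phi> \<Delta> Q P Ifam \<tau> l th I" and D: "defining_chain \<Phi> \<Delta> Q P Ifam \<tau> l th I thb"
    and k: "k \<le> l"
  shows "lift_min (\<Inter>r\<in>{0..k}. P (I r)) (thb k)"
  using k
proof (induction k rule: less_induct)
  case (less k)
  have ch: "chains.ch l (\<lambda>k. (thb k, I k))" using D by (simp add: defining_chain_iff)
  then have X: "thb j \<in> lower" "I j \<in> Ifam" if "j \<le> l" for j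
    using that by (auto simp: chains.ch_def chains.X_def)
  have up: "cle \<Phi> \<Delta> (thb j) (thb (Suc j))" if "j < l" for j
    using ch that by (simp add: chains.ch_def chains.leX_def)
  let ?H = "\<lambda>k. \<Inter>r\<in>{0..k}. P (I r)"
  have par: "parabolic (?H j)" if "j \<le> l" for j
    using that X(2) by (intro parabolic_INT parabolic_P) auto
  note tk = lower_D(1)[OF X(1)[OF less.prems]]
  obtain M where M: "lift_min (?H k) M" "proj (?H k) M = proj (?H k) (thb k)"
    using ex_lift_min[OF par[OF less.prems] tk] by blast
  have MQ: "M \<in> quot \<Phi> Q" and Mle: "cle \<Phi> \<Delta> M (thb k)"
    using M tk by (auto simp: lift_min_def)
  have "M = thb k"
  proof (rule defining_chain_rigid[OF max D less.prems])
    show "M \<in> lower" using lower_le[OF X(1)[OF less.prems] MQ Mle] .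
    have "?H k \<subseteq> P (I k)" by auto
    then show "proj (P (I k)) M = proj (P (I k)) (thb k)"
      using proj_coarser[OF par[OF less.prems] parabolic_P[OF X(2)[OF less.prems]] _ M(2)] by blast
    show "cle \<Phi> \<Delta> (thb j) M" if j: "k = Suc j" for j
    proof -
      have jl: "j \<le> l" "j < l" using j less.prems by auto
      have "?H k \<subseteq> ?H j" "j < k" using j by auto
      then have "lift_min (?H k) (thb j)"
        using lift_min_finer[OF par[OF less.prems] par[OF jl(1)] _ less.IH[OF _ jl(1)]] by blast
      then show ?thesis
        using lift_min_mono[OF par[OF less.prems] _ M(1) tk M(2)] up[OF jl(2)] j by blast
    qed
    show "cle \<Phi> \<Delta> M (thb (Suc k))" if "k < l"
      using cle_trans[OF MQ tk lower_D(1)[OF X(1)] Mle up[OF that]] that by simp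
  qed
  then show ?case using M(1) by simp
qed

text \<open>The mirror argument runs downwards from position \<open>l\<close>, where maximality for
  \<open>Qt\<close> is the starting point; the neighbour that needs monotonicity of lifts is now the
  upper one.\<close>

lemma defining_chain_lift_max:
  assumes max: "max_tau_standard \<Phi> \<Delta> Q P Ifam \<tau> l th I" and D: "defining_chain \<Phi> \<Delta> Q P Ifam \<tau> l th I thb"
    and Qt: "parabolic Qt" "lift_max Qt (thb l)" and k: "k \<le> l"
  shows "lift_max (Qt \<inter> (\<Inter>r\<in>{k..l}. P (I r))) (thb k)"
  using k
proof (induction k rule: inc_induct)
  case base
  have "I l \<in> Ifam" using D by (auto simp: defining_chain_iff chains.ch_def chains.X_def)
  then have "parabolic (Qt \<inter> (\<Inter>r\<in>{l..l}. P (I r)))"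
    using Qt(1) by (intro parabolic_Int) (auto intro: parabolic_P)
  then show ?case using lift_max_finer[OF _ Qt(1) _ Qt(2)] by blast
next
  case (step k)
  have ch: "chains.ch l (\<lambda>k. (thb k, I k))" using D by (simp add: defining_chain_iff)
  then have X: "thb j \<in> lower" "I j \<in> Ifam" if "j \<le> l" for j
    using that by (auto simp: chains.ch_def chains.X_def)
  have up: "cle \<Phi> \<Delta> (thb j) (thb (Suc j))" if "j < l" for j
    using ch that by (simp add: chains.ch_def chains.leX_def)
  let ?H = "\<lambda>k. Qt \<inter> (\<Inter>r\<in>{k..l}. P (I r))"
  have par: "parabolic (?H j)" if "j \<le> l" for j
    using that X(2) Qt(1) by (intro parabolic_Int parabolic_INT parabolic_P) auto
  have kl: "k \<le> l" "Suc k \<le> l" "k < l" using step.hyps by auto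
  note tk = lower_D(1)[OF X(1)[OF kl(1)]] and tk' = lower_D(1)[OF X(1)[OF kl(2)]]
  obtain M where M: "lift_max (?H k) M" "proj (?H k) M = proj (?H k) (thb k)"
    using ex_lift_max[OF par[OF kl(1)] tk] by blast
  have MQ: "M \<in> quot \<Phi> Q" and Mle: "cle \<Phi> \<Delta> (thb k) M"
    using M tk by (auto simp: lift_max_def)
  have "?H k \<subseteq> ?H (Suc k)" by auto
  then have "lift_max (?H k) (thb (Suc k))"
    using lift_max_finer[OF par[OF kl(1)] par[OF kl(2)] _ step.IH] by blast
  then have hi: "cle \<Phi> \<Delta> M (thb (Suc k))"
    using lift_max_mono[OF par[OF kl(1)] _ M(1) tk M(2) up[OF kl(3)]] by blast
  have "M = thb k"
  proof (rule defining_chain_rigid[OF max D kl(1)])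
    \<comment> \<open>\<open>M\<close> lies above \<open>thb k\<close>, so the bound by \<tau> has
      to come from the upper neighbour.\<close>
    show "M \<in> lower" using lower_le[OF X(1)[OF kl(2)] MQ hi] .
    have "?H k \<subseteq> P (I k)" using kl(1) by auto
    then show "proj (P (I k)) M = proj (P (I k)) (thb k)"
      using proj_coarser[OF par[OF kl(1)] parabolic_P[OF X(2)[OF kl(1)]] _ M(2)] by blast
    show "cle \<Phi> \<Delta> (thb j) M" if "k = Suc j" for j
      using cle_trans[OF lower_D(1)[OF X(1)] tk MQ _ Mle, of j] up[of j] that kl by simp
    show "cle \<Phi> \<Delta> M (thb (Suc k))" by (rule hi)
  qed
  then show ?case using M(1) by simp
qed

end

theorem mainTheorem4:
  fixes \<Phi> \<Delta> :: "'v::euclidean_space set" and lam :: "nat \<Rightarrow> 'v" and m :: nat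
    and Ifam :: "nat set set" and \<tau> Qt :: "('v \<Rightarrow> 'v) set"
    and l :: nat and th :: "nat \<Rightarrow> ('v \<Rightarrow> 'v) set" and I :: "nat \<Rightarrow> nat set"
  assumes "root_system \<Phi>" and "irreducible_rs \<Phi>" and "base \<Phi> \<Delta>"
    and "m \<ge> 1" and "\<forall>i\<in>{1..m}. dominant_weight \<Phi> \<Delta> (lam i)"
    and "index_family Ifam m"
    and "\<tau> \<in> quot \<Phi> (Qgrp \<Phi> lam m)"
    and "is_Qtau \<Phi> \<Delta> (Qgrp \<Phi> lam m) \<tau> Qt"
    and "max_tau_standard \<Phi> \<Delta> (Qgrp \<Phi> lam m) (PI \<Phi> lam Ifam) Ifam \<tau> l th I"
  shows "\<exists>thb. defining_chain \<Phi> \<Delta> (Qgrp \<Phi> lam m) (PI \<Phi> lam Ifam) Ifam \<tau> l th I thb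
      \<and> (\<forall>thb'. defining_chain \<Phi> \<Delta> (Qgrp \<Phi> lam m) (PI \<Phi> lam Ifam) Ifam \<tau> l th I thb'
                 \<longrightarrow> (\<forall>k\<le>l. thb' k = thb k))
      \<and> max_bchain \<Phi> \<Delta> (Qgrp \<Phi> lam m) Ifam \<tau> l thb I
      \<and> thb l = \<tau> \<and> I l = {1..m} \<and> thb 0 = coset id (Qgrp \<Phi> lam m)
      \<and> l = wrank \<Delta> \<tau> + m - 1
      \<and> (\<forall>k\<le>l. is_pmin \<Phi> \<Delta> (Qgrp \<Phi> lam m) (\<Inter>r\<in>{0..k}. PI \<Phi> lam Ifam (I r)) (thb k)
              \<and> is_pmax \<Phi> \<Delta> (Qgrp \<Phi> lam m) (Qt \<inter> (\<Inter>r\<in>{k..l}. PI \<Phi> lam Ifam (I r))) (thb k))"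
proof -
  obtain h where "positive_system \<Phi> \<Delta> h" using base_positive_system[OF assms(1,3)] by blast
  then interpret positive_system \<Phi> \<Delta> h .
  have "dom (lam i)" if "i \<in> {1..m}" for i
    using assms(5) that by (auto simp: dominant_weight_def dom_simple)
  moreover have "independent \<Delta>" using assms(3) by (simp add: base_def)
  ultimately interpret lsm_data \<Phi> \<Delta> h lam m Ifam \<tau>
    using assms(4,6,7) by unfold_locales
  obtain thb where D: "defining_chain \<Phi> \<Delta> Q P Ifam \<tau> l th I thb"
    using assms(9) by (auto simp: max_tau_standard_def tau_standard_def)
  let ?D = "\<lambda>k. (thb k, I k)"
  note max = assms(9)
  note full = max_tau_standard_full[OF max D]
  have ch: "chains.ch l ?D" using D by (simp add: defining_chain_iff)
  then have X: "I j \<in> Ifam" if "j \<le> l" for j using that by (auto simp: chains.ch_def chains.X_def)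
  have "max_bchain \<Phi> \<Delta> Q Ifam \<tau> l thb I"
    unfolding max_bchain_def bchain_iff chain_elems_eq
  proof (intro conjI allI impI ch)
    fix l' th' I'
    assume "chains.ch l' (\<lambda>k. (th' k, I' k)) \<and> ?D ` {..l} \<subseteq> (\<lambda>k. (th' k, I' k)) ` {..l'}"
    then show "(\<lambda>k. (th' k, I' k)) ` {..l'} = ?D ` {..l}"
      unfolding full(1) by (elim conjE) (rule chains.full_maximal[OF full(2)])
  qed
  moreover have top: "thb l = \<tau>" "I l = {1..m}"
    using chains.full_top[OF full(2)] full(1) by auto
  moreover have "thb 0 = coset id Q" using chains.full_bot[OF full(2)] by simp
  moreover have "l = wrank \<Delta> \<tau> + m - 1" using full(1) by (simp add: chains.N_def)
  moreover have "is_pmin \<Phi> \<Delta> Q (\<Inter>r\<in>{0..k}. P (I r)) (thb k) \<and>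
      is_pmax \<Phi> \<Delta> Q (Qt \<inter> (\<Inter>r\<in>{k..l}. P (I r))) (thb k)" if k: "k \<le> l" for k
  proof
    obtain Jt where Jt: "Jt \<subseteq> \<Delta>" "Qt = weyl Jt" "Q \<subseteq> Qt" "is_pmax \<Phi> \<Delta> Q Qt \<tau>"
      using assms(8) by (auto simp: is_Qtau_def)
    then have Qt: "parabolic Qt" using parabolic_weyl by blast
    then have "lift_max Qt (thb l)" using is_pmax_iff_lift_max Jt(4) top(1) by blast
    then have "lift_max (Qt \<inter> (\<Inter>r\<in>{k..l}. P (I r))) (thb k)"
      using defining_chain_lift_max[OF max D Qt _ k] by blast
    moreover have "parabolic (Qt \<inter> (\<Inter>r\<in>{k..l}. P (I r)))"
      using X k Qt by (intro parabolic_Int parabolic_INT parabolic_P) auto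
    ultimately show "is_pmax \<Phi> \<Delta> Q (Qt \<inter> (\<Inter>r\<in>{k..l}. P (I r))) (thb k)"
      using is_pmax_iff_lift_max by blast
    have "parabolic (\<Inter>r\<in>{0..k}. P (I r))" using X k by (intro parabolic_INT parabolic_P) auto
    then show "is_pmin \<Phi> \<Delta> Q (\<Inter>r\<in>{0..k}. P (I r)) (thb k)"
      using is_pmin_iff_lift_min defining_chain_lift_min[OF max D k] by blast
  qed
  ultimately show ?thesis using D defining_chain_unique[OF max D] by blast
qed

end
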